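(* Let $\zeta_1,\zeta_2$ be any two points on the unit circle $\mathbb{T}$ such that the angle between them, considered as vectors in $\mathbb{R}^2$, is $90^\circ$. Let $\mu=\delta_{\zeta_1}+\delta_{\zeta_2}$, where $\delta_\zeta$ denotes the Dirac measure at $\zeta$. Then the Cauchy dual $M_z'=M_z(M_z^*M_z)^{-1}$ of the operator $M_z$ of multiplication by the coordinate function $z$ on the Dirichlet-type space $D(\mu)$ is not subnormal.
   Context: Let $\mathbb{D}$ be the open unit disc, $\mathbb{T}$ the unit circle, and $H^2$ the Hardy space of holomorphic functions $f(z)=\sum_{n\ge 0}a_nz^n$ on $\mathbb{D}$ with $\|f\|_{H^2}^2=\sum|a_n|^2<\infty$. For a finite positive Borel measure $\mu$ on $\mathbb{T}$, put $P_\mu(z)=\int_{\mathbb{T}}\frac{1-|z|^2}{|z-\zeta|^2}\,d\mu(\zeta)$ for $z\in\mathbb{D}$. The Dirichlet-type space is $D(\mu)=\{f \text{ holomorphic on }\mathbb{D}: \int_{\mathbb{D}}|f'(z)|^2P_\mu(z)\,dA(z)<\infty\}$, where $dA$ is the normalized Lebesgue area measure on $\mathbb{D}$ (so $A(\mathbb{D})=1$). It is contained in $H^2$ and is a reproducing kernel Hilbert space with norm $\|f\|_\mu^2=\|f\|_{H^2}^2+\int_{\mathbb{D}}|f'(z)|^2P_\mu(z)\,dA(z)$. The operator $M_z$, $(M_zf)(z)=zf(z)$, is bounded and left invertible on $D(\mu)$. For a left invertible bounded operator $T$ on a Hilbert space, its Cauchy dual is $T'=T(T^*T)^{-1}$.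 A bounded operator $T$ on a Hilbert space $\mathcal{H}$ is subnormal if there exist a Hilbert space $\mathcal{K}\supseteq\mathcal{H}$ and a normal bounded operator $S$ on $\mathcal{K}$ such that $S|_{\mathcal{H}}=T$. *)

theory Defs
  imports
    "HOL-Analysis.Analysis"
    "HOL-Complex_Analysis.Complex_Analysis"
    "HOL-Probability.Giry_Monad"
    "HOL-Library.Function_Algebras"
begin

section \<open>Complex Hilbert spaces with an explicit carrier\<close>

text \<open>
  The spaces \<open>D(\<mu>)\<close> depend on a parameter, so a Hilbert space is a subspace \<open>H\<close> of an ambient
  complex vector space with an inner product that matters on \<open>H\<close> only. Likewise, operators are
  functions on the ambient type that matter on \<open>H\<close> only. Inner products are linear in the first
  argument.
\<close>

definition ip_norm :: "('v \<Rightarrow> 'v \<Rightarrow> complex) \<Rightarrow> 'v \<Rightarrow> real" where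
  "ip_norm ip x = sqrt (Re (ip x x))"

locale complex_hilbert_space = vector_space scl
  for scl :: "complex \<Rightarrow> 'v::ab_group_add \<Rightarrow> 'v" +
  fixes H :: "'v set" and ip :: "'v \<Rightarrow> 'v \<Rightarrow> complex"
  assumes subspace_H: "subspace H"
    and ip_add: "\<lbrakk>x \<in> H; y \<in> H; z \<in> H\<rbrakk> \<Longrightarrow> ip (x + y) z = ip x z + ip y z"
    and ip_scale: "\<lbrakk>x \<in> H; y \<in> H\<rbrakk> \<Longrightarrow> ip (scl c x) y = c * ip x y"
    and ip_cnj: "\<lbrakk>x \<in> H; y \<in> H\<rbrakk> \<Longrightarrow> ip y x = cnj (ip x y)"
    and ip_pos: "\<lbrakk>x \<in> H; x \<noteq> 0\<rbrakk> \<Longrightarrow> Re (ip x x) > 0"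
    and ip_complete:
      "\<lbrakk>\<And>n. X n \<in> H; \<And>e. e > 0 \<Longrightarrow> \<exists>N. \<forall>m\<ge>N. \<forall>n\<ge>N. ip_norm ip (X m - X n) < e\<rbrakk>
        \<Longrightarrow> \<exists>x\<in>H. (\<lambda>n. ip_norm ip (X n - x)) \<longlonglongrightarrow> 0"

definition linear_map_on ::
  "(complex \<Rightarrow> 'v::ab_group_add \<Rightarrow> 'v) \<Rightarrow> 'v set \<Rightarrow>
   (complex \<Rightarrow> 'w::ab_group_add \<Rightarrow> 'w) \<Rightarrow> 'w set \<Rightarrow> ('v \<Rightarrow> 'w) \<Rightarrow> bool" where
  "linear_map_on scaleH H scaleK K T \<longleftrightarrow>
     T \<in> H \<rightarrow> K \<and>
     (\<forall>x\<in>H. \<forall>y\<in>H. T (x + y) = T x + T y) \<and>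
     (\<forall>c. \<forall>x\<in>H. T (scaleH c x) = scaleK c (T x))"

definition bounded_operator_on ::
  "(complex \<Rightarrow> 'v::ab_group_add \<Rightarrow> 'v) \<Rightarrow> 'v set \<Rightarrow> ('v \<Rightarrow> 'v \<Rightarrow> complex) \<Rightarrow> ('v \<Rightarrow> 'v) \<Rightarrow> bool" where
  "bounded_operator_on scl H ip T \<longleftrightarrow>
     linear_map_on scl H scl H T \<and> (\<exists>C. \<forall>x\<in>H. ip_norm ip (T x) \<le> C * ip_norm ip x)"

definition adjoint_on :: "'v set \<Rightarrow> ('v \<Rightarrow> 'v \<Rightarrow> complex) \<Rightarrow> ('v \<Rightarrow> 'v) \<Rightarrow> 'v \<Rightarrow> 'v" where
  "adjoint_on H ip T y = (THE w. w \<in> H \<and> (\<forall>x\<in>H. ip (T x) y = ip x w))"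

definition normal_operator_on ::
  "(complex \<Rightarrow> 'v::ab_group_add \<Rightarrow> 'v) \<Rightarrow> 'v set \<Rightarrow> ('v \<Rightarrow> 'v \<Rightarrow> complex) \<Rightarrow> ('v \<Rightarrow> 'v) \<Rightarrow> bool" where
  "normal_operator_on scl H ip S \<longleftrightarrow>
     bounded_operator_on scl H ip S \<and>
     (\<forall>x\<in>H. S (adjoint_on H ip S x) = adjoint_on H ip S (S x))"

definition cauchy_dual :: "'v set \<Rightarrow> ('v \<Rightarrow> 'v \<Rightarrow> complex) \<Rightarrow> ('v \<Rightarrow> 'v) \<Rightarrow> 'v \<Rightarrow> 'v" where
  "cauchy_dual H ip T = T \<circ> inv_into H (adjoint_on H ip T \<circ> T)"

text \<open>
  The inclusion of \<open>H\<close> in the larger Hilbert space \<open>K\<close> is an isometric linear embedding \<open>V\<close>, and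
  the restriction of \<open>S\<close> to \<open>H\<close> being \<open>T\<close> reads \<open>S \<circ> V = V \<circ> T\<close> on \<open>H\<close>. HOL cannot quantify over
  types inside a formula, so the ambient type \<open>'k\<close> of \<open>K\<close> is a parameter: non-subnormality is the
  negation for an arbitrary (schematic) \<open>'k\<close>.
\<close>

definition subnormal_in ::
  "'k::ab_group_add itself \<Rightarrow> (complex \<Rightarrow> 'v::ab_group_add \<Rightarrow> 'v) \<Rightarrow> 'v set \<Rightarrow>
   ('v \<Rightarrow> 'v \<Rightarrow> complex) \<Rightarrow> ('v \<Rightarrow> 'v) \<Rightarrow> bool" where
  "subnormal_in _ scaleH H ipH T \<longleftrightarrow>
     (\<exists>(scaleK :: complex \<Rightarrow> 'k \<Rightarrow> 'k) K ipK V S.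
        complex_hilbert_space scaleK K ipK \<and>
        linear_map_on scaleH H scaleK K V \<and>
        (\<forall>x\<in>H. \<forall>y\<in>H. ipK (V x) (V y) = ipH x y) \<and>
        normal_operator_on scaleK K ipK S \<and>
        (\<forall>x\<in>H. S (V x) = V (T x)))"


section \<open>Measures on the circle\<close>

definition circle_borel :: "complex measure" where
  "circle_borel = restrict_space borel (sphere 0 1)"

definition dirac :: "complex \<Rightarrow> complex measure" where
  "dirac \<zeta> = return circle_borel \<zeta>"

definition add_measure :: "'a measure \<Rightarrow> 'a measure \<Rightarrow> 'a measure" where
  "add_measure M N = measure_of (space M) (sets M) (\<lambda>A. emeasure M A + emeasure N A)"

lemma emeasure_add_measure:
  assumes "sets N = sets M" "A \<in> sets M"
  shows "emeasure (add_measure M N) A = emeasure M A + emeasure N A"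
proof (rule emeasure_measure_of[OF add_measure_def])
  show "countably_additive (sets (add_measure M N)) (\<lambda>A. emeasure M A + emeasure N A)"
  proof (rule countably_additiveI)
    fix F :: "nat \<Rightarrow> 'a set"
    assume F: "range F \<subseteq> sets (add_measure M N)" "disjoint_family F"
    have M: "range F \<subseteq> sets M" and N: "range F \<subseteq> sets N"
      using F(1) assms(1) by (simp_all add: add_measure_def sets.space_closed)
    have "(\<Sum>i. emeasure M (F i) + emeasure N (F i)) = (\<Sum>i. emeasure M (F i)) + (\<Sum>i. emeasure N (F i))"
      by (rule suminf_add[symmetric]) auto
    then show "(\<Sum>i. emeasure M (F i) + emeasure N (F i))
        = emeasure M (\<Union>i. F i) + emeasure N (\<Union>i. F i)"
      by (simp add: suminf_emeasure[OF M F(2)] suminf_emeasure[OF N F(2)])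
  qed
qed (use assms(2) in \<open>auto simp: add_measure_def positive_def sets.space_closed dest: sets.sets_into_space\<close>)


section \<open>Dirichlet-type spaces\<close>

definition poisson :: "complex measure \<Rightarrow> complex \<Rightarrow> real" where
  "poisson \<mu> z = (\<integral>\<zeta>. (1 - (cmod z)\<^sup>2) / (cmod (z - \<zeta>))\<^sup>2 \<partial>\<mu>)"

text \<open>Lebesgue area measure on the disc, normalized to total mass 1.\<close>

definition disc_area :: "complex measure" where
  "disc_area = uniform_measure lborel (ball 0 1)"

text \<open>
  A holomorphic function on the open unit disc is represented by its extension by zero to the
  complex plane, so that distinct elements of \<open>Dspace \<mu>\<close> are distinct as functions on the disc.
\<close>

definition Dspace :: "complex measure \<Rightarrow> (complex \<Rightarrow> complex) set" where
  "Dspace \<mu> = {f. f holomorphic_on ball 0 1 \<and> (\<forall>z. z \<notin> ball 0 1 \<longrightarrow> f z = 0) \<and>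
     set_nn_integral disc_area (ball 0 1) (\<lambda>z. ennreal ((cmod (deriv f z))\<^sup>2 * poisson \<mu> z)) < \<infinity>}"

definition taylor_coeff :: "(complex \<Rightarrow> complex) \<Rightarrow> nat \<Rightarrow> complex" where
  "taylor_coeff f n = (deriv ^^ n) f 0 / fact n"

definition hardy_inner :: "(complex \<Rightarrow> complex) \<Rightarrow> (complex \<Rightarrow> complex) \<Rightarrow> complex" where
  "hardy_inner f g = (\<Sum>n. taylor_coeff f n * cnj (taylor_coeff g n))"

text \<open>The inner product that induces the norm
  \<open>\<parallel>f\<parallel>\<^sub>\<mu>\<^sup>2 = \<parallel>f\<parallel>\<^sup>2 + \<integral> \<bar>f'\<bar>\<^sup>2 P\<^sub>\<mu> dA\<close>, the first term on the right being the norm of \<open>H\<^sup>2\<close>.\<close>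

definition Dinner :: "complex measure \<Rightarrow> (complex \<Rightarrow> complex) \<Rightarrow> (complex \<Rightarrow> complex) \<Rightarrow> complex" where
  "Dinner \<mu> f g = hardy_inner f g +
     set_lebesgue_integral disc_area (ball 0 1)
       (\<lambda>z. deriv f z * cnj (deriv g z) * complex_of_real (poisson \<mu> z))"

text \<open>Addition of functions is the pointwise one of \<^theory>\<open>HOL-Library.Function_Algebras\<close>.\<close>

definition fun_scale :: "complex \<Rightarrow> (complex \<Rightarrow> complex) \<Rightarrow> complex \<Rightarrow> complex" where
  "fun_scale c f = (\<lambda>z. c * f z)"

lemma vector_space_fun_scale: "vector_space fun_scale"
  by unfold_locales (auto simp: fun_scale_def fun_eq_iff algebra_simps)

definition Mz :: "(complex \<Rightarrow> complex) \<Rightarrow> complex \<Rightarrow> complex" where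
  "Mz f = (\<lambda>z. z * f z)"


section \<open>Angles\<close>

definition vec_angle :: "'a::real_inner \<Rightarrow> 'a \<Rightarrow> real" where
  "vec_angle x y = arccos (inner x y / (norm x * norm y))"

end

theory Submission
  imports Defs
begin

text \<open>
  Write \<open>T = M\<^sub>z\<close>. If \<open>f = \<Sum> a\<^sub>k z\<^sup>k\<close>, then the weighted Dirichlet integral of \<open>f\<close> for the point mass
  at \<open>\<zeta>\<close> is a weighted Bergman norm of \<open>f' / (z - \<zeta>)\<close>, which Parseval's identity turns into
  \<open>\<Sum> \<bar>s\<^sub>n\<bar>\<^sup>2 / (n (n + 1))\<close> with \<open>s\<^sub>n = \<Sum>\<^bsub>k\<le>n\<^esub> k a\<^sub>k \<zeta>\<^sup>k\<close>. A telescoping identity gives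
  \<open>\<langle>T f, T g\<rangle> = \<langle>f, g\<rangle> + \<Sum>\<^sub>i f(\<zeta>\<^sub>i) cnj (g(\<zeta>\<^sub>i))\<close>, that is, \<open>T\<^sup>* T = 1 + k\<^sub>1 \<otimes> k\<^sub>1 + k\<^sub>2 \<otimes> k\<^sub>2\<close>, where \<open>k\<^sub>i\<close>
  represents the boundary value at \<open>\<zeta>\<^sub>i\<close>. Hence \<open>Q = 1 - T'\<^sup>* T'\<close> has rank two and \<open>T'\<close> induces on the
  quotient by its kernel a \<open>2 \<times> 2\<close> matrix that is explicit in terms of \<open>\<zeta>\<^sub>1\<close>, \<open>\<zeta>\<^sub>2\<close> and the Gram matrix
  of \<open>k\<^sub>1, k\<^sub>2\<close>. If \<open>T'\<close> were subnormal, then this matrix would have \<open>Q\<close>-orthogonal eigenvectors, since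
  finite-dimensional invariant subspaces of normal operators reduce them. This forces
  \<open>\<zeta>\<^sub>1 cnj \<zeta>\<^sub>2\<close> to be real or \<open>\<langle>k\<^sub>1, k\<^sub>2\<rangle> = 0\<close>. The former is false for orthogonal \<open>\<zeta>\<^sub>1, \<zeta>\<^sub>2\<close>; the latter
  would make \<open>(k\<^sub>1 - 1) / z\<close> a multiple of \<open>k\<^sub>1\<close>, whose value at \<open>\<zeta>\<^sub>2\<close> vanishes, and so give
  \<open>k\<^sub>1(\<zeta>\<^sub>2) = 1\<close>.
\<close>

section \<open>Complex Hilbert spaces\<close>

context complex_hilbert_space
begin

lemmas H_zero [simp] = subspace_0[OF subspace_H]
lemmas H_add [simp] = subspace_add[OF subspace_H]
lemmas H_scale [simp] = subspace_scale[OF subspace_H]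
lemmas H_diff [simp] = subspace_diff[OF subspace_H]

lemma ip_zero_left: "y \<in> H \<Longrightarrow> ip 0 y = 0"
  using ip_scale[of 0 y 0] by simp

lemma ip_zero_right: "y \<in> H \<Longrightarrow> ip y 0 = 0"
  using ip_cnj[of 0 y] ip_zero_left by simp

lemma ip_diff:
  assumes "x \<in> H" "y \<in> H" "z \<in> H"
  shows "ip (x - y) z = ip x z - ip y z"
  using ip_add[of "x - y" y z] assms by simp

lemma ip_add_right:
  assumes "x \<in> H" "y \<in> H" "z \<in> H"
  shows "ip z (x + y) = ip z x + ip z y"
  using assms by (simp add: ip_cnj[of _ z] ip_add)

lemma ip_diff_right:
  assumes "x \<in> H" "y \<in> H" "z \<in> H"
  shows "ip z (x - y) = ip z x - ip z y"
  using assms by (simp add: ip_cnj[of _ z] ip_diff)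

lemma ip_scale_right:
  assumes "x \<in> H" "z \<in> H"
  shows "ip z (scl c x) = cnj c * ip z x"
  using assms by (simp add: ip_cnj[of _ z] ip_scale)

lemmas ip_expand = ip_add ip_diff ip_scale ip_add_right ip_diff_right ip_scale_right

lemma Im_ip_self: "x \<in> H \<Longrightarrow> Im (ip x x) = 0"
  using ip_cnj[of x x] by (metis Reals_cnj_iff complex_is_Real_iff)

lemma ip_self: "x \<in> H \<Longrightarrow> ip x x = of_real (Re (ip x x))"
  by (simp add: complex_eq_iff Im_ip_self)

lemma Re_ip_self_nonneg: "x \<in> H \<Longrightarrow> 0 \<le> Re (ip x x)"
  by (cases "x = 0") (auto simp: ip_zero_left dest: ip_pos)

lemma ip_self_eq_0: "x \<in> H \<Longrightarrow> Re (ip x x) = 0 \<Longrightarrow> x = 0"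
  using ip_pos by force

lemma ip_norm_nonneg: "x \<in> H \<Longrightarrow> 0 \<le> ip_norm ip x"
  by (simp add: ip_norm_def Re_ip_self_nonneg)

lemma ip_norm_sq: "x \<in> H \<Longrightarrow> (ip_norm ip x)\<^sup>2 = Re (ip x x)"
  by (simp add: ip_norm_def Re_ip_self_nonneg)

lemma ip_ext:
  assumes "x \<in> H" "y \<in> H" "\<And>z. z \<in> H \<Longrightarrow> ip z x = ip z y"
  shows "x = y"
proof -
  have "ip (x - y) (x - y) = 0"
    using assms by (simp add: ip_diff_right)
  then show ?thesis
    using ip_self_eq_0[of "x - y"] assms(1,2) by simp
qed

text \<open>Pythagoras for the projection of \<open>x\<close> onto the line of \<open>h\<close>.
  Nonnegativity of the left side yields the Cauchy-Schwarz inequality; comparison with a minimal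
  norm yields orthogonality in the representation theorem.\<close>

lemma ip_residual:
  assumes "x \<in> H" "h \<in> H" "h \<noteq> 0"
  defines "c \<equiv> ip x h / ip h h"
  shows "Re (ip (x - scl c h) (x - scl c h)) = Re (ip x x) - (cmod (ip x h))\<^sup>2 / Re (ip h h)"
proof -
  define r where "r = Re (ip h h)"
  have r: "ip h h = of_real r" "r > 0"
    using ip_self[OF assms(2)] ip_pos[OF assms(2,3)] by (auto simp: r_def)
  have "ip (x - scl c h) (x - scl c h)
      = ip x x - cnj c * ip x h - c * cnj (ip x h) + c * cnj c * of_real r"
    using assms(1,2) by (simp add: ip_expand r ip_cnj[of x h] algebra_simps)
  also have "\<dots> = ip x x - ip x h * cnj (ip x h) / of_real r"
    using r(2) by (simp add: c_def r field_simps)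
  also have "\<dots> = ip x x - of_real ((cmod (ip x h))\<^sup>2 / r)"
    by (simp only: complex_norm_square[symmetric] of_real_divide)
  finally show ?thesis by (simp add: r_def)
qed

lemma cauchy_schwarz:
  assumes "x \<in> H" "y \<in> H"
  shows "cmod (ip x y) \<le> ip_norm ip x * ip_norm ip y"
proof (cases "y = 0")
  case True
  then show ?thesis using assms by (simp add: ip_zero_right ip_norm_def)
next
  case False
  then have pos: "Re (ip y y) > 0" using assms ip_pos by blast
  have "0 \<le> Re (ip x x) - (cmod (ip x y))\<^sup>2 / Re (ip y y)"
    using ip_residual[OF assms False] Re_ip_self_nonneg[of "x - scl (ip x y / ip y y) y"] assms
    by simp
  then have "(cmod (ip x y))\<^sup>2 \<le> Re (ip x x) * Re (ip y y)"
    using pos by (simp add: field_simps)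
  also have "\<dots> = (ip_norm ip x * ip_norm ip y)\<^sup>2"
    using assms by (simp add: power_mult_distrib ip_norm_sq)
  finally show ?thesis
    by (rule power2_le_imp_le) (intro mult_nonneg_nonneg ip_norm_nonneg assms)
qed

lemma ip_norm_triangle:
  assumes "x \<in> H" "y \<in> H"
  shows "ip_norm ip (x + y) \<le> ip_norm ip x + ip_norm ip y"
proof (rule power2_le_imp_le)
  have "Re (ip x y) \<le> ip_norm ip x * ip_norm ip y"
    using cauchy_schwarz[OF assms] complex_Re_le_cmod order_trans by blast
  moreover have "(ip_norm ip (x + y))\<^sup>2 = Re (ip x x) + 2 * Re (ip x y) + Re (ip y y)"
    using assms by (simp add: ip_norm_sq ip_expand ip_cnj[of x y])
  ultimately show "(ip_norm ip (x + y))\<^sup>2 \<le> (ip_norm ip x + ip_norm ip y)\<^sup>2"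
    using assms by (simp add: power2_sum ip_norm_sq)
qed (intro add_nonneg_nonneg ip_norm_nonneg assms)

text \<open>The vectors on which \<open>\<phi>\<close> equals 1 include one of least norm. It is
  orthogonal to the kernel of \<open>\<phi>\<close>, and a multiple of it represents
  \<open>\<phi>\<close>.\<close>

theorem riesz_representation:
  assumes add: "\<And>x y. x \<in> H \<Longrightarrow> y \<in> H \<Longrightarrow> \<phi> (x + y) = \<phi> x + \<phi> y"
    and scale: "\<And>c x. x \<in> H \<Longrightarrow> \<phi> (scl c x) = c * \<phi> x"
    and bound: "\<And>x. x \<in> H \<Longrightarrow> cmod (\<phi> x) \<le> C * ip_norm ip x"
  shows "\<exists>w\<in>H. \<forall>x\<in>H. \<phi> x = ip x w"
proof (cases "\<forall>x\<in>H. \<phi> x = 0")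
  case True
  then show ?thesis by (intro bexI[of _ 0]) (simp_all add: ip_zero_right)
next
  case False
  then obtain x0 where x0: "x0 \<in> H" "\<phi> x0 \<noteq> 0" by blast
  have \<phi>_diff: "\<phi> (x - y) = \<phi> x - \<phi> y" if "x \<in> H" "y \<in> H" for x y
    using add[of "x - y" y] that by simp
  define D where "D = {x \<in> H. \<phi> x = 1}"
  define d where "d = (INF x\<in>D. Re (ip x x))"
  have "scl (1 / \<phi> x0) x0 \<in> D" using x0 by (simp add: D_def scale)
  then have D_ne: "D \<noteq> {}" by blast
  have bdd: "bdd_below ((\<lambda>x. Re (ip x x)) ` D)"
    by (rule bdd_belowI[of _ 0]) (auto simp: D_def Re_ip_self_nonneg)
  have d_le: "d \<le> Re (ip x x)" if "x \<in> D" for x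
    unfolding d_def by (rule cINF_lower[OF bdd that])
  have "\<exists>x\<in>D. Re (ip x x) < d + 1 / Suc n" for n
    using cINF_less_iff[OF D_ne bdd, of "d + 1 / Suc n"] by (simp add: d_def)
  then obtain X where X: "\<And>n. X n \<in> D" "\<And>n. Re (ip (X n) (X n)) < d + 1 / Suc n"
    by metis
  have XH: "X n \<in> H" for n using X(1) by (simp add: D_def)
  \<comment> \<open>Parallelogram law: the midpoint of \<open>X m\<close> and \<open>X n\<close>
    lies in \<open>D\<close> again, so its squared norm is at least \<open>d\<close>. Hence the
    minimizing sequence is Cauchy.\<close>
  have close: "(ip_norm ip (X m - X n))\<^sup>2 \<le> 2 / Suc m + 2 / Suc n" for m n
  proof -
    let ?h = "scl (1/2) (X m + X n)"
    have "?h \<in> D" using X(1) by (simp add: D_def scale add)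
    then have "d \<le> Re (ip ?h ?h)" by (rule d_le)
    moreover have "4 * Re (ip ?h ?h) = Re (ip (X m + X n) (X m + X n))"
      using XH by (simp add: ip_scale ip_scale_right)
    moreover have "Re (ip (X m - X n) (X m - X n)) + Re (ip (X m + X n) (X m + X n))
        = 2 * Re (ip (X m) (X m)) + 2 * Re (ip (X n) (X n))"
      using XH by (simp add: ip_expand)
    ultimately show ?thesis
      using X(2)[of m] X(2)[of n] XH by (simp add: ip_norm_sq)
  qed
  have "\<exists>x\<in>H. (\<lambda>n. ip_norm ip (X n - x)) \<longlonglongrightarrow> 0"
  proof (rule ip_complete[OF XH])
    fix e :: real assume e: "e > 0"
    obtain N where N: "4 / Suc N < e\<^sup>2"
      using reals_Archimedean[of "e\<^sup>2 / 4"] e by (auto simp: field_simps)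
    have "ip_norm ip (X m - X n) < e" if "m \<ge> N" "n \<ge> N" for m n
    proof (rule power2_less_imp_less)
      have "2 / real (Suc m) \<le> 2 / Suc N" "2 / real (Suc n) \<le> 2 / Suc N"
        using that by (auto intro!: divide_left_mono)
      then show "(ip_norm ip (X m - X n))\<^sup>2 < e\<^sup>2"
        using close[of m n] N by linarith
    qed (use e in simp)
    then show "\<exists>N. \<forall>m\<ge>N. \<forall>n\<ge>N. ip_norm ip (X m - X n) < e" by blast
  qed
  then obtain x where x: "x \<in> H" "(\<lambda>n. ip_norm ip (X n - x)) \<longlonglongrightarrow> 0" by blast
  have "(\<lambda>n. \<phi> (X n - x)) \<longlonglongrightarrow> 0"
  proof (rule Lim_null_comparison)
    show "\<forall>\<^sub>F n in sequentially. cmod (\<phi> (X n - x)) \<le> C * ip_norm ip (X n - x)"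
      using bound XH x(1) by simp
    show "(\<lambda>n. C * ip_norm ip (X n - x)) \<longlonglongrightarrow> 0"
      using tendsto_mult_left[OF x(2), of C] by simp
  qed
  then have "(\<lambda>n. 1 - \<phi> x) \<longlonglongrightarrow> 0"
    using X(1) x(1) by (simp add: \<phi>_diff D_def)
  then have \<phi>x: "\<phi> x = 1" by (simp add: LIMSEQ_const_iff)
  \<comment> \<open>The limit \<open>x\<close> is a minimizer: the triangle inequality bounds its
    squared norm by a sequence that tends to \<open>d\<close>.\<close>
  have "(\<lambda>n. (ip_norm ip (X n - x) + sqrt (d + 1 / Suc n))\<^sup>2) \<longlonglongrightarrow> (0 + sqrt (d + 0))\<^sup>2"
    by (intro tendsto_intros x(2) LIMSEQ_Suc[OF lim_1_over_n])
  moreover have "Re (ip x x) \<le> (ip_norm ip (X n - x) + sqrt (d + 1 / Suc n))\<^sup>2" for n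
  proof -
    have "ip_norm ip (x - X n) = ip_norm ip (X n - x)"
      using x(1) XH[of n] by (simp add: ip_norm_def ip_expand)
    then have "ip_norm ip x \<le> ip_norm ip (X n - x) + ip_norm ip (X n)"
      using ip_norm_triangle[of "x - X n" "X n"] x(1) XH[of n] by simp
    also have "ip_norm ip (X n) \<le> sqrt (d + 1 / Suc n)"
      using X(2)[of n] by (simp add: ip_norm_def)
    finally show ?thesis
      using power_mono[OF _ ip_norm_nonneg[OF x(1)], of _ 2] x(1) by (simp add: ip_norm_sq)
  qed
  moreover have "0 \<le> d"
    unfolding d_def using D_ne by (intro cINF_greatest) (auto simp: D_def Re_ip_self_nonneg)
  ultimately have x_min: "Re (ip x x) \<le> d"
    by (intro LIMSEQ_le_const[of "\<lambda>n. (ip_norm ip (X n - x) + sqrt (d + 1 / Suc n))\<^sup>2"]) auto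
  \<comment> \<open>Subtracting from \<open>x\<close> its projection onto \<open>h\<close> does not
    leave \<open>D\<close>, but it would lower the norm below the minimum unless \<open>x\<close> is
    orthogonal to \<open>h\<close>.\<close>
  have orth: "ip h x = 0" if h: "h \<in> H" "\<phi> h = 0" for h
  proof (cases "h = 0")
    case True
    then show ?thesis using x(1) by (simp add: ip_zero_left)
  next
    case False
    have "x - scl (ip x h / ip h h) h \<in> D"
      using x(1) h by (simp add: D_def \<phi>_diff \<phi>x scale)
    then have "(cmod (ip x h))\<^sup>2 / Re (ip h h) \<le> 0"
      using ip_residual[OF x(1) h(1) False] d_le x_min by fastforce
    then have "ip x h = 0"
      using ip_pos[OF h(1) False] by (simp add: field_simps mult_le_0_iff)
    then show ?thesis using ip_cnj[OF x(1) h(1)] by simp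
  qed
  have "x \<noteq> 0"
    using \<phi>x scale[OF H_zero, of 0] by auto
  then have "ip x x \<noteq> 0" using ip_pos[OF x(1)] by force
  have "\<phi> f = ip f (scl (1 / ip x x) x)" if f: "f \<in> H" for f
  proof -
    have "ip (f - scl (\<phi> f) x) x = 0"
      by (rule orth) (use f x(1) in \<open>simp_all add: \<phi>_diff scale \<phi>x\<close>)
    then have "ip f x = \<phi> f * ip x x" using f x(1) by (simp add: ip_diff ip_scale)
    moreover have "cnj (ip x x) = ip x x" using ip_cnj[OF x(1) x(1)] by simp
    ultimately show ?thesis
      using f x(1) \<open>ip x x \<noteq> 0\<close> by (simp add: ip_scale_right)
  qed
  then show ?thesis using x(1) by (intro bexI[of _ "scl (1 / ip x x) x"]) auto
qed

lemma adjoint_on_eqI: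
  assumes "w \<in> H" "\<And>x. x \<in> H \<Longrightarrow> ip (T x) y = ip x w"
  shows "adjoint_on H ip T y = w"
  unfolding adjoint_on_def
proof (rule the_equality)
  show "w \<in> H \<and> (\<forall>x\<in>H. ip (T x) y = ip x w)" using assms by blast
  fix w' assume w': "w' \<in> H \<and> (\<forall>x\<in>H. ip (T x) y = ip x w')"
  show "w' = w"
  proof (rule ip_ext)
    show "ip z w' = ip z w" if "z \<in> H" for z
      using w' assms(2)[OF that] that by auto
  qed (use w' assms(1) in auto)
qed

text \<open>\<open>adjoint_on\<close> is a definite description, so its defining property is
  available only after existence has been shown. The representation theorem, applied to the
  functional that sends \<open>x\<close> to \<open>ip (S x) y\<close>, provides it.\<close>

lemma bounded_operator_adjoint:
  assumes S: "bounded_operator_on scl H ip S" and y: "y \<in> H"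
  shows "adjoint_on H ip S y \<in> H"
    and "x \<in> H \<Longrightarrow> ip (S x) y = ip x (adjoint_on H ip S y)"
proof -
  have SH: "S x \<in> H" if "x \<in> H" for x
    using S that by (auto simp: bounded_operator_on_def linear_map_on_def)
  have lin: "S (x + y) = S x + S y" "S (scl c x) = scl c (S x)" if "x \<in> H" "y \<in> H" for x y c
    using S that by (auto simp: bounded_operator_on_def linear_map_on_def)
  obtain C where C: "\<And>x. x \<in> H \<Longrightarrow> ip_norm ip (S x) \<le> C * ip_norm ip x"
    using S by (auto simp: bounded_operator_on_def)
  have "\<exists>w\<in>H. \<forall>x\<in>H. ip (S x) y = ip x w"
  proof (rule riesz_representation)
    show "ip (S (x + z)) y = ip (S x) y + ip (S z) y" if "x \<in> H" "z \<in> H" for x z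
      using that y by (simp add: lin SH ip_add)
    show "ip (S (scl c x)) y = c * ip (S x) y" if "x \<in> H" for c x
      using that y by (simp add: lin SH ip_scale)
    show "cmod (ip (S x) y) \<le> (C * ip_norm ip y) * ip_norm ip x" if "x \<in> H" for x
      using cauchy_schwarz[OF SH[OF that] y] mult_right_mono[OF C[OF that] ip_norm_nonneg[OF y]]
      by (simp add: ac_simps)
  qed
  then obtain w where w: "w \<in> H" "\<And>x. x \<in> H \<Longrightarrow> ip (S x) y = ip x w" by blast
  then have "adjoint_on H ip S y = w" by (intro adjoint_on_eqI)
  with w show "adjoint_on H ip S y \<in> H" "x \<in> H \<Longrightarrow> ip (S x) y = ip x (adjoint_on H ip S y)"
    by auto
qed

end

section \<open>Subnormality and two-isometries with a defect of rank two\<close>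

text \<open>For normal \<open>S\<close> with adjoint \<open>S'\<close>, the vectors
  \<open>S' w\<close> and \<open>S w\<close> have equal norms. Expanding the squared norm of
  \<open>S' w - scl (cnj c) w\<close> therefore gives 0, as for
  \<open>S w - scl c w\<close>.\<close>

lemma (in complex_hilbert_space) normal_eigenvector_adjoint:
  assumes S: "normal_operator_on scl H ip S" and w: "w \<in> H" "S w = scl c w"
  shows "adjoint_on H ip S w = scl (cnj c) w"
proof -
  define S' where "S' = adjoint_on H ip S"
  have bnd: "bounded_operator_on scl H ip S" and comm: "\<And>x. x \<in> H \<Longrightarrow> S (S' x) = S' (S x)"
    using S by (auto simp: normal_operator_on_def S'_def)
  have SH: "S x \<in> H" if "x \<in> H" for x
    using bnd that by (auto simp: bounded_operator_on_def linear_map_on_def)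
  have S'H: "S' x \<in> H" if "x \<in> H" for x
    using bounded_operator_adjoint(1)[OF bnd] that by (simp add: S'_def)
  have adj: "ip (S x) y = ip x (S' y)" if "x \<in> H" "y \<in> H" for x y
    using bounded_operator_adjoint(2)[OF bnd that(2,1)] by (simp add: S'_def)
  have adj': "ip (S' y) x = ip y (S x)" if "x \<in> H" "y \<in> H" for x y
    using adj[OF that] ip_cnj[OF SH[OF that(1)] that(2)] ip_cnj[OF that(1) S'H[OF that(2)]] by simp
  have "ip (S' w) (S' w) = ip (S w) (S w)"
    using adj[of "S' w" w] adj'[of w "S w"] w(1) by (simp add: S'H SH comm)
  moreover have "ip w (S' w) = ip (S w) w" "ip (S' w) w = ip w (S w)"
    using w(1) by (simp_all add: adj adj')
  ultimately have "ip (S' w - scl (cnj c) w) (S' w - scl (cnj c) w) = 0"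
    using w S'H[OF w(1)] by (simp add: ip_expand)
  then have "S' w - scl (cnj c) w = 0"
    using w(1) S'H[OF w(1)] by (intro ip_self_eq_0) simp_all
  then show ?thesis by (simp add: S'_def)
qed

text \<open>
  With \<open>Q x y = \<langle>x, y\<rangle> - \<langle>T x, T y\<rangle>\<close>, the hypotheses say that
  \<open>(1 - S\<^sup>* S) (S - \<alpha>) (S - \<beta>) V x = 0\<close> for a normal extension \<open>S\<close> of \<open>T\<close>. Normality allows
  \<open>S - \<beta>\<close> to be replaced by its adjoint.
\<close>

lemma subnormal_defect_orthogonal:
  fixes \<alpha> \<beta> :: complex
  assumes sub: "subnormal_in TYPE('k::ab_group_add) scl H ip T"
    and H: "complex_hilbert_space scl H ip" and T: "T \<in> H \<rightarrow> H"
    and x: "x \<in> H" and z: "z \<in> H"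
  defines "Q \<equiv> \<lambda>u v. ip u v - ip (T u) (T v)"
  defines "p \<equiv> T (T x) - scl (\<alpha> + \<beta>) (T x) + scl (\<alpha> * \<beta>) x"
  assumes Q: "Q p p = 0" "Q (T p) (T p) = 0"
  shows "Q (T x - scl \<alpha> x) (T z - scl \<beta> z) = 0"
proof -
  interpret H: complex_hilbert_space scl H ip by fact
  obtain scaleK K ipK V S where K: "complex_hilbert_space scaleK K ipK"
    and V: "linear_map_on scl H scaleK K V"
    and isom: "\<And>x y. x \<in> H \<Longrightarrow> y \<in> H \<Longrightarrow> ipK (V x) (V y) = ip x y"
    and S: "normal_operator_on scaleK (K :: 'k set) ipK S"
    and SV: "\<And>x. x \<in> H \<Longrightarrow> S (V x) = V (T x)"
    using sub unfolding subnormal_in_def by blast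
  interpret K: complex_hilbert_space scaleK K ipK by fact
  define S' where "S' = adjoint_on K ipK S"
  have bnd: "bounded_operator_on scaleK K ipK S"
    and comm: "\<And>x. x \<in> K \<Longrightarrow> S (S' x) = S' (S x)"
    using S by (auto simp: normal_operator_on_def S'_def)
  have SK: "S x \<in> K" if "x \<in> K" for x
    using bnd that by (auto simp: bounded_operator_on_def linear_map_on_def)
  have S_add: "S (x + y) = S x + S y" if "x \<in> K" "y \<in> K" for x y
    using bnd that by (auto simp: bounded_operator_on_def linear_map_on_def)
  have S_scale: "S (scaleK c x) = scaleK c (S x)" if "x \<in> K" for x c
    using bnd that by (auto simp: bounded_operator_on_def linear_map_on_def)
  have S_diff: "S (x - y) = S x - S y" if "x \<in> K" "y \<in> K" for x y
    using S_add[of "x - y" y] that by simp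
  have S'K: "S' x \<in> K" if "x \<in> K" for x
    using K.bounded_operator_adjoint(1)[OF bnd] that by (simp add: S'_def)
  have adj: "ipK (S x) y = ipK x (S' y)" if "x \<in> K" "y \<in> K" for x y
    using K.bounded_operator_adjoint(2)[OF bnd that(2,1)] by (simp add: S'_def)
  have adj': "ipK (S' y) x = ipK y (S x)" if "x \<in> K" "y \<in> K" for x y
    using adj[OF that] K.ip_cnj[OF SK[OF that(1)] that(2)] K.ip_cnj[OF that(1) S'K[OF that(2)]]
    by simp
  have S'_add: "S' (x + y) = S' x + S' y" if "x \<in> K" "y \<in> K" for x y
    using that by (intro K.ip_ext) (simp_all add: S'K SK K.ip_add_right adj[symmetric])
  have S'_scale: "S' (scaleK c x) = scaleK c (S' x)" if "x \<in> K" for c x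
    using that by (intro K.ip_ext) (simp_all add: S'K SK K.ip_scale_right adj[symmetric])
  have S'_diff: "S' (x - y) = S' x - S' y" if "x \<in> K" "y \<in> K" for x y
    using S'_add[of "x - y" y] that by simp
  have VK: "V x \<in> K" if "x \<in> H" for x
    using V that by (auto simp: linear_map_on_def)
  have V_add: "V (x + y) = V x + V y" if "x \<in> H" "y \<in> H" for x y
    using V that by (auto simp: linear_map_on_def)
  have V_scale: "V (scl c x) = scaleK c (V x)" if "x \<in> H" for x c
    using V that by (auto simp: linear_map_on_def)
  have V_diff: "V (x - y) = V x - V y" if "x \<in> H" "y \<in> H" for x y
    using V_add[of "x - y" y] that by simp
  have TH: "T x \<in> H" if "x \<in> H" for x using T that by blast
  \<comment> \<open>\<open>D\<close> is \<open>1 - S' S\<close>. Its compression along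
    \<open>V\<close> is the form \<open>Q\<close>, and by normality it commutes with
    \<open>S\<close>.\<close>
  define D where "D v = v - S' (S v)" for v
  have DK: "D v \<in> K" if "v \<in> K" for v
    using that by (simp add: D_def SK S'K)
  have D_ip: "ipK (D (V u)) (V v) = Q u v" if "u \<in> H" "v \<in> H" for u v
    using that by (simp add: D_def Q_def K.ip_diff VK SK S'K TH adj' isom SV)
  have p: "p \<in> H" using x by (simp add: p_def TH)
  \<comment> \<open>Moving one factor \<open>S' S\<close> across the inner product and commuting
    \<open>S\<close> past \<open>D\<close> shows that the squared norm of \<open>D (V p)\<close> is
    \<open>Q p p - Q (T p) (T p)\<close>.\<close>
  have "ipK (D (V p)) (D (V p)) = Q p p - ipK (S (D (V p))) (S (V p))"
  proof -
    have "ipK (D (V p)) (D (V p)) = ipK (D (V p)) (V p) - ipK (D (V p)) (S' (S (V p)))"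
      using p K.ip_diff_right[of "V p" "S' (S (V p))" "D (V p)"]
      by (simp add: D_def[of "V p", symmetric] DK S'K SK VK)
    then show ?thesis using p by (simp add: D_ip adj DK SK VK)
  qed
  also have "ipK (S (D (V p))) (S (V p)) = Q (T p) (T p)"
    using p by (simp add: D_ip[OF TH[OF p] TH[OF p], symmetric] D_def S_diff comm S'K SK VK SV[symmetric])
  finally have "D (V p) = 0"
    using Q p by (intro K.ip_self_eq_0) (simp_all add: DK VK)
  define u where "u = T x - scl \<alpha> x"
  have u: "u \<in> H" using x by (simp add: u_def TH)
  \<comment> \<open>The quadratic polynomial factors, so \<open>V p\<close> is
    \<open>S - \<beta>\<close> applied to \<open>V u\<close>. As \<open>D\<close> commutes with
    \<open>S\<close>, it follows that \<open>S\<close> multiplies \<open>D (V u)\<close> by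
    \<open>\<beta>\<close>, and then its adjoint multiplies that vector by
    \<open>cnj \<beta>\<close>.\<close>
  have Vp: "V p = S (V u) - scaleK \<beta> (V u)"
    using x by (simp add: p_def u_def V_add V_diff V_scale S_diff S_scale SV TH VK
        K.scale_right_diff_distrib K.scale_left_distrib algebra_simps)
  have "D (V p) = S (D (V u)) - scaleK \<beta> (D (V u))"
    unfolding Vp using u by (simp add: D_def S_diff S_scale S'_diff S'_scale comm VK SK S'K
        K.scale_right_diff_distrib algebra_simps)
  then have "S (D (V u)) = scaleK \<beta> (D (V u))"
    using \<open>D (V p) = 0\<close> by simp
  then have eig: "S' (D (V u)) = scaleK (cnj \<beta>) (D (V u))"
    unfolding S'_def using u by (intro K.normal_eigenvector_adjoint[OF S]) (simp_all add: DK VK)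
  have "Q u (T z - scl \<beta> z) = ipK (D (V u)) (S (V z) - scaleK \<beta> (V z))"
    using u z by (simp add: D_ip[symmetric] TH V_diff V_scale SV)
  also have "\<dots> = ipK (S' (D (V u))) (V z) - cnj \<beta> * ipK (D (V u)) (V z)"
    using u z by (simp add: K.ip_diff_right K.ip_scale_right adj' DK VK SK)
  also have "\<dots> = 0"
    using u z by (simp add: eig K.ip_scale DK VK)
  finally show ?thesis by (simp add: u_def)
qed

text \<open>Abstract form of multiplication by the coordinate: \<open>E1\<close> and
  \<open>E2\<close> stand for the boundary values at \<open>\<zeta>1\<close> and
  \<open>\<zeta>2\<close>, and \<open>e\<close> for the constant function 1. The conditions on
  \<open>e\<close> and \<open>range_T\<close> make \<open>H\<close> the orthogonal sum of the line
  of \<open>e\<close> and the range of \<open>T\<close>. The last condition says that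
  \<open>\<zeta>1 * cnj \<zeta>2\<close> is not real.\<close>

locale rank_two_defect = complex_hilbert_space scl H ip
  for scl :: "complex \<Rightarrow> 'v::ab_group_add \<Rightarrow> 'v" and H ip +
  fixes T :: "'v \<Rightarrow> 'v" and E1 E2 :: "'v \<Rightarrow> complex" and \<zeta>1 \<zeta>2 :: complex and e :: 'v
  assumes T_in: "x \<in> H \<Longrightarrow> T x \<in> H"
    and E_add: "\<lbrakk>x \<in> H; y \<in> H\<rbrakk> \<Longrightarrow> E1 (x + y) = E1 x + E1 y"
      "\<lbrakk>x \<in> H; y \<in> H\<rbrakk> \<Longrightarrow> E2 (x + y) = E2 x + E2 y"
    and E_scale: "x \<in> H \<Longrightarrow> E1 (scl c x) = c * E1 x" "x \<in> H \<Longrightarrow> E2 (scl c x) = c * E2 x"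
    and E_bounded: "\<exists>C. \<forall>x\<in>H. cmod (E1 x) \<le> C * ip_norm ip x"
      "\<exists>C. \<forall>x\<in>H. cmod (E2 x) \<le> C * ip_norm ip x"
    and E_T: "x \<in> H \<Longrightarrow> E1 (T x) = \<zeta>1 * E1 x" "x \<in> H \<Longrightarrow> E2 (T x) = \<zeta>2 * E2 x"
    and ip_T: "\<lbrakk>x \<in> H; y \<in> H\<rbrakk> \<Longrightarrow>
      ip (T x) (T y) = ip x y + E1 x * cnj (E1 y) + E2 x * cnj (E2 y)"
    and e: "e \<in> H" "E1 e = 1" "E2 e = 1" "x \<in> H \<Longrightarrow> ip (T x) e = 0"
    and range_T: "x \<in> H \<Longrightarrow> \<exists>y\<in>H. x - scl (ip x e) e = T y"
    and \<zeta>: "cmod \<zeta>1 = 1" "cmod \<zeta>2 = 1" "\<zeta>1 * cnj \<zeta>2 \<noteq> \<zeta>2 * cnj \<zeta>1"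
begin

lemma E_diff:
  assumes "x \<in> H" "y \<in> H"
  shows "E1 (x - y) = E1 x - E1 y" "E2 (x - y) = E2 x - E2 y"
  using E_add[of "x - y" y] assms by simp_all

text \<open>The defect form \<open>Q\<close> of the Cauchy dual depends only on two coordinates,
  \<open>c1\<close> and \<open>c2\<close>, which the Cauchy dual transforms by a matrix.
  Subnormality makes the images of \<open>T' - \<alpha>\<close> and \<open>T' - \<beta>\<close>
  orthogonal for \<open>Q\<close>. Evaluating this on two coordinate vectors, in both orders, gives
  two different values for \<open>\<delta> * (\<alpha> * cnj \<beta>)\<close>.\<close>

theorem cauchy_dual_not_subnormal:
  "\<not> subnormal_in TYPE('k::ab_group_add) scl H ip (cauchy_dual H ip T)"
proof
  define T' where "T' = cauchy_dual H ip T"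
  assume "subnormal_in TYPE('k) scl H ip (cauchy_dual H ip T)"
  then have sub: "subnormal_in TYPE('k) scl H ip T'" by (simp add: T'_def)
  obtain k1 where k1: "k1 \<in> H" "\<And>x. x \<in> H \<Longrightarrow> E1 x = ip x k1"
    using riesz_representation[of E1] E_add E_scale E_bounded by metis
  obtain k2 where k2: "k2 \<in> H" "\<And>x. x \<in> H \<Longrightarrow> E2 x = ip x k2"
    using riesz_representation[of E2] E_add E_scale E_bounded by metis
  \<comment> \<open>These are the entries of the identity plus the Gram matrix of \<open>k1\<close>,
    \<open>k2\<close>: \<open>a1\<close>, \<open>a2\<close> on the diagonal, \<open>b\<close> and
    \<open>cnj b\<close> off it. The matrix sends the boundary values of \<open>y\<close> to those
    of \<open>T^* T y\<close>.\<close>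
  define a1 a2 where "a1 = 1 + E1 k1" and "a2 = 1 + E2 k2"
  define b where "b = E1 k2"
  have E21: "E2 k1 = cnj b" using ip_cnj[OF k2(1) k1(1)] by (simp add: b_def k1 k2)
  have kk: "E1 k1 = a1 - 1" "E2 k2 = a2 - 1" "E1 k2 = b" "E2 k1 = cnj b"
    by (simp_all add: a1_def a2_def b_def E21)
  have a_Re: "E1 k1 = of_real ((ip_norm ip k1)\<^sup>2)" "E2 k2 = of_real ((ip_norm ip k2)\<^sup>2)"
    using ip_self[OF k1(1)] ip_self[OF k2(1)] by (simp_all add: ip_norm_sq k1 k2)
  have cnj_a: "cnj a1 = a1" "cnj a2 = a2"
    by (simp_all add: a1_def a2_def a_Re)
  have a2_nz: "a2 \<noteq> 0"
  proof
    assume "a2 = 0"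
    then have "1 + (ip_norm ip k2)\<^sup>2 = 0"
      unfolding a2_def a_Re by (metis of_real_0 of_real_1 of_real_add of_real_eq_iff)
    then show False by (smt (verit) zero_le_power2)
  qed
  \<comment> \<open>The determinant of that matrix. It is nonzero because Cauchy-Schwarz bounds the
    squared modulus of \<open>b\<close> by the product of the squared norms of \<open>k1\<close> and
    \<open>k2\<close>, which is smaller than \<open>a1 * a2\<close>.\<close>
  define \<delta> where "\<delta> = a1 * a2 - b * cnj b"
  have \<delta>: "\<delta> \<noteq> 0"
  proof
    assume "\<delta> = 0"
    define m n where "m = ip_norm ip k1" and "n = ip_norm ip k2"
    have "cmod b \<le> n * m"
      using cauchy_schwarz[OF k2(1) k1(1)] k1(2)[OF k2(1)] by (simp add: b_def m_def n_def)
    then have "(cmod b)\<^sup>2 \<le> (n * m)\<^sup>2" by (simp add: power_mono)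
    moreover have "of_real ((1 + m\<^sup>2) * (1 + n\<^sup>2) - (cmod b)\<^sup>2) = (0 :: complex)"
      using \<open>\<delta> = 0\<close>
      by (simp add: \<delta>_def a1_def a2_def a_Re m_def n_def complex_norm_square[symmetric])
    then have "(1 + m\<^sup>2) * (1 + n\<^sup>2) - (cmod b)\<^sup>2 = 0" by (simp only: of_real_eq_0_iff)
    moreover have "(1 + m\<^sup>2) * (1 + n\<^sup>2) = 1 + m\<^sup>2 + n\<^sup>2 + (n * m)\<^sup>2"
      by (simp add: algebra_simps power2_eq_square)
    ultimately show False by (smt (verit) zero_le_power2)
  qed
  \<comment> \<open>This is \<open>T^* T\<close> expressed through the representing vectors. It is
    injective because \<open>ip y (A y)\<close> is the squared norm of \<open>T y\<close>, which is
    at least that of \<open>y\<close>.\<close>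
  define A where "A y = y + scl (E1 y) k1 + scl (E2 y) k2" for y
  have AH: "A y \<in> H" if "y \<in> H" for y using that k1 k2 by (simp add: A_def)
  have ip_A: "ip x (A y) = ip (T x) (T y)" if "x \<in> H" "y \<in> H" for x y
    using that k1 k2 by (simp add: A_def ip_T ip_add_right ip_scale_right)
  have adj: "adjoint_on H ip T (T y) = A y" if "y \<in> H" for y
    using that by (intro adjoint_on_eqI) (simp_all add: AH ip_A)
  have A_inj: "inj_on A H"
  proof (rule inj_onI)
    fix y z assume yz: "y \<in> H" "z \<in> H" "A y = A z"
    define w where "w = y - z"
    have w: "w \<in> H" using yz by (simp add: w_def)
    have "A w = A y - A z"
      using yz(1,2) by (simp add: A_def w_def E_diff scale_left_diff_distrib algebra_simps)
    then have "ip (T w) (T w) = 0"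
      using yz w ip_A[of w w] by (simp add: ip_zero_right)
    then have "ip w w + of_real ((cmod (E1 w))\<^sup>2) + of_real ((cmod (E2 w))\<^sup>2) = 0"
      using w by (simp only: ip_T complex_norm_square)
    then have "Re (ip w w) + (cmod (E1 w))\<^sup>2 + (cmod (E2 w))\<^sup>2 = 0"
      by (metis Re_complex_of_real plus_complex.sel(1) zero_complex.sel(1))
    then have "Re (ip w w) = 0"
      using Re_ip_self_nonneg[OF w] by (smt (verit) zero_le_power2)
    then show "y = z" using ip_self_eq_0[OF w] by (simp add: w_def)
  qed
  have "inj_on (adjoint_on H ip T \<circ> T) H"
    using A_inj by (simp add: adj cong: inj_on_cong)
  then have T'_A: "T' (A y) = T y" if "y \<in> H" for y
    using inv_into_f_f[of "adjoint_on H ip T \<circ> T" H y] that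
    by (simp add: T'_def cauchy_dual_def adj)
  \<comment> \<open>Cramer's rule: \<open>c1 x\<close> and \<open>c2 x\<close> are the boundary
    values of the solution \<open>y\<close> of \<open>A y = x\<close>. Thus \<open>D\<close> below
    inverts \<open>A\<close>, and \<open>T'\<close> is \<open>T\<close> after
    \<open>D\<close>.\<close>
  define c1 c2 where "c1 x = (a2 * E1 x - b * E2 x) / \<delta>" and "c2 x = (a1 * E2 x - cnj b * E1 x) / \<delta>"
    for x
  have c_lin: "c1 (x + y) = c1 x + c1 y" "c2 (x + y) = c2 x + c2 y"
      "c1 (x - y) = c1 x - c1 y" "c2 (x - y) = c2 x - c2 y"
      if "x \<in> H" "y \<in> H" for x y
    using that by (simp_all add: c1_def c2_def E_add E_diff add_divide_distrib
        diff_divide_distrib algebra_simps)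
  have c_scale: "c1 (scl s x) = s * c1 x" "c2 (scl s x) = s * c2 x" if "x \<in> H" for x s
    using that by (simp_all add: c1_def c2_def E_scale diff_divide_distrib algebra_simps)
  have c_A: "c1 (A y) = E1 y" "c2 (A y) = E2 y" if "y \<in> H" for y
    using that k1(1) k2(1) \<delta>
    by (simp_all add: c1_def c2_def A_def E_add E_scale kk field_simps) (simp_all add: \<delta>_def algebra_simps)
  define D where "D x = x - scl (c1 x) k1 - scl (c2 x) k2" for x
  have DH: "D x \<in> H" if "x \<in> H" for x using that k1 k2 by (simp add: D_def)
  have E_c: "E1 x = a1 * c1 x + b * c2 x" "E2 x = cnj b * c1 x + a2 * c2 x" for x
    using \<delta> by (simp_all add: c1_def c2_def divide_simps) (simp_all add: \<delta>_def algebra_simps)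
  have E_D: "E1 (D x) = c1 x" "E2 (D x) = c2 x" if "x \<in> H" for x
  proof -
    have "E1 (D x) = E1 x - c1 x * (a1 - 1) - c2 x * b" "E2 (D x) = E2 x - c1 x * cnj b - c2 x * (a2 - 1)"
      using that k1(1) k2(1) by (simp_all add: D_def E_diff E_scale kk)
    then show "E1 (D x) = c1 x" "E2 (D x) = c2 x"
      by (simp_all add: E_c algebra_simps)
  qed
  have A_D: "A (D x) = x" if "x \<in> H" for x
    using that by (simp add: A_def E_D) (simp add: D_def)
  have T'_eq: "T' x = T (D x)" if "x \<in> H" for x
    using T'_A[OF DH[OF that]] that by (simp add: A_D)
  have T'H: "T' x \<in> H" if "x \<in> H" for x using that by (simp add: T'_eq T_in DH)
  have E_T': "E1 (T' x) = \<zeta>1 * c1 x" "E2 (T' x) = \<zeta>2 * c2 x" if "x \<in> H" for x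
    using that by (simp_all add: T'_eq E_T DH E_D)
  define Q where "Q u v = ip u v - ip (T' u) (T' v)" for u v
  have Q_eq: "Q u v = c1 u * cnj (E1 v) + c2 u * cnj (E2 v)" if "u \<in> H" "v \<in> H" for u v
  proof -
    have "ip (T' u) (T' v) = ip (D u) v"
      using that ip_A[of "D u" "D v"] by (simp add: T'_eq DH A_D)
    also have "\<dots> = ip u v - c1 u * ip k1 v - c2 u * ip k2 v"
      using that k1(1) k2(1) by (simp add: D_def ip_diff ip_scale)
    also have "ip k1 v = cnj (E1 v)" using that(2) ip_cnj[OF that(2) k1(1)] by (simp add: k1)
    also have "ip k2 v = cnj (E2 v)" using that(2) ip_cnj[OF that(2) k2(1)] by (simp add: k2)
    finally show ?thesis by (simp add: Q_def)
  qed

  text \<open>The roots of the characteristic polynomial of the matrix that describes the action of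
    \<open>T'\<close> on the coordinates \<open>(c1, c2)\<close>.\<close>
  define \<tau> where "\<tau> = (a2 * \<zeta>1 + a1 * \<zeta>2) / \<delta>"
  define r where "r = csqrt (\<tau>\<^sup>2 - 4 * (\<zeta>1 * \<zeta>2 / \<delta>))"
  define \<alpha> \<beta> where "\<alpha> = (\<tau> + r) / 2" and "\<beta> = (\<tau> - r) / 2"
  have sum: "\<alpha> + \<beta> = \<tau>" by (simp add: \<alpha>_def \<beta>_def field_simps)
  have "\<alpha> * \<beta> = (\<tau>\<^sup>2 - r\<^sup>2) / 4"
    by (simp add: \<alpha>_def \<beta>_def field_simps power2_eq_square)
  then have prod: "\<alpha> * \<beta> = \<zeta>1 * \<zeta>2 / \<delta>" by (simp add: r_def)
  have c_T': "c1 (T' x) = (a2 * \<zeta>1 * c1 x - b * \<zeta>2 * c2 x) / \<delta>"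
      "c2 (T' x) = (a1 * \<zeta>2 * c2 x - cnj b * \<zeta>1 * c1 x) / \<delta>" if "x \<in> H" for x
    using that by (simp_all add: c1_def[of "T' x"] c2_def[of "T' x"] E_T')
  \<comment> \<open>Cayley-Hamilton: both coordinates of \<open>p\<close> vanish, hence also those
    of \<open>T' p\<close>, so that \<open>Q\<close> vanishes at both vectors.\<close>
  have Q0: "Q (T' x - scl \<alpha> x) (T' z - scl \<beta> z) = 0" if x: "x \<in> H" and z: "z \<in> H" for x z
  proof -
    define p where "p = T' (T' x) - scl (\<alpha> + \<beta>) (T' x) + scl (\<alpha> * \<beta>) x"
    have p: "p \<in> H" using x by (simp add: p_def T'H)
    have cp: "c1 p = c1 (T' (T' x)) - (\<alpha> + \<beta>) * c1 (T' x) + \<alpha> * \<beta> * c1 x"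
        "c2 p = c2 (T' (T' x)) - (\<alpha> + \<beta>) * c2 (T' x) + \<alpha> * \<beta> * c2 x"
      using x by (simp_all add: p_def c_lin c_scale T'H)
    have "\<delta> * \<delta> * c1 p = 0" "\<delta> * \<delta> * c2 p = 0"
      using x \<delta> by (simp_all add: cp c_T' T'H sum prod \<tau>_def divide_simps)
        (simp_all add: \<delta>_def algebra_simps)
    then have c_p: "c1 p = 0" "c2 p = 0" using \<delta> by simp_all
    then have "c1 (T' p) = 0" "c2 (T' p) = 0" using p by (simp_all add: c_T')
    with c_p have "Q p p = 0" "Q (T' p) (T' p) = 0"
      using p by (simp_all add: Q_eq T'H)
    then show ?thesis
      unfolding Q_def p_def
      by (intro subnormal_defect_orthogonal[OF sub complex_hilbert_space_axioms _ x z])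
        (use T'H in auto)
  qed
  have key: "(c1 (T' x) - \<alpha> * c1 x) * cnj (\<zeta>1 * c1 z - \<beta> * E1 z)
      + (c2 (T' x) - \<alpha> * c2 x) * cnj (\<zeta>2 * c2 z - \<beta> * E2 z) = 0" if "x \<in> H" "z \<in> H" for x z
    using Q0[OF that] that by (simp add: Q_eq c_lin c_scale E_diff E_scale E_T' T'H)
  have \<zeta>12: "\<zeta>1 \<noteq> \<zeta>2" using \<zeta>(3) by auto
  have "\<exists>y\<in>H. E1 y = s \<and> E2 y = t" for s t
  proof -
    \<comment> \<open>The boundary values of \<open>e\<close> are 1 and 1, those of
      \<open>T e\<close> are \<open>\<zeta>1\<close> and \<open>\<zeta>2\<close>. As these points
      differ, linear interpolation attains every pair \<open>s\<close>, \<open>t\<close>.\<close>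
    define u v where "u = (s - t) / (\<zeta>1 - \<zeta>2)" and "v = s - u * \<zeta>1"
    let ?y = "scl v e + scl u (T e)"
    have y: "?y \<in> H" "E1 ?y = v + u * \<zeta>1" "E2 ?y = v + u * \<zeta>2"
      using e by (simp_all add: E_add E_scale E_T T_in)
    have "u * (\<zeta>1 - \<zeta>2) = s - t" using \<zeta>12 by (simp add: u_def)
    then have "E1 ?y = s" "E2 ?y = t" unfolding y(2,3) by (simp_all add: v_def algebra_simps)
    with y(1) show ?thesis by blast
  qed
  then have "\<exists>x\<in>H. c1 x = s \<and> c2 x = t" for s t
    using c_A AH by metis
  then obtain x1 x2 where x1: "x1 \<in> H" "c1 x1 = 1" "c2 x1 = 0"
    and x2: "x2 \<in> H" "c1 x2 = 0" "c2 x2 = 1" by metis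
  \<comment> \<open>Since \<open>ip k1 e = 1\<close>, one can write \<open>k1 = e + T h\<close>, and
    pairing with \<open>T x\<close> identifies \<open>A h\<close> as \<open>cnj \<zeta>1\<close>
    times \<open>k1\<close>. If \<open>b\<close> were 0, then \<open>E2 (A h) = a2 * E2 h\<close>
    would vanish, and \<open>E2 k1 = 1 + \<zeta>2 * E2 h\<close> would be 1 instead of
    \<open>cnj b = 0\<close>.\<close>
  have b: "b \<noteq> 0"
  proof
    assume "b = 0"
    have "ip k1 e = 1" using e(1,2) ip_cnj[OF e(1) k1(1)] k1(2)[OF e(1)] by simp
    then obtain h where h: "h \<in> H" "k1 = e + T h"
      using range_T[OF k1(1)] by (auto simp: algebra_simps)
    have "A h = scl (cnj \<zeta>1) k1"
    proof (rule ip_ext)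
      fix x assume x: "x \<in> H"
      have "ip x (A h) = ip (T x) (k1 - e)" using x h by (simp add: ip_A)
      also have "\<dots> = \<zeta>1 * ip x k1"
        using x k1(1) e(1) by (simp add: ip_diff_right T_in e(4) k1(2)[symmetric] E_T)
      finally show "ip x (A h) = ip x (scl (cnj \<zeta>1) k1)" using x k1(1) by (simp add: ip_scale_right)
    qed (use h k1 AH in auto)
    then have "E2 (A h) = 0" using k1(1) \<open>b = 0\<close> by (simp add: E_scale kk)
    then have "a2 * E2 h = 0"
      using h(1) k1(1) k2(1) \<open>b = 0\<close> kk
      by (auto simp: A_def E_add E_scale left_diff_distrib right_diff_distrib)
    then have "E2 k1 = 1" using h a2_nz e(1) by (simp add: E_add E_T T_in e(3))
    then show False using \<open>b = 0\<close> by (simp add: kk)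
  qed
  \<comment> \<open>In the pairing of \<open>x2\<close> with \<open>x1\<close> the two terms with
    \<open>a1\<close> cancel; the swapped pairing loses those with \<open>a2\<close> likewise. What
    remains equates \<open>\<delta> * (\<alpha> * cnj \<beta>)\<close> with
    \<open>\<zeta>2 * cnj \<zeta>1\<close> and with \<open>\<zeta>1 * cnj \<zeta>2\<close>.\<close>
  have "(- b * \<zeta>2 / \<delta>) * (cnj \<zeta>1 - cnj \<beta> * a1) - (a1 * \<zeta>2 / \<delta> - \<alpha>) * (cnj \<beta> * b) = 0"
    using key[OF x2(1) x1(1)] x1 x2 by (simp add: c_T' E_c cnj_a)
  then have "b * (\<delta> * (\<alpha> * cnj \<beta>) - \<zeta>2 * cnj \<zeta>1) = 0"
    using \<delta> by (simp add: field_simps)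
  moreover have "(a2 * \<zeta>1 / \<delta> - \<alpha>) * (- (cnj \<beta> * cnj b)) + (- cnj b * \<zeta>1 / \<delta>) * (cnj \<zeta>2 - cnj \<beta> * a2) = 0"
    using key[OF x1(1) x2(1)] x1 x2 by (simp add: c_T' E_c cnj_a)
  then have "cnj b * (\<delta> * (\<alpha> * cnj \<beta>) - \<zeta>1 * cnj \<zeta>2) = 0"
    using \<delta> by (simp add: field_simps)
  ultimately show False using b \<zeta>(3) by simp
qed

end

section \<open>Parseval identity in a weighted Bergman space\<close>

text \<open>This identification with the Euclidean plane makes the invariance of Lebesgue measure
  under orthogonal transformations applicable to complex numbers.\<close>

lemma distr_lborel_real2_complex:
  "distr lborel borel (\<lambda>v::real^2. Complex (v $ 1) (v $ 2)) = (lborel :: complex measure)"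
proof (rule lborel_eqI[symmetric])
  have [measurable]: "(\<lambda>v::real^2. Complex (v $ 1) (v $ 2)) \<in> borel_measurable borel"
    by (intro borel_measurable_continuous_onI continuous_intros)
  fix l u :: complex
  assume *: "\<And>b. b \<in> Basis \<Longrightarrow> l \<bullet> b \<le> u \<bullet> b"
  define l' u' :: "real^2" where "l' = vector [Re l, Im l]" and "u' = vector [Re u, Im u]"
  have B: "(Basis :: (real^2) set) = {axis 1 1, axis 2 1}"
    by (auto simp: Basis_vec_def UNIV_2)
  have le: "Re l \<le> Re u" "Im l \<le> Im u"
    using *[of 1] *[of \<i>] by (simp_all add: Basis_complex_def)
  have "(\<lambda>v::real^2. Complex (v $ 1) (v $ 2)) -` box l u = box l' u'"
    by (auto simp: in_box_complex_iff mem_box_cart l'_def u'_def forall_2)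
  then have "emeasure (distr lborel borel (\<lambda>v::real^2. Complex (v $ 1) (v $ 2))) (box l u)
      = emeasure lborel (box l' u')"
    by (simp add: emeasure_distr)
  also have "\<dots> = (\<Prod>b\<in>Basis. (u' - l') \<bullet> b)"
    by (rule emeasure_lborel_box) (use le in \<open>auto simp: B inner_axis l'_def u'_def\<close>)
  also have "\<dots> = (\<Prod>b\<in>Basis. (u - l) \<bullet> b)"
    by (simp add: B Basis_complex_def axis_eq_axis inner_axis l'_def u'_def)
  finally show "emeasure (distr lborel borel (\<lambda>v::real^2. Complex (v $ 1) (v $ 2))) (box l u)
      = (\<Prod>b\<in>Basis. (u - l) \<bullet> b)" .
qed simp

text \<open>It suffices to compare values on boxes. Transported to \<open>real^2\<close>, the
  preimage of a box under multiplication by \<open>w\<close> is the image of that box under the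
  orthogonal map \<open>g\<close> given by \<open>cnj w\<close>.\<close>

lemma distr_lborel_rotation:
  assumes "cmod w = 1"
  shows "distr lborel borel (\<lambda>z. w * z) = (lborel :: complex measure)"
proof (rule lborel_eqI[symmetric])
  define \<psi> :: "real^2 \<Rightarrow> complex" where "\<psi> v = Complex (v $ 1) (v $ 2)" for v
  define \<phi> :: "complex \<Rightarrow> real^2" where "\<phi> z = vector [Re z, Im z]" for z
  have \<psi>\<phi> [simp]: "\<psi> (\<phi> z) = z" "\<phi> (\<psi> v) = v" for z v
    by (auto simp: \<psi>_def \<phi>_def vec_eq_iff forall_2 complex_eq_iff)
  have \<psi>_meas [measurable]: "\<psi> \<in> borel_measurable borel"
    unfolding \<psi>_def by (intro borel_measurable_continuous_onI continuous_intros)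
  have lborel_\<psi>: "emeasure lborel B = emeasure lborel (\<psi> -` B)" if "B \<in> sets borel" for B
    using that \<psi>_meas emeasure_distr[of \<psi> lborel borel B] distr_lborel_real2_complex
    by (simp add: \<psi>_def[abs_def])
  have w: "w * cnj w = 1" "cnj w * w = 1"
    using assms complex_norm_square[of w] by (simp_all add: mult.commute)
  define g where "g v = \<phi> (cnj w * \<psi> v)" for v
  have norm_\<psi>: "norm v = cmod (\<psi> v)" for v
    by (simp add: \<psi>_def cmod_def norm_vec_def L2_set_def sum_2)
  have g: "orthogonal_transformation g"
    unfolding orthogonal_transformation
  proof
    show "linear g"
      by (rule linearI) (simp_all add: g_def \<phi>_def \<psi>_def vec_eq_iff forall_2 algebra_simps)
    show "\<forall>v. norm (g v) = norm v"
      using assms by (simp add: norm_\<psi> g_def norm_mult)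
  qed
  fix l u :: complex
  assume *: "\<And>b. b \<in> Basis \<Longrightarrow> l \<bullet> b \<le> u \<bullet> b"
  let ?B = "\<psi> -` box l u"
  have meas: "?B \<in> sets borel" using measurable_sets[of \<psi> borel borel "box l u"] by simp
  have "emeasure lborel ?B = emeasure lborel (box l u)"
    by (simp add: lborel_\<psi>)
  also have "\<dots> < \<infinity>" using emeasure_lborel_box_finite[of l u] by simp
  finally have fin: "?B \<in> lmeasurable"
    using meas by (intro fmeasurableI) auto
  have im: "g ` ?B \<in> lmeasurable" by (rule measurable_orthogonal_image[OF g fin])
  have pre: "\<psi> -` ((\<lambda>z. w * z) -` box l u) = g ` ?B"
  proof (rule set_eqI)
    fix v
    have "v = g (\<phi> (w * \<psi> v))" by (simp add: g_def mult.assoc[symmetric] w)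
    moreover have "w * \<psi> (g v') = \<psi> v'" for v' by (simp add: g_def mult.assoc[symmetric] w)
    ultimately show "v \<in> \<psi> -` ((\<lambda>z. w * z) -` box l u) \<longleftrightarrow> v \<in> g ` ?B"
      by (auto intro!: image_eqI[of v g "\<phi> (w * \<psi> v)"])
  qed
  have "(\<lambda>z. w * z) -` box l u \<in> sets borel"
    using measurable_sets[of "\<lambda>z. w * z" borel borel "box l u"] by simp
  then have "emeasure (distr lborel borel (\<lambda>z. w * z)) (box l u) = emeasure lborel (g ` ?B)"
    by (simp add: emeasure_distr lborel_\<psi> pre)
  also have "\<dots> = emeasure lborel ?B"
  proof -
    have "g ` ?B \<in> sets borel"
      using measurable_sets[of \<psi> borel borel, OF _ \<open>(\<lambda>z. w * z) -` box l u \<in> sets borel\<close>] pre by simp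
    then have "emeasure lborel (g ` ?B) = emeasure lebesgue (g ` ?B)" by simp
    also have "\<dots> = emeasure lebesgue ?B"
      using im fin measure_orthogonal_image[OF g fin] by (simp add: emeasure_eq_measure2)
    also have "\<dots> = emeasure lborel ?B" using meas by simp
    finally show ?thesis .
  qed
  also have "\<dots> = emeasure lborel (box l u)" by (simp add: lborel_\<psi>)
  also have "\<dots> = (\<Prod>b\<in>Basis. (u - l) \<bullet> b)" by (rule emeasure_lborel_box) (fact *)
  finally show "emeasure (distr lborel borel (\<lambda>z. w * z)) (box l u) = (\<Prod>b\<in>Basis. (u - l) \<bullet> b)" .
qed simp

section \<open>The normalized area measure of the disc\<close>

lemma sets_disc_area [measurable_cong, simp]: "sets disc_area = sets borel"
  by (simp add: disc_area_def)

lemma space_disc_area [simp]: "space disc_area = UNIV"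
  by (simp add: disc_area_def)

lemma emeasure_lborel_ball_complex: "r \<ge> 0 \<Longrightarrow> emeasure lborel (ball (0::complex) r) = ennreal (pi * r\<^sup>2)"
  by (simp add: emeasure_ball unit_ball_vol_2)

lemma emeasure_lborel_cball_complex: "r \<ge> 0 \<Longrightarrow> emeasure lborel (cball (0::complex) r) = ennreal (pi * r\<^sup>2)"
  by (simp add: emeasure_cball unit_ball_vol_2)

lemma prob_space_disc_area: "prob_space disc_area"
  unfolding disc_area_def
  by (rule prob_space_uniform_measure) (simp_all add: emeasure_lborel_ball_complex)

lemma distr_disc_area_rotation:
  assumes "cmod w = 1"
  shows "distr disc_area disc_area (\<lambda>z. w * z) = disc_area"
proof (rule measure_eqI)
  fix A assume "A \<in> sets (distr disc_area disc_area (\<lambda>z. w * z))"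
  then have A [measurable]: "A \<in> sets borel" by simp
  have m [measurable]: "(\<lambda>z. w * z) -` B \<in> sets borel" if "B \<in> sets borel" for B :: "complex set"
    using measurable_sets[of "\<lambda>z. w * z" borel borel B] that by simp
  have "ball 0 1 \<inter> (\<lambda>z. w * z) -` A = (\<lambda>z. w * z) -` (ball 0 1 \<inter> A)"
    using assms by (auto simp: norm_mult)
  then have "emeasure lborel (ball 0 1 \<inter> (\<lambda>z. w * z) -` A) = emeasure lborel (ball 0 1 \<inter> A)"
    using emeasure_distr[of "\<lambda>z. w * z" lborel borel "ball 0 1 \<inter> A"]
    by (simp add: distr_lborel_rotation[OF assms])
  then show "emeasure (distr disc_area disc_area (\<lambda>z. w * z)) A = emeasure disc_area A"
    using emeasure_distr[of "\<lambda>z. w * z" disc_area disc_area A] m[OF A]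
    by (simp add: disc_area_def emeasure_uniform_measure)
qed simp

text \<open>The annulus of points in the disc with squared modulus above \<open>x\<close> has area
  \<open>pi * (1 - x)\<close>. So the squared modulus, rather than the modulus, is uniformly
  distributed, and radial integrals become integrals over the unit interval.\<close>

lemma distr_disc_area_norm_sq:
  "distr disc_area borel (\<lambda>z. (cmod z)\<^sup>2) = uniform_measure lborel {0..1}"
proof (rule measure_eqI_lessThan)
  interpret prob_space disc_area by (rule prob_space_disc_area)
  have d: "emeasure disc_area A = emeasure lborel (ball 0 1 \<inter> A) / ennreal pi" if "A \<in> sets borel" for A
    using that by (simp add: disc_area_def emeasure_uniform_measure emeasure_lborel_ball_complex)
  have u: "emeasure (uniform_measure lborel {0..1}) A = emeasure lborel ({0..1} \<inter> A)"
    if "A \<in> sets borel" for A :: "real set"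
    using that by (simp add: emeasure_uniform_measure divide_ennreal_def)
  have [simp]: "y / 1 = y" for y :: ennreal by (simp add: divide_ennreal_def)
  fix x :: real
  have meas: "emeasure (distr disc_area borel (\<lambda>z. (cmod z)\<^sup>2)) {x<..} = emeasure disc_area {z. x < (cmod z)\<^sup>2}"
    by (subst emeasure_distr) (auto simp: vimage_def)
  have [measurable]: "{z. x < (cmod z)\<^sup>2} \<in> sets borel" by measurable
  show "emeasure (distr disc_area borel (\<lambda>z. (cmod z)\<^sup>2)) {x<..} < \<infinity>"
    unfolding meas by (metis emeasure_finite infinity_ennreal_def less_top)
  consider "x < 0" | "x \<ge> 1" | "0 \<le> x" "x < 1" by linarith
  then show "emeasure (distr disc_area borel (\<lambda>z. (cmod z)\<^sup>2)) {x<..}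
      = emeasure (uniform_measure lborel {0..1}) {x<..}"
  proof cases
    case 1
    then have "{z::complex. x < (cmod z)\<^sup>2} = UNIV" by (auto intro: less_le_trans[of x 0])
    moreover have "{0..1} \<inter> {x<..} = {0..1}" using 1 by auto
    ultimately show ?thesis
      using emeasure_space_1 by (simp add: meas u)
  next
    case 2
    then have "ball 0 1 \<inter> {z::complex. x < (cmod z)\<^sup>2} = {}"
      by (auto simp: not_less) (smt (verit) power_le_one norm_ge_zero)
    moreover have "{0..1} \<inter> {x<..} = {}" using 2 by auto
    ultimately show ?thesis by (simp add: meas u d)
  next
    case 3
    have "ball 0 1 \<inter> {z::complex. x < (cmod z)\<^sup>2} = ball 0 1 - cball 0 (sqrt x)"
      using 3 by (auto simp: not_le real_less_lsqrt) (metis real_sqrt_less_iff norm_ge_zero real_sqrt_abs abs_of_nonneg real_less_lsqrt sqrt_le_D not_le)+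
    moreover have "cball 0 (sqrt x) \<subseteq> (ball 0 1 :: complex set)"
      using 3 by (intro cball_subset_ball_iff[THEN iffD2]) auto
    ultimately have "emeasure lborel (ball 0 1 \<inter> {z::complex. x < (cmod z)\<^sup>2})
        = ennreal pi - ennreal (pi * x)"
      using 3 by (simp add: emeasure_Diff emeasure_lborel_ball_complex emeasure_lborel_cball_complex)
    also have "\<dots> = ennreal (pi * (1 - x))"
      using 3 by (subst ennreal_minus) (auto simp: algebra_simps)
    also have "\<dots> / ennreal pi = ennreal (1 - x)"
      using 3 by (subst divide_ennreal) auto
    moreover have "{0..1} \<inter> {x<..} = {x<..1}" using 3 by auto
    ultimately show ?thesis
      using 3 by (simp add: meas u d)
  qed
qed simp_all

lemma nn_integral_disc_radial:
  assumes [measurable]: "g \<in> borel_measurable borel"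
  shows "(\<integral>\<^sup>+z. g ((cmod z)\<^sup>2) \<partial>disc_area) = (\<integral>\<^sup>+t. g t * indicator {0..1} t \<partial>lborel)"
proof -
  have "(\<integral>\<^sup>+z. g ((cmod z)\<^sup>2) \<partial>disc_area) = (\<integral>\<^sup>+t. g t \<partial>distr disc_area borel (\<lambda>z. (cmod z)\<^sup>2))"
    by (subst nn_integral_distr) auto
  also have "\<dots> = (\<integral>\<^sup>+t. g t * indicator {0..1} t \<partial>lborel)"
    unfolding distr_disc_area_norm_sq
    by (subst nn_integral_uniform_measure) (auto simp: divide_ennreal_def)
  finally show ?thesis .
qed

section \<open>Orthogonality of monomials and Parseval's identity\<close>

lemma borel_measurable_cnj [measurable]: "cnj \<in> borel_measurable borel"
  by (intro borel_measurable_continuous_onI continuous_intros)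

text \<open>Rotation by the angle \<open>pi / (m - n)\<close> preserves the measure and the radial
  factor but multiplies the integrand by -1, so the integral equals its own negative.\<close>

lemma disc_monomials_orthogonal:
  fixes g :: "real \<Rightarrow> real"
  assumes "m \<noteq> n" and [measurable]: "g \<in> borel_measurable borel"
  shows "(\<integral>z. of_real (g (cmod z)) * (z ^ m * cnj (z ^ n)) \<partial>disc_area) = 0"
proof -
  let ?h = "\<lambda>z. complex_of_real (g (cmod z)) * (z ^ m * cnj (z ^ n))"
  define w where "w = cis (pi / (real m - real n))"
  define \<theta> where "\<theta> = pi / (real m - real n)"
  have "w ^ k = cis (real k * \<theta>)" for k
    unfolding w_def \<theta>_def by (rule Complex.DeMoivre)
  then have "w ^ m * cnj (w ^ n) = cis ((real m - real n) * \<theta>)"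
    by (simp add: cis_cnj cis_mult left_diff_distrib del: complex_cnj_power)
  also have "\<dots> = -1" using \<open>m \<noteq> n\<close> by (simp add: \<theta>_def)
  finally have w: "w ^ m * cnj (w ^ n) = -1" .
  have "cmod w = 1" by (simp add: w_def)
  then have "(\<integral>z. ?h z \<partial>disc_area) = (\<integral>z. ?h z \<partial>distr disc_area disc_area (\<lambda>z. w * z))"
    by (simp add: distr_disc_area_rotation)
  also have "\<dots> = (\<integral>z. ?h (w * z) \<partial>disc_area)"
    by (rule integral_distr) measurable
  also have "\<dots> = (\<integral>z. (w ^ m * cnj (w ^ n)) * ?h z \<partial>disc_area)"
    using \<open>cmod w = 1\<close> by (intro Bochner_Integration.integral_cong) (simp_all add: norm_mult power_mult_distrib ac_simps)
  also have "\<dots> = - (\<integral>z. ?h z \<partial>disc_area)" by (simp only: w) simp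
  finally show ?thesis by simp
qed

text \<open>Cutting the weight off at radius \<open>r < 1\<close> keeps the partial sums uniformly
  bounded where the weight is nonzero. Dominated convergence then reduces the identity to
  polynomials, where orthogonality of monomials applies.\<close>

lemma disc_parseval_ball:
  fixes c :: "nat \<Rightarrow> complex"
  assumes f: "\<And>z. cmod z < 1 \<Longrightarrow> (\<lambda>n. c n * z ^ n) sums f z" and r: "0 < r" "r < 1"
  defines "W \<equiv> \<lambda>t. if t < r then 1 - t\<^sup>2 else 0 :: real"
  shows "(\<lambda>n. (cmod (c n))\<^sup>2 * (\<integral>z. W (cmod z) * (cmod z) ^ (2 * n) \<partial>disc_area)) sums
    (\<integral>z. W (cmod z) * (cmod (f z))\<^sup>2 \<partial>disc_area)"
    and "integrable disc_area (\<lambda>z. W (cmod z) * (cmod (f z))\<^sup>2)"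
    and "integrable disc_area (\<lambda>z. W (cmod z) * (cmod z) ^ (2 * n))"
proof -
  interpret prob_space disc_area by (rule prob_space_disc_area)
  have [measurable]: "W \<in> borel_measurable borel" unfolding W_def by measurable
  have W: "0 \<le> W t" "W t \<le> 1" if "0 \<le> t" for t
  proof -
    have "t\<^sup>2 \<le> 1" if "t < r" using \<open>0 \<le> t\<close> that r(2) by (simp add: power_le_one)
    then show "0 \<le> W t" "W t \<le> 1" by (auto simp: W_def)
  qed
  define S where "S K z = (\<Sum>n<K. c n * z ^ n)" for K z
  have [measurable]: "S K \<in> borel_measurable borel" for K unfolding S_def by measurable
  \<comment> \<open>Convergence at the point \<open>(r + 1) / 2\<close>, which lies between
    \<open>r\<close> and 1, gives absolute convergence at \<open>r\<close>.\<close>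
  have "summable (\<lambda>n. c n * of_real ((r + 1) / 2) ^ n)"
    using f[of "of_real ((r + 1) / 2)"] r by (simp add: sums_iff)
  then have sm: "summable (\<lambda>n. norm (c n * of_real r ^ n))"
    by (rule powser_insidea) (use r in simp)
  define B where "B = (\<Sum>n. norm (c n * of_real r ^ n))"
  have S_le: "cmod (S K z) \<le> B" if "cmod z < r" for K z
  proof -
    have "cmod (S K z) \<le> (\<Sum>n<K. norm (c n * z ^ n))" unfolding S_def by (rule norm_sum)
    also have "\<dots> \<le> (\<Sum>n<K. norm (c n * of_real r ^ n))"
      using that r by (intro sum_mono) (simp add: norm_mult norm_power mult_left_mono power_mono)
    also have "\<dots> \<le> B" unfolding B_def by (rule sum_le_suminf[OF sm]) auto
    finally show ?thesis .
  qed
  have bound: "W (cmod z) * (cmod (S K z))\<^sup>2 \<le> B\<^sup>2" for K z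
  proof (cases "cmod z < r")
    case True
    have "W (cmod z) * (cmod (S K z))\<^sup>2 \<le> 1 * B\<^sup>2"
      using W S_le[OF True] by (intro mult_mono power_mono) auto
    then show ?thesis by simp
  qed (simp add: W_def)
  have lim: "(\<lambda>K. W (cmod z) * (cmod (S K z))\<^sup>2) \<longlonglongrightarrow> W (cmod z) * (cmod (f z))\<^sup>2" for z
  proof (cases "cmod z < r")
    case True
    then have "(\<lambda>K. S K z) \<longlonglongrightarrow> f z"
      using f[of z] r unfolding S_def sums_def by simp
    then show ?thesis by (intro tendsto_intros)
  qed (simp add: W_def)
  have f_meas [measurable]: "(\<lambda>z. W (cmod z) * (cmod (f z))\<^sup>2) \<in> borel_measurable disc_area"
    by (rule borel_measurable_LIMSEQ_real[OF lim]) measurable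
  have dom: "AE z in disc_area. norm (W (cmod z) * (cmod (S K z))\<^sup>2) \<le> B\<^sup>2" for K
    using bound W by (auto simp: abs_mult)
  have conv: "(\<lambda>K. \<integral>z. W (cmod z) * (cmod (S K z))\<^sup>2 \<partial>disc_area) \<longlonglongrightarrow> (\<integral>z. W (cmod z) * (cmod (f z))\<^sup>2 \<partial>disc_area)"
    by (rule integral_dominated_convergence[where w = "\<lambda>_. B\<^sup>2"]) (use lim dom in auto)
  show "integrable disc_area (\<lambda>z. W (cmod z) * (cmod (f z))\<^sup>2)"
    by (rule integrable_dominated_convergence[where w = "\<lambda>_. B\<^sup>2"
          and s = "\<lambda>K z. W (cmod z) * (cmod (S K z))\<^sup>2"]) (use lim dom in auto)
  have int_mn: "integrable disc_area (\<lambda>z. of_real (W (cmod z)) * (z ^ m * cnj (z ^ n)))" for m n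
  proof (rule integrable_const_bound[where B = 1])
    have "W (cmod z) * (cmod z ^ m * cmod z ^ n) \<le> 1" for z
    proof (cases "cmod z < r")
      case True
      then have "W (cmod z) * (cmod z ^ m * cmod z ^ n) \<le> 1 * (1 * 1)"
        using W r by (intro mult_mono power_le_one) auto
      then show ?thesis by simp
    qed (simp add: W_def)
    then show "AE z in disc_area. norm (of_real (W (cmod z)) * (z ^ m * cnj (z ^ n))) \<le> 1"
      using W by (auto simp: norm_mult norm_power)
  qed measurable
  have zz: "of_real (W (cmod z)) * (z ^ n * cnj (z ^ n)) = complex_of_real (W (cmod z) * cmod z ^ (2 * n))" for z n
  proof -
    have "z ^ n * cnj (z ^ n) = of_real ((cmod (z ^ n))\<^sup>2)" by (simp only: complex_norm_square)
    also have "(cmod (z ^ n))\<^sup>2 = cmod z ^ (2 * n)"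
      by (simp add: norm_power power_mult[symmetric] mult.commute)
    finally show ?thesis by (simp only: of_real_mult)
  qed
  show "integrable disc_area (\<lambda>z. W (cmod z) * (cmod z) ^ (2 * n))" for n
    using int_mn[of n n] unfolding zz by (simp only: complex_of_real_integrable_eq)
  define J where "J n = (\<integral>z. W (cmod z) * (cmod z) ^ (2 * n) \<partial>disc_area)" for n
  have val: "(\<integral>z. of_real (W (cmod z)) * (z ^ m * cnj (z ^ n)) \<partial>disc_area) = (if m = n then of_real (J n) else 0)" for m n
  proof (cases "m = n")
    case True
    then show ?thesis by (simp only: zz integral_complex_of_real J_def simp_thms if_True)
  next
    case False
    then show ?thesis by (simp only: disc_monomials_orthogonal[OF False \<open>W \<in> borel_measurable borel\<close>] if_False)
  qed
  \<comment> \<open>The squared modulus of a partial sum is a double sum of monomials; only its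
    diagonal survives integration.\<close>
  have part: "(\<integral>z. W (cmod z) * (cmod (S K z))\<^sup>2 \<partial>disc_area) = (\<Sum>n<K. (cmod (c n))\<^sup>2 * J n)" for K
  proof -
    have "complex_of_real (W (cmod z) * (cmod (S K z))\<^sup>2)
        = (\<Sum>m<K. \<Sum>n<K. (c m * cnj (c n)) * (of_real (W (cmod z)) * (z ^ m * cnj (z ^ n))))" for z
    proof -
      have "S K z * cnj (S K z) = (\<Sum>m<K. \<Sum>n<K. (c m * z ^ m) * cnj (c n * z ^ n))"
        unfolding S_def cnj_sum sum_product ..
      then have "complex_of_real (W (cmod z) * (cmod (S K z))\<^sup>2)
          = (\<Sum>m<K. \<Sum>n<K. of_real (W (cmod z)) * ((c m * z ^ m) * cnj (c n * z ^ n)))"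
        by (simp only: of_real_mult complex_norm_square sum_distrib_left)
      then show ?thesis by (simp add: ac_simps)
    qed
    then have "complex_of_real (\<integral>z. W (cmod z) * (cmod (S K z))\<^sup>2 \<partial>disc_area)
        = (\<integral>z. (\<Sum>m<K. \<Sum>n<K. (c m * cnj (c n)) * (of_real (W (cmod z)) * (z ^ m * cnj (z ^ n)))) \<partial>disc_area)"
      by (simp only: integral_complex_of_real[symmetric])
    also have "\<dots> = (\<Sum>m<K. \<Sum>n<K. (c m * cnj (c n)) * (\<integral>z. of_real (W (cmod z)) * (z ^ m * cnj (z ^ n)) \<partial>disc_area))"
      by (subst Bochner_Integration.integral_sum
          | intro Bochner_Integration.integrable_sum integrable_mult_right int_mn sum.cong refl
          | simp only: integral_mult_right_zero)+
    also have "\<dots> = (\<Sum>n<K. c n * cnj (c n) * of_real (J n))"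
      unfolding val by (simp add: if_distrib[of "\<lambda>x. _ * x"] cong: if_cong)
    also have "\<dots> = complex_of_real (\<Sum>n<K. (cmod (c n))\<^sup>2 * J n)"
      unfolding of_real_sum of_real_mult complex_norm_square ..
    finally show ?thesis by (simp only: of_real_eq_iff)
  qed
  show "(\<lambda>n. (cmod (c n))\<^sup>2 * (\<integral>z. W (cmod z) * (cmod z) ^ (2 * n) \<partial>disc_area)) sums
    (\<integral>z. W (cmod z) * (cmod (f z))\<^sup>2 \<partial>disc_area)"
    using conv unfolding part sums_def J_def .
qed

text \<open>The cutoff radii \<open>r k\<close> increase to 1, and monotone convergence passes to
  the whole disc in the integral and in the series alike. Both sides may be infinite, which lets the
  identity decide membership in the space.\<close>

theorem disc_parseval:
  fixes c :: "nat \<Rightarrow> complex"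
  assumes f: "\<And>z. cmod z < 1 \<Longrightarrow> (\<lambda>n. c n * z ^ n) sums f z"
  shows "(\<integral>\<^sup>+z. ennreal ((cmod (f z))\<^sup>2 * (1 - (cmod z)\<^sup>2)) * indicator (ball 0 1) z \<partial>disc_area)
    = (\<Sum>n. ennreal ((cmod (c n))\<^sup>2 / ((n + 1) * (n + 2))))"
proof -
  define r :: "nat \<Rightarrow> real" where "r k = 1 - 1 / (k + 2)" for k
  have r: "0 < r k" "r k < 1" for k by (simp_all add: r_def field_simps)
  have r_mono: "r i \<le> r j" if "i \<le> j" for i j
    using that by (simp add: r_def frac_le)
  define W where "W k t = (if t < r k then 1 - t\<^sup>2 else 0 :: real)" for k t
  have W_ge: "0 \<le> W k t" if "0 \<le> t" for k t
    using that r(2)[of k] by (auto simp: W_def intro!: power_le_one)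
  note ball = disc_parseval_ball[OF f r, folded W_def]
  have W_mono: "W i (cmod z) \<le> W j (cmod z)" if "i \<le> j" for i j z
    using r_mono[OF that] W_ge[of "cmod z" j] by (auto simp: W_def)
  have SUP_W: "(SUP k. ennreal (W k (cmod z) * x)) = ennreal (x * (1 - (cmod z)\<^sup>2)) * indicator (ball 0 1) z"
    if "x \<ge> 0" for z x
  proof (cases "cmod z < 1")
    case True
    obtain k :: nat where k: "1 / (real k + 2) < 1 - cmod z"
    proof -
      obtain k where "inverse (real (Suc k)) < 1 - cmod z"
        using reals_Archimedean[of "1 - cmod z"] True by auto
      moreover have "1 / (real k + 2) \<le> inverse (real (Suc k))" by (simp add: field_simps)
      ultimately show ?thesis by (intro that[of k]) simp
    qed
    have "(SUP k. ennreal (W k (cmod z) * x)) = ennreal (x * (1 - (cmod z)\<^sup>2))"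
    proof (rule antisym)
      show "(SUP k. ennreal (W k (cmod z) * x)) \<le> ennreal (x * (1 - (cmod z)\<^sup>2))"
        using that True by (intro SUP_least ennreal_leI) (auto simp: W_def mult.commute power_le_one)
      have "ennreal (x * (1 - (cmod z)\<^sup>2)) = ennreal (W k (cmod z) * x)"
        using k by (simp add: W_def r_def mult.commute)
      then show "ennreal (x * (1 - (cmod z)\<^sup>2)) \<le> (SUP k. ennreal (W k (cmod z) * x))"
        by (metis SUP_upper UNIV_I)
    qed
    then show ?thesis using True by simp
  next
    case False
    then have "W k (cmod z) = 0" for k using r(2)[of k] by (simp add: W_def)
    then show ?thesis using False by simp
  qed
  have mono: "incseq (\<lambda>k z. ennreal (W k (cmod z) * g z))" if "\<And>z. 0 \<le> g z" for g :: "complex \<Rightarrow> real"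
    using that W_mono by (intro incseq_SucI le_funI ennreal_leI mult_right_mono) auto
  define X where "X k n = (\<integral>\<^sup>+z. ennreal (W k (cmod z) * cmod z ^ (2 * n)) \<partial>disc_area)" for k n
  have X_eq: "ennreal (\<integral>z. W k (cmod z) * cmod z ^ (2 * n) \<partial>disc_area) = X k n" for k n
    unfolding X_def by (rule nn_integral_eq_integral[symmetric]) (use ball(3) W_ge in auto)
  have "(\<integral>\<^sup>+z. ennreal ((cmod (f z))\<^sup>2 * (1 - (cmod z)\<^sup>2)) * indicator (ball 0 1) z \<partial>disc_area)
      = (SUP k. \<integral>\<^sup>+z. ennreal (W k (cmod z) * (cmod (f z))\<^sup>2) \<partial>disc_area)"
    using ball(2) by (simp add: SUP_W[symmetric] nn_integral_monotone_convergence_SUP mono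
        borel_measurable_integrable)
  also have "\<dots> = (SUP k. \<Sum>n. ennreal ((cmod (c n))\<^sup>2) * X k n)"
  proof (rule SUP_cong[OF refl])
    fix k
    have "(\<integral>\<^sup>+z. ennreal (W k (cmod z) * (cmod (f z))\<^sup>2) \<partial>disc_area)
        = ennreal (\<integral>z. W k (cmod z) * (cmod (f z))\<^sup>2 \<partial>disc_area)"
      by (rule nn_integral_eq_integral) (use ball(2) W_ge in auto)
    also have "\<dots> = (\<Sum>n. ennreal ((cmod (c n))\<^sup>2 * (\<integral>z. W k (cmod z) * cmod z ^ (2 * n) \<partial>disc_area)))"
      using W_ge by (intro suminf_ennreal_eq[symmetric] ball(1) mult_nonneg_nonneg
          Bochner_Integration.integral_nonneg) auto
    also have "\<dots> = (\<Sum>n. ennreal ((cmod (c n))\<^sup>2) * X k n)"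
      by (simp add: ennreal_mult' X_eq)
    finally show "(\<integral>\<^sup>+z. ennreal (W k (cmod z) * (cmod (f z))\<^sup>2) \<partial>disc_area)
        = (\<Sum>n. ennreal ((cmod (c n))\<^sup>2) * X k n)" .
  qed
  also have "\<dots> = (\<Sum>n. SUP k. ennreal ((cmod (c n))\<^sup>2) * X k n)"
    unfolding X_def
    by (intro ennreal_suminf_SUP_eq[symmetric] incseq_SucI mult_left_mono nn_integral_mono
        ennreal_leI mult_right_mono W_mono) auto
  also have "\<dots> = (\<Sum>n. ennreal ((cmod (c n))\<^sup>2 / ((n + 1) * (n + 2))))"
  proof (rule suminf_cong)
    fix n
    have "(SUP k. X k n) = (\<integral>\<^sup>+z. (SUP k. ennreal (W k (cmod z) * cmod z ^ (2 * n))) \<partial>disc_area)"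
      unfolding X_def using ball(3)
      by (intro nn_integral_monotone_convergence_SUP[symmetric] mono) (auto simp: borel_measurable_integrable)
    also have "\<dots> = (\<integral>\<^sup>+z. ennreal (((cmod z)\<^sup>2) ^ n * (1 - (cmod z)\<^sup>2)) \<partial>disc_area)"
    proof (rule nn_integral_cong)
      fix z :: complex
      \<comment> \<open>Outside the disc the weight is nonpositive, so \<open>ennreal\<close> turns
        it into 0 and takes over the role of the indicator.\<close>
      have "ennreal (cmod z ^ (2 * n) * (1 - (cmod z)\<^sup>2)) = 0" if "1 \<le> cmod z"
        using that by (intro ennreal_neg mult_nonneg_nonpos) (auto simp: one_le_power)
      then show "(SUP k. ennreal (W k (cmod z) * cmod z ^ (2 * n)))
          = ennreal (((cmod z)\<^sup>2) ^ n * (1 - (cmod z)\<^sup>2))"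
        by (subst SUP_W) (auto simp: power_mult split: split_indicator)
    qed
    \<comment> \<open>With \<open>t\<close> the squared modulus, the moment is the integral of
      \<open>t ^ n * (1 - t)\<close> over the unit interval.\<close>
    also have "\<dots> = (\<integral>\<^sup>+t. ennreal (t ^ n * (1 - t)) * indicator {0..1} t \<partial>lborel)"
      by (rule nn_integral_disc_radial) measurable
    also have "\<dots> = ennreal ((1 ^ Suc n / Suc n - 1 ^ Suc (Suc n) / Suc (Suc n))
        - (0 ^ Suc n / Suc n - 0 ^ Suc (Suc n) / Suc (Suc n)))"
    proof (rule nn_integral_FTC_Icc[where F = "\<lambda>t. t ^ Suc n / Suc n - t ^ Suc (Suc n) / Suc (Suc n)"])
      fix t :: real assume t: "t \<in> {0..1}"
      have D: "((\<lambda>t. t ^ Suc m / Suc m) has_real_derivative t ^ m) (at t)" for m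
        using DERIV_cdivide[OF DERIV_pow[of "Suc m" t], of "real (Suc m)"] by simp
      show "((\<lambda>t. t ^ Suc n / Suc n - t ^ Suc (Suc n) / Suc (Suc n)) has_real_derivative t ^ n * (1 - t)) (at t)"
        using DERIV_diff[OF D[of n] D[of "Suc n"]] by (simp add: algebra_simps)
      show "0 \<le> t ^ n * (1 - t)" using t by simp
    qed simp_all
    also have "\<dots> = ennreal (1 / ((n + 1) * (n + 2)))"
      by (simp add: field_simps)
    finally show "(SUP k. ennreal ((cmod (c n))\<^sup>2) * X k n) = ennreal ((cmod (c n))\<^sup>2 / ((n + 1) * (n + 2)))"
      by (simp add: SUP_mult_left_ennreal[symmetric] ennreal_mult'[symmetric])
  qed
  finally show ?thesis .
qed

section \<open>Local Dirichlet integrals of coefficient sequences\<close>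

definition psum :: "complex \<Rightarrow> (nat \<Rightarrow> complex) \<Rightarrow> nat \<Rightarrow> complex" where
  "psum \<zeta> a n = (\<Sum>k\<le>n. a k * \<zeta> ^ k)"

text \<open>Partial sums of \<open>z f'(z)\<close> at \<open>\<zeta>\<close>. Up to a unimodular
  factor and an index shift by one, they are the Taylor coefficients of
  \<open>f'(z) / (1 - cnj \<zeta> * z)\<close>.\<close>

definition deriv_psum :: "complex \<Rightarrow> (nat \<Rightarrow> complex) \<Rightarrow> nat \<Rightarrow> complex" where
  "deriv_psum \<zeta> a n = (\<Sum>k\<le>n. of_nat k * a k * \<zeta> ^ k)"

text \<open>The local Dirichlet integral at \<open>\<zeta>\<close> of \<open>\<Sum>n. a n * z ^ n\<close> is
  \<open>\<Sum>n\<ge>1. \<bar>deriv_psum \<zeta> a n\<bar>\<^sup>2 / (n (n + 1))\<close>; the term \<open>n = 0\<close> below is \<open>0 / 0 = 0\<close>.\<close>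

definition local_dirichlet :: "complex \<Rightarrow> (nat \<Rightarrow> complex) \<Rightarrow> bool" where
  "local_dirichlet \<zeta> a \<longleftrightarrow> summable (\<lambda>n. (cmod (deriv_psum \<zeta> a n))\<^sup>2 / (real n * (real n + 1)))"

definition local_term :: "complex \<Rightarrow> (nat \<Rightarrow> complex) \<Rightarrow> (nat \<Rightarrow> complex) \<Rightarrow> nat \<Rightarrow> complex" where
  "local_term \<zeta> a b n = deriv_psum \<zeta> a n * cnj (deriv_psum \<zeta> b n) / (of_nat n * (of_nat n + 1))"

text \<open>For sequences with finite local Dirichlet integral this is the limit of the partial sums
  \<open>psum \<zeta> a\<close>, written as the absolutely convergent series that summation by parts
  produces. The term at 0 is again \<open>0 / 0 = 0\<close>.\<close>

definition boundary_value :: "complex \<Rightarrow> (nat \<Rightarrow> complex) \<Rightarrow> complex" where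
  "boundary_value \<zeta> a = a 0 + (\<Sum>n. deriv_psum \<zeta> a n / (of_nat n * (of_nat n + 1)))"

definition shift :: "(nat \<Rightarrow> complex) \<Rightarrow> nat \<Rightarrow> complex" where
  "shift a n = (case n of 0 \<Rightarrow> 0 | Suc m \<Rightarrow> a m)"

lemma shift_simps [simp]: "shift a 0 = 0" "shift a (Suc n) = a n"
  by (simp_all add: shift_def)

lemma deriv_psum_0 [simp]: "deriv_psum \<zeta> a 0 = 0"
  by (simp add: deriv_psum_def)

lemma deriv_psum_Suc: "deriv_psum \<zeta> a (Suc n) = deriv_psum \<zeta> a n + of_nat (Suc n) * a (Suc n) * \<zeta> ^ Suc n"
  by (simp add: deriv_psum_def)

lemma psum_0 [simp]: "psum \<zeta> a 0 = a 0"
  by (simp add: psum_def)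

lemma psum_Suc: "psum \<zeta> a (Suc n) = psum \<zeta> a n + a (Suc n) * \<zeta> ^ Suc n"
  by (simp add: psum_def)

lemma deriv_psum_add: "deriv_psum \<zeta> (\<lambda>n. a n + b n) n = deriv_psum \<zeta> a n + deriv_psum \<zeta> b n"
  by (simp add: deriv_psum_def sum.distrib algebra_simps)

lemma deriv_psum_scale: "deriv_psum \<zeta> (\<lambda>n. c * a n) n = c * deriv_psum \<zeta> a n"
  by (simp add: deriv_psum_def sum_distrib_left ac_simps)

lemma psum_shift: "psum \<zeta> (shift a) (Suc n) = \<zeta> * psum \<zeta> a n"
  by (induction n) (simp_all add: psum_Suc algebra_simps)

lemma deriv_psum_shift: "deriv_psum \<zeta> (shift a) (Suc n) = \<zeta> * (deriv_psum \<zeta> a n + psum \<zeta> a n)"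
  by (induction n) (simp_all add: deriv_psum_Suc psum_Suc algebra_simps)

lemma local_term_0 [simp]: "local_term \<zeta> a b 0 = 0"
  by (simp add: local_term_def)

lemma cmod_local_term:
  "cmod (local_term \<zeta> a b n) = cmod (deriv_psum \<zeta> a n) * cmod (deriv_psum \<zeta> b n) / (real n * (real n + 1))"
proof -
  have "cmod (of_nat n * (of_nat n + 1)) = real n * (real n + 1)"
    by (metis of_nat_Suc add.commute norm_mult norm_of_nat)
  then show ?thesis by (simp add: local_term_def norm_mult norm_divide)
qed

lemma local_term_self:
  "local_term \<zeta> a a n = of_real ((cmod (deriv_psum \<zeta> a n))\<^sup>2 / (real n * (real n + 1)))"
  unfolding local_term_def of_real_divide complex_norm_square by simp

lemma summable_norm_local_term:
  assumes "local_dirichlet \<zeta> a" "local_dirichlet \<zeta> b"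
  shows "summable (\<lambda>n. norm (local_term \<zeta> a b n))"
proof (rule summable_comparison_test)
  have "cmod (local_term \<zeta> a b n) \<le> (cmod (deriv_psum \<zeta> a n))\<^sup>2 / (real n * (real n + 1))
      + (cmod (deriv_psum \<zeta> b n))\<^sup>2 / (real n * (real n + 1))" for n
  proof -
    have "cmod (deriv_psum \<zeta> a n) * cmod (deriv_psum \<zeta> b n) \<le> (cmod (deriv_psum \<zeta> a n))\<^sup>2 + (cmod (deriv_psum \<zeta> b n))\<^sup>2"
      using sum_squares_bound[of "cmod (deriv_psum \<zeta> a n)" "cmod (deriv_psum \<zeta> b n)"]
        mult_nonneg_nonneg[OF norm_ge_zero norm_ge_zero, of "deriv_psum \<zeta> a n" "deriv_psum \<zeta> b n"] by linarith
    then show ?thesis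
      unfolding cmod_local_term add_divide_distrib[symmetric] by (intro divide_right_mono) auto
  qed
  then show "\<exists>N. \<forall>n\<ge>N. norm (norm (local_term \<zeta> a b n)) \<le> (cmod (deriv_psum \<zeta> a n))\<^sup>2 / (real n * (real n + 1))
      + (cmod (deriv_psum \<zeta> b n))\<^sup>2 / (real n * (real n + 1))" by simp
  show "summable (\<lambda>n. (cmod (deriv_psum \<zeta> a n))\<^sup>2 / (real n * (real n + 1))
      + (cmod (deriv_psum \<zeta> b n))\<^sup>2 / (real n * (real n + 1)))"
    using assms by (intro summable_add) (simp_all add: local_dirichlet_def)
qed

lemmas summable_local_term = summable_norm_local_term[THEN summable_norm_cancel]

lemma local_dirichlet_add:
  assumes "local_dirichlet \<zeta> a" "local_dirichlet \<zeta> b"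
  shows "local_dirichlet \<zeta> (\<lambda>n. a n + b n)"
proof -
  have "summable (\<lambda>n. local_term \<zeta> a a n + local_term \<zeta> a b n + local_term \<zeta> b a n + local_term \<zeta> b b n)"
    using assms by (intro summable_add summable_local_term)
  moreover have "local_term \<zeta> a a n + local_term \<zeta> a b n + local_term \<zeta> b a n + local_term \<zeta> b b n
      = local_term \<zeta> (\<lambda>n. a n + b n) (\<lambda>n. a n + b n) n" for n
    by (simp add: local_term_def deriv_psum_add add_divide_distrib[symmetric] algebra_simps)
  ultimately show ?thesis
    by (simp add: local_term_self local_dirichlet_def summable_complex_of_real del: of_real_divide of_real_mult of_real_power)
qed

lemma local_dirichlet_scale:
  assumes "local_dirichlet \<zeta> a"
  shows "local_dirichlet \<zeta> (\<lambda>n. c * a n)"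
  using summable_mult[OF assms[unfolded local_dirichlet_def], of "(cmod c)\<^sup>2"]
  by (simp add: local_dirichlet_def deriv_psum_scale norm_mult power_mult_distrib)

text \<open>The sum telescopes; its term at 0 is \<open>1 / 0 = 0\<close>.\<close>

lemma sum_inverse_consecutive_le: "(\<Sum>n<N. 1 / (real n * (real n + 1))) \<le> 1"
proof -
  have "(\<Sum>n<Suc N. 1 / (real n * (real n + 1))) = 1 - 1 / (real N + 1)" for N
    proof (induction N)
    case (Suc N)
    have "1 - 1 / (x + 1) + 1 / ((x + 1) * (x + 2)) = 1 - 1 / (x + 2)" if "x \<ge> 0" for x :: real
      using that by (simp add: divide_simps) (simp add: algebra_simps)
    from this[of "real N"] show ?case
      by (subst sum.lessThan_Suc, subst Suc) (simp add: add.commute add.left_commute)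
  qed simp
  then have "(\<Sum>n<Suc N. 1 / (real n * (real n + 1))) \<le> 1" for N by simp
  then show ?thesis by (cases N) (simp_all del: sum.lessThan_Suc)
qed

lemma summable_inverse_consecutive: "summable (\<lambda>n. 1 / (real n * (real n + 1)))"
  by (rule summableI_nonneg_bounded[OF _ sum_inverse_consecutive_le]) simp

lemma suminf_inverse_consecutive_le: "(\<Sum>n. 1 / (real n * (real n + 1))) \<le> 1"
  by (rule suminf_le_const[OF summable_inverse_consecutive]) (rule sum_inverse_consecutive_le)

text \<open>Each modulus is at most half of its square plus 1, and the weights have sum at most 1.
  The resulting bound is inhomogeneous; rescaling to unit norm later turns it into boundedness of
  the functional.\<close>

lemma boundary_terms:
  assumes "local_dirichlet \<zeta> a"
  shows "summable (\<lambda>n. norm (deriv_psum \<zeta> a n / (of_nat n * (of_nat n + 1))))"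
    and "cmod (boundary_value \<zeta> a) \<le> cmod (a 0)
      + ((\<Sum>n. (cmod (deriv_psum \<zeta> a n))\<^sup>2 / (real n * (real n + 1))) + 1) / 2"
proof -
  let ?t = "\<lambda>n. deriv_psum \<zeta> a n / (of_nat n * (of_nat n + 1))"
  let ?g = "\<lambda>n. ((cmod (deriv_psum \<zeta> a n))\<^sup>2 / (real n * (real n + 1)) + 1 / (real n * (real n + 1))) / 2"
  have le: "norm (?t n) \<le> ?g n" for n
  proof -
    have "cmod (of_nat n * (of_nat n + 1)) = real n * (real n + 1)"
      by (metis of_nat_Suc add.commute norm_mult norm_of_nat)
    moreover have "cmod (deriv_psum \<zeta> a n) \<le> ((cmod (deriv_psum \<zeta> a n))\<^sup>2 + 1) / 2"
      using sum_squares_bound[of "cmod (deriv_psum \<zeta> a n)" 1] by simp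
    then have "cmod (deriv_psum \<zeta> a n) / (real n * (real n + 1))
        \<le> (((cmod (deriv_psum \<zeta> a n))\<^sup>2 + 1) / 2) / (real n * (real n + 1))"
      by (intro divide_right_mono) auto
    ultimately show ?thesis by (simp add: norm_divide add_divide_distrib ac_simps)
  qed
  have sm: "summable ?g"
    using assms by (intro summable_divide summable_add summable_inverse_consecutive)
      (simp add: local_dirichlet_def)
  show 1: "summable (\<lambda>n. norm (?t n))"
    by (rule summable_comparison_test'[OF sm, of 0]) (use le in simp)
  have "cmod (\<Sum>n. ?t n) \<le> (\<Sum>n. norm (?t n))" by (rule summable_norm[OF 1])
  also have "\<dots> \<le> (\<Sum>n. ?g n)" by (rule suminf_le[OF le 1 sm])
  also have "\<dots> = ((\<Sum>n. (cmod (deriv_psum \<zeta> a n))\<^sup>2 / (real n * (real n + 1)))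
      + (\<Sum>n. 1 / (real n * (real n + 1)))) / 2"
    using assms by (subst suminf_divide) (auto simp: suminf_add[symmetric] local_dirichlet_def
        summable_add summable_inverse_consecutive)
  also have "\<dots> \<le> ((\<Sum>n. (cmod (deriv_psum \<zeta> a n))\<^sup>2 / (real n * (real n + 1))) + 1) / 2"
    using suminf_inverse_consecutive_le by simp
  finally show "cmod (boundary_value \<zeta> a) \<le> cmod (a 0)
      + ((\<Sum>n. (cmod (deriv_psum \<zeta> a n))\<^sup>2 / (real n * (real n + 1))) + 1) / 2"
    unfolding boundary_value_def using norm_triangle_ineq[of "a 0" "\<Sum>n. ?t n"] by linarith
qed

lemma boundary_value_add:
  assumes "local_dirichlet \<zeta> a" "local_dirichlet \<zeta> b"
  shows "boundary_value \<zeta> (\<lambda>n. a n + b n) = boundary_value \<zeta> a + boundary_value \<zeta> b"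
  using assms boundary_terms(1)[THEN summable_norm_cancel]
  by (simp add: boundary_value_def deriv_psum_add add_divide_distrib suminf_add[symmetric])

lemma boundary_value_scale:
  assumes "local_dirichlet \<zeta> a"
  shows "boundary_value \<zeta> (\<lambda>n. c * a n) = c * boundary_value \<zeta> a"
  using suminf_mult[OF boundary_terms(1)[THEN summable_norm_cancel, OF assms], of c]
  by (simp add: boundary_value_def deriv_psum_scale algebra_simps)

text \<open>Summation by parts: for \<open>k > 0\<close>, the term \<open>a k * \<zeta> ^ k\<close>
  is the difference of two consecutive values of \<open>deriv_psum\<close> divided by
  \<open>k\<close>, and differences of reciprocals give the factors
  \<open>1 / (k (k + 1))\<close>.\<close>

lemma psum_eq:
  "psum \<zeta> a n = a 0 + deriv_psum \<zeta> a n / of_nat (Suc n) + (\<Sum>k\<le>n. deriv_psum \<zeta> a k / (of_nat k * (of_nat k + 1)))"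
proof (induction n)
  case (Suc n)
  have nz: "of_nat (Suc n) \<noteq> (0 :: complex)" "of_nat (Suc (Suc n)) \<noteq> (0 :: complex)"
    by (simp_all only: of_nat_eq_0_iff)
  define s x c where "s = deriv_psum \<zeta> a n" and "x = a (Suc n) * \<zeta> ^ Suc n" and "c = (of_nat (Suc n) :: complex)"
  have c: "c \<noteq> 0" "c + 1 \<noteq> 0" "of_nat (Suc (Suc n)) = c + 1"
    using nz by (simp_all add: c_def)
  have "s / c + x = (s + c * x) / (c + 1) + (s + c * x) / (c * (c + 1))"
    using c by (simp add: divide_simps) (simp add: algebra_simps)
  moreover have "deriv_psum \<zeta> a (Suc n) = s + c * x"
    by (simp add: deriv_psum_Suc s_def x_def c_def)
  ultimately show ?case
    using Suc by (simp only: psum_Suc sum.atMost_Suc c(3) c_def[symmetric] x_def[symmetric] s_def[symmetric])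
      (simp add: algebra_simps)
qed simp

text \<open>The squared modulus of the quotient is at most a term of the convergent series for the
  local Dirichlet integral.\<close>

lemma deriv_psum_over_n_tendsto_0:
  assumes "local_dirichlet \<zeta> a"
  shows "(\<lambda>n. deriv_psum \<zeta> a n / of_nat (Suc n)) \<longlonglongrightarrow> 0"
proof -
  have lim: "(\<lambda>n. sqrt ((cmod (deriv_psum \<zeta> a n))\<^sup>2 / (real n * (real n + 1)))) \<longlonglongrightarrow> sqrt 0"
    using assms by (intro tendsto_intros summable_LIMSEQ_zero) (simp add: local_dirichlet_def)
  have "cmod (deriv_psum \<zeta> a n / of_nat (Suc n)) \<le> sqrt ((cmod (deriv_psum \<zeta> a n))\<^sup>2 / (real n * (real n + 1)))"
    for n
  proof (rule real_le_rsqrt)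
    have "(cmod (deriv_psum \<zeta> a n / of_nat (Suc n)))\<^sup>2 = (cmod (deriv_psum \<zeta> a n))\<^sup>2 / (real (Suc n))\<^sup>2"
      by (simp only: norm_divide power_divide norm_of_nat)
    also have "\<dots> \<le> (cmod (deriv_psum \<zeta> a n))\<^sup>2 / (real n * (real n + 1))"
    proof (cases n)
      case (Suc m)
      have "real n * (real n + 1) \<le> (real (Suc n))\<^sup>2" by (simp add: power2_eq_square algebra_simps)
      moreover have "0 < (real (Suc n))\<^sup>2 * (real n * (real n + 1))"
        using Suc by (intro mult_pos_pos) simp_all
      ultimately show ?thesis by (intro divide_left_mono) simp_all
    qed simp
    finally show "(cmod (deriv_psum \<zeta> a n / of_nat (Suc n)))\<^sup>2 \<le> (cmod (deriv_psum \<zeta> a n))\<^sup>2 / (real n * (real n + 1))" .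
  qed
  then have "\<forall>\<^sub>F n in sequentially. norm (deriv_psum \<zeta> a n / of_nat (Suc n))
      \<le> sqrt ((cmod (deriv_psum \<zeta> a n))\<^sup>2 / (real n * (real n + 1)))"
    by (intro always_eventually allI)
  from Lim_null_comparison[OF this] lim show ?thesis by (simp only: real_sqrt_zero)
qed

lemma psum_tendsto:
  assumes "local_dirichlet \<zeta> a"
  shows "psum \<zeta> a \<longlonglongrightarrow> boundary_value \<zeta> a"
proof -
  have "(\<lambda>n. a 0 + deriv_psum \<zeta> a n / of_nat (Suc n) + (\<Sum>k\<le>n. deriv_psum \<zeta> a k / (of_nat k * (of_nat k + 1))))
      \<longlonglongrightarrow> a 0 + 0 + (\<Sum>n. deriv_psum \<zeta> a n / (of_nat n * (of_nat n + 1)))"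
    using boundary_terms(1)[OF assms, THEN summable_norm_cancel]
    by (intro tendsto_add tendsto_const deriv_psum_over_n_tendsto_0[OF assms] summable_LIMSEQ')
  then show ?thesis by (simp add: psum_eq[symmetric] boundary_value_def del: of_nat_Suc)
qed

text \<open>The partial sums for the shift and for the sequence itself differ by boundary terms only: for
  a polynomial of degree \<open>N\<close> these are the product of the values at \<open>\<zeta>\<close> and the tails of the two
  series, as \<open>\<Sum>\<^bsub>n\<ge>N\<^esub> 1 / (n (n + 1)) = 1 / N\<close>.\<close>

lemma local_term_shift_sum:
  assumes "cmod \<zeta> = 1"
  shows "(\<Sum>n\<le>N. local_term \<zeta> (shift a) (shift b) (Suc n)) =
    (\<Sum>n\<le>N. local_term \<zeta> a b n) + psum \<zeta> a N * cnj (psum \<zeta> b N)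
    + deriv_psum \<zeta> a N * cnj (deriv_psum \<zeta> b N) / of_nat (Suc N)
    - (deriv_psum \<zeta> a N + psum \<zeta> a N) * cnj (deriv_psum \<zeta> b N + psum \<zeta> b N) / of_nat (Suc (Suc N))"
proof -
  have "\<zeta> * cnj \<zeta> = 1" using assms complex_norm_square[of \<zeta>] by simp
  then have "(\<zeta> * u) * cnj (\<zeta> * v) = u * cnj v" for u v
    by (metis complex_cnj_mult mult.assoc mult.left_commute mult.right_neutral)
  then have *: "local_term \<zeta> (shift a) (shift b) (Suc n)
      = (deriv_psum \<zeta> a n + psum \<zeta> a n) * cnj (deriv_psum \<zeta> b n + psum \<zeta> b n) / (of_nat (Suc n) * (of_nat (Suc n) + 1))" for n
    by (simp only: local_term_def deriv_psum_shift)
  show ?thesis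
  proof (induction N)
    case 0
    then show ?case by (simp add: * field_simps)
  next
    case (Suc n)
    define s t A B where "s = deriv_psum \<zeta> a n" and "t = cnj (deriv_psum \<zeta> b n)"
      and "A = psum \<zeta> a n" and "B = cnj (psum \<zeta> b n)"
    define x y c where "x = a (Suc n) * \<zeta> ^ Suc n" and "y = cnj (b (Suc n) * \<zeta> ^ Suc n)"
      and "c = (of_nat (Suc n) :: complex)"
    have c: "c \<noteq> 0" "c + 1 \<noteq> 0" "c + 2 \<noteq> 0"
      and c_Suc: "of_nat (Suc (Suc n)) = c + 1" "of_nat (Suc (Suc (Suc n))) = c + 2"
    proof -
      show "of_nat (Suc (Suc n)) = c + 1" "of_nat (Suc (Suc (Suc n))) = c + 2"
        by (simp_all add: c_def)
      then show "c \<noteq> 0" "c + 1 \<noteq> 0" "c + 2 \<noteq> 0"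
        by (metis c_def of_nat_eq_0_iff nat.distinct(1))+
    qed
    have new: "deriv_psum \<zeta> a (Suc n) = s + c * x" "cnj (deriv_psum \<zeta> b (Suc n)) = t + c * y"
        "psum \<zeta> a (Suc n) = A + x" "cnj (psum \<zeta> b (Suc n)) = B + y"
      by (simp_all add: deriv_psum_Suc psum_Suc s_def t_def A_def B_def x_def y_def c_def)
    have step: "(s + c * x + (A + x)) * (t + c * y + (B + y)) / ((c + 1) * (c + 2))
        + (A * B + s * t / c - (s + A) * (t + B) / (c + 1))
      = (s + c * x) * (t + c * y) / (c * (c + 1))
        + ((A + x) * (B + y) + (s + c * x) * (t + c * y) / (c + 1)
           - (s + c * x + (A + x)) * (t + c * y + (B + y)) / (c + 2))"
    \<comment> \<open>After partial fractions the quotients with denominator \<open>c + 2\<close>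
      agree on both sides and those of the unshifted product over \<open>c + 1\<close> cancel. The
      remaining ones are expanded using
      \<open>s + c * x + (A + x) = (s + A) + (c + 1) * x\<close>.\<close>
    proof -
      have pf: "w / ((c + 1) * (c + 2)) = w / (c + 1) - w / (c + 2)" "w / (c * (c + 1)) = w / c - w / (c + 1)" for w
        using c by (simp_all add: divide_simps) (simp_all add: algebra_simps)
      have "(s + c * x + (A + x)) * (t + c * y + (B + y)) / (c + 1)
          = (s + A) * (t + B) / (c + 1) + (s + A) * y + x * (t + B) + (c + 1) * x * y"
        using c by (simp add: field_simps)
      moreover have "(s + c * x) * (t + c * y) / c = s * t / c + s * y + x * t + c * x * y"
        using c by (simp add: field_simps)
      ultimately show ?thesis unfolding pf by (simp add: algebra_simps)
    qed
    have l1: "local_term \<zeta> (shift a) (shift b) (Suc (Suc n))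
        = (s + c * x + (A + x)) * (t + c * y + (B + y)) / ((c + 1) * (c + 2))"
      unfolding * c_Suc by (simp add: new)
    have l2: "local_term \<zeta> a b (Suc n) = (s + c * x) * (t + c * y) / (c * (c + 1))"
      unfolding local_term_def new c_def ..
    have IH: "(\<Sum>n\<le>n. local_term \<zeta> (shift a) (shift b) (Suc n)) = (\<Sum>n\<le>n. local_term \<zeta> a b n)
        + (A * B + s * t / c - (s + A) * (t + B) / (c + 1))"
      unfolding Suc c_Suc s_def t_def A_def B_def c_def by simp
    show ?case
      unfolding sum.atMost_Suc IH l1 l2 c_Suc new complex_cnj_add
      using step by (simp add: algebra_simps)
  qed
qed

text \<open>The source of the rank-one defect at \<open>\<zeta>\<close>: the finite identity is
  taken to the limit, and of its boundary terms only the product of the boundary values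
  survives.\<close>

theorem local_term_shift_sums:
  assumes \<zeta>: "cmod \<zeta> = 1" and a: "local_dirichlet \<zeta> a" and b: "local_dirichlet \<zeta> b"
  shows "local_term \<zeta> (shift a) (shift b) sums
    ((\<Sum>n. local_term \<zeta> a b n) + boundary_value \<zeta> a * cnj (boundary_value \<zeta> b))"
proof -
  define s t A B where "s = deriv_psum \<zeta> a" and "t n = cnj (deriv_psum \<zeta> b n)"
    and "A = psum \<zeta> a" and "B n = cnj (psum \<zeta> b n)" for n
  have s: "(\<lambda>n. s n / of_nat (Suc n)) \<longlonglongrightarrow> 0" and A: "A \<longlonglongrightarrow> boundary_value \<zeta> a"
    using deriv_psum_over_n_tendsto_0[OF a] psum_tendsto[OF a] by (simp_all add: s_def A_def)
  have t: "(\<lambda>n. t n / of_nat (Suc n)) \<longlonglongrightarrow> 0"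
    using tendsto_cnj[OF deriv_psum_over_n_tendsto_0[OF b]] by (simp add: t_def)
  have B: "B \<longlonglongrightarrow> cnj (boundary_value \<zeta> b)"
    unfolding B_def by (intro tendsto_cnj psum_tendsto b)
  have q: "(\<lambda>n. complex_of_real (real (Suc n) / real (Suc (Suc n)))) \<longlonglongrightarrow> of_real 1"
    by (intro tendsto_of_real LIMSEQ_n_over_Suc_n[THEN LIMSEQ_Suc])
  have r: "(\<lambda>n. complex_of_real (1 / real (Suc (Suc n)))) \<longlonglongrightarrow> of_real 0"
    by (intro tendsto_of_real lim_1_over_n[THEN LIMSEQ_Suc, THEN LIMSEQ_Suc])
  let ?p = "\<lambda>n. s n / of_nat (Suc n)" and ?p' = "\<lambda>n. t n / of_nat (Suc n)"
    and ?q = "\<lambda>n. complex_of_real (real (Suc n) / real (Suc (Suc n)))"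
    and ?r = "\<lambda>n. complex_of_real (1 / real (Suc (Suc n)))"
  \<comment> \<open>The last two boundary terms need not tend to 0 separately, since
    \<open>s n * t n / (n + 1)\<close> may be unbounded. Their difference is regrouped so that every
    product has a factor tending to 0 and all other factors converge.\<close>
  have "(\<lambda>n. (\<Sum>k\<le>n. local_term \<zeta> a b k) + A n * B n + ?p n * ?p' n * ?q n
       - (?p n * ?q n * B n + A n * ?p' n * ?q n + A n * B n * ?r n))
     \<longlonglongrightarrow> (\<Sum>k. local_term \<zeta> a b k) + boundary_value \<zeta> a * cnj (boundary_value \<zeta> b) + 0 * 0 * of_real 1
       - (0 * of_real 1 * cnj (boundary_value \<zeta> b) + boundary_value \<zeta> a * 0 * of_real 1
         + boundary_value \<zeta> a * cnj (boundary_value \<zeta> b) * of_real 0)"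
    by (intro tendsto_add tendsto_diff tendsto_mult s t A B q r summable_LIMSEQ' summable_local_term a b)
  moreover have "(\<Sum>k\<le>n. local_term \<zeta> a b k) + A n * B n + ?p n * ?p' n * ?q n
       - (?p n * ?q n * B n + A n * ?p' n * ?q n + A n * B n * ?r n)
     = (\<Sum>k\<le>n. local_term \<zeta> (shift a) (shift b) (Suc k))" for n
  proof -
    define c where "c = (of_nat (Suc n) :: complex)"
    have c: "c \<noteq> 0" "c + 1 \<noteq> 0" and c_Suc: "of_nat (Suc (Suc n)) = c + 1"
    proof -
      show "of_nat (Suc (Suc n)) = c + 1" by (simp add: c_def)
      then show "c \<noteq> 0" "c + 1 \<noteq> 0"
        by (metis c_def of_nat_eq_0_iff nat.distinct(1))+
    qed
    have "(s n / c) * (t n / c) * (c / (c + 1)) - ((s n / c) * (c / (c + 1)) * B n + A n * (t n / c) * (c / (c + 1)) + A n * B n * (1 / (c + 1)))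
       = s n * t n / c - (s n + A n) * (t n + B n) / (c + 1)"
      using c by (simp add: divide_simps) (simp add: algebra_simps)
    then show ?thesis
      unfolding local_term_shift_sum[OF \<zeta>] s_def[symmetric] A_def[symmetric] complex_cnj_add
        t_def[symmetric] B_def[symmetric] of_real_divide of_real_of_nat_eq of_real_1 c_Suc c_def[symmetric]
      by (simp add: algebra_simps)
  qed
  ultimately have "(\<lambda>n. \<Sum>k\<le>n. local_term \<zeta> (shift a) (shift b) (Suc k))
      \<longlonglongrightarrow> (\<Sum>k. local_term \<zeta> a b k) + boundary_value \<zeta> a * cnj (boundary_value \<zeta> b)"
    by simp
  then have "(\<lambda>n. local_term \<zeta> (shift a) (shift b) (Suc n)) sums
      ((\<Sum>k. local_term \<zeta> a b k) + boundary_value \<zeta> a * cnj (boundary_value \<zeta> b))"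
    by (simp add: sums_def_le)
  then show ?thesis by (simp add: sums_Suc_iff)
qed

lemma local_dirichlet_shift:
  assumes "cmod \<zeta> = 1" "local_dirichlet \<zeta> a"
  shows "local_dirichlet \<zeta> (shift a)"
proof -
  have "summable (local_term \<zeta> (shift a) (shift a))"
    using local_term_shift_sums[OF assms assms(2)] by (simp add: sums_iff)
  moreover have "local_term \<zeta> (shift a) (shift a)
      = (\<lambda>n. of_real ((cmod (deriv_psum \<zeta> (shift a) n))\<^sup>2 / (real n * (real n + 1))))"
    by (rule ext) (rule local_term_self)
  ultimately show ?thesis
    by (simp only: local_dirichlet_def summable_complex_of_real)
qed

lemma boundary_value_shift:
  assumes "cmod \<zeta> = 1" "local_dirichlet \<zeta> a"
  shows "boundary_value \<zeta> (shift a) = \<zeta> * boundary_value \<zeta> a"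
proof (rule LIMSEQ_unique)
  show "(\<lambda>n. psum \<zeta> (shift a) (Suc n)) \<longlonglongrightarrow> boundary_value \<zeta> (shift a)"
    by (intro LIMSEQ_Suc psum_tendsto local_dirichlet_shift assms)
  show "(\<lambda>n. psum \<zeta> (shift a) (Suc n)) \<longlonglongrightarrow> \<zeta> * boundary_value \<zeta> a"
    unfolding psum_shift by (intro tendsto_intros psum_tendsto assms)
qed

text \<open>The sums \<open>deriv_psum\<close> of the backward shift differ from those of
  \<open>a\<close> at the next index, up to a unimodular factor, by partial sums
  \<open>psum\<close>. These are bounded because the partial sums of \<open>a\<close> converge, and
  a bounded sequence is summable against the weights.\<close>

lemma local_dirichlet_backward_shift:
  assumes \<zeta>: "cmod \<zeta> = 1" and a: "local_dirichlet \<zeta> a"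
  shows "local_dirichlet \<zeta> (\<lambda>n. a (Suc n))"
proof -
  define b where "b n = a (Suc n)" for n
  \<comment> \<open>Dropping the constant coefficient does not affect \<open>deriv_psum\<close> and
    changes \<open>psum\<close> by a constant.\<close>
  have D: "deriv_psum \<zeta> a n = deriv_psum \<zeta> (shift b) n" for n
    by (induction n) (simp_all add: deriv_psum_Suc b_def)
  have P: "psum \<zeta> a n = a 0 + psum \<zeta> (shift b) n" for n
    by (induction n) (simp_all add: psum_Suc b_def)
  obtain C where C: "\<And>n. cmod (psum \<zeta> a n) \<le> C"
    using convergent_imp_Bseq[OF convergentI[OF psum_tendsto[OF a]]] by (auto simp: Bseq_def)
  have C0: "0 \<le> C" using C[of 0] norm_ge_zero order_trans by blast
  have pb: "cmod (psum \<zeta> b n) \<le> 2 * C" for n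
  proof -
    have "\<zeta> * psum \<zeta> b n = psum \<zeta> a (Suc n) - psum \<zeta> a 0" by (simp add: P psum_shift)
    then have "cmod (psum \<zeta> b n) = cmod (psum \<zeta> a (Suc n) - psum \<zeta> a 0)"
      using \<zeta> by (metis mult_1 norm_mult)
    also have "\<dots> \<le> C + C" by (rule norm_triangle_le_diff) (intro add_mono C)
    finally show ?thesis by simp
  qed
  let ?A = "\<lambda>n. (cmod (deriv_psum \<zeta> a n))\<^sup>2 / (real n * (real n + 1))"
  have le: "(cmod (deriv_psum \<zeta> b n))\<^sup>2 / (real n * (real n + 1))
      \<le> 6 * ?A (Suc n) + 8 * C\<^sup>2 * (1 / (real n * (real n + 1)))" for n
  proof (cases "n = 0")
    case False
    have "\<zeta> * deriv_psum \<zeta> b n = deriv_psum \<zeta> a (Suc n) - \<zeta> * psum \<zeta> b n"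
      by (simp add: D deriv_psum_shift algebra_simps)
    then have "cmod (deriv_psum \<zeta> b n) = cmod (deriv_psum \<zeta> a (Suc n) - \<zeta> * psum \<zeta> b n)"
      using \<zeta> by (metis mult_1 norm_mult)
    also have "\<dots> \<le> cmod (deriv_psum \<zeta> a (Suc n)) + cmod (\<zeta> * psum \<zeta> b n)"
      by (rule norm_triangle_ineq4)
    also have "\<dots> \<le> cmod (deriv_psum \<zeta> a (Suc n)) + 2 * C"
      using pb[of n] \<zeta> by (simp add: norm_mult)
    finally have "(cmod (deriv_psum \<zeta> b n))\<^sup>2 \<le> (cmod (deriv_psum \<zeta> a (Suc n)) + 2 * C)\<^sup>2"
      by (simp add: power_mono)
    also have "\<dots> \<le> 2 * (cmod (deriv_psum \<zeta> a (Suc n)))\<^sup>2 + 8 * C\<^sup>2"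
      using sum_squares_bound[of "cmod (deriv_psum \<zeta> a (Suc n))" "2 * C"]
      by (simp add: power2_sum power_mult_distrib)
    finally have "(cmod (deriv_psum \<zeta> b n))\<^sup>2 / (real n * (real n + 1))
        \<le> (2 * (cmod (deriv_psum \<zeta> a (Suc n)))\<^sup>2 + 8 * C\<^sup>2) / (real n * (real n + 1))"
      by (intro divide_right_mono) auto
    also have "\<dots> = 2 * (cmod (deriv_psum \<zeta> a (Suc n)))\<^sup>2 / (real n * (real n + 1)) + 8 * C\<^sup>2 * (1 / (real n * (real n + 1)))"
      by (simp add: add_divide_distrib)
    also have "2 * (cmod (deriv_psum \<zeta> a (Suc n)))\<^sup>2 / (real n * (real n + 1)) \<le> 6 * ?A (Suc n)"
    proof -
      \<comment> \<open>The factor 3 works because \<open>n + 2 \<le> 3 * n\<close> for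
        \<open>n \<ge> 1\<close>.\<close>
      have "1 / (real n * (real n + 1)) \<le> 3 / (real (Suc n) * (real (Suc n) + 1))"
        using False mult_mono[of 1 "real n" 1 "real n"] by (simp add: divide_simps) (simp add: algebra_simps)
      from mult_left_mono[OF this, of "2 * (cmod (deriv_psum \<zeta> a (Suc n)))\<^sup>2"] show ?thesis by simp
    qed
    finally show ?thesis by simp
  qed simp
  have "summable (\<lambda>n. 6 * ?A (Suc n) + 8 * C\<^sup>2 * (1 / (real n * (real n + 1))))"
    using iffD2[OF summable_Suc_iff a[unfolded local_dirichlet_def]]
    by (intro summable_add summable_mult summable_inverse_consecutive)
  then have "local_dirichlet \<zeta> b"
    unfolding local_dirichlet_def
    by (rule summable_comparison_test'[of _ 0]) (use le in simp)
  then show ?thesis by (simp add: b_def[abs_def])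
qed

text \<open>Up to a unimodular factor, \<open>(n + 1) * a (n + 1)\<close> is a difference of two
  consecutive values of \<open>deriv_psum\<close>. This is the inclusion of the Dirichlet-type space
  in the Hardy space.\<close>

lemma local_dirichlet_square_summable:
  assumes \<zeta>: "cmod \<zeta> = 1" and a: "local_dirichlet \<zeta> a"
  shows "summable (\<lambda>n. (cmod (a n))\<^sup>2)"
proof -
  let ?A = "\<lambda>n. (cmod (deriv_psum \<zeta> a n))\<^sup>2 / (real n * (real n + 1))"
  have le: "(cmod (a (Suc n)))\<^sup>2 \<le> 4 * ?A (Suc n) + 2 * ?A n" for n
  proof -
    let ?x = "cmod (deriv_psum \<zeta> a (Suc n))" and ?y = "cmod (deriv_psum \<zeta> a n)" and ?m = "real (Suc n)"
    have "of_nat (Suc n) * a (Suc n) * \<zeta> ^ Suc n = deriv_psum \<zeta> a (Suc n) - deriv_psum \<zeta> a n"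
      by (simp add: deriv_psum_Suc)
    then have "cmod (of_nat (Suc n) * a (Suc n) * \<zeta> ^ Suc n) \<le> ?x + ?y"
      using norm_triangle_ineq4 by metis
    then have "?m * cmod (a (Suc n)) \<le> ?x + ?y"
      by (simp only: norm_mult norm_power \<zeta> power_one mult_1_right norm_of_nat)
    then have "(?m * cmod (a (Suc n)))\<^sup>2 \<le> (?x + ?y)\<^sup>2" by (intro power_mono) auto
    also have "\<dots> \<le> 2 * ?x\<^sup>2 + 2 * ?y\<^sup>2"
      using sum_squares_bound[of ?x ?y] by (simp add: power2_sum)
    finally have "(cmod (a (Suc n)))\<^sup>2 \<le> (2 * ?x\<^sup>2 + 2 * ?y\<^sup>2) / ?m\<^sup>2"
      by (subst pos_le_divide_eq) (simp_all only: power_mult_distrib mult.commute zero_less_power of_nat_0_less_iff zero_less_Suc)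
    also have "\<dots> = 2 * (?x\<^sup>2 / ?m\<^sup>2) + 2 * (?y\<^sup>2 / ?m\<^sup>2)" by (simp add: add_divide_distrib)
    also have "?x\<^sup>2 / ?m\<^sup>2 \<le> 2 * ?A (Suc n)"
    proof -
      have "1 / ?m\<^sup>2 \<le> 2 / (?m * (?m + 1))"
        by (simp add: divide_simps) (simp add: power2_eq_square algebra_simps)
      from mult_left_mono[OF this, of "?x\<^sup>2"] show ?thesis by (simp add: ac_simps)
    qed
    also have "?y\<^sup>2 / ?m\<^sup>2 \<le> ?A n"
    proof (cases "n = 0")
      case False
      have "real n * (real n + 1) \<le> ?m\<^sup>2" by (simp add: power2_eq_square algebra_simps)
      moreover have "0 < ?m\<^sup>2 * (real n * (real n + 1))" using False by (intro mult_pos_pos) auto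
      ultimately show ?thesis by (intro divide_left_mono) auto
    qed simp
    finally show ?thesis by simp
  qed
  have "summable (\<lambda>n. 4 * ?A (Suc n) + 2 * ?A n)"
    using a[unfolded local_dirichlet_def] iffD2[OF summable_Suc_iff a[unfolded local_dirichlet_def]]
    by (intro summable_add summable_mult)
  then have "summable (\<lambda>n. (cmod (a (Suc n)))\<^sup>2)"
    by (rule summable_comparison_test'[of _ 0]) (use le in simp)
  then show ?thesis using summable_Suc_iff[of "\<lambda>n. (cmod (a n))\<^sup>2"] by blast
qed

lemma summable_mult_cnj:
  assumes "summable (\<lambda>n. (cmod (a n))\<^sup>2)" "summable (\<lambda>n. (cmod (b n))\<^sup>2)"
  shows "summable (\<lambda>n. a n * cnj (b n))"
proof (rule summable_norm_cancel, rule summable_comparison_test'[of _ 0])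
  show "summable (\<lambda>n. (cmod (a n))\<^sup>2 + (cmod (b n))\<^sup>2)" using assms by (rule summable_add)
  fix n
  have "cmod (a n) * cmod (b n) \<le> (cmod (a n))\<^sup>2 + (cmod (b n))\<^sup>2"
    using sum_squares_bound[of "cmod (a n)" "cmod (b n)"]
      mult_nonneg_nonneg[OF norm_ge_zero norm_ge_zero, of "a n" "b n"] by linarith
  then show "norm (norm (a n * cnj (b n))) \<le> (cmod (a n))\<^sup>2 + (cmod (b n))\<^sup>2"
    by (simp add: norm_mult)
qed

section \<open>The weighted sequence space and its completeness\<close>

definition weighted_sq :: "complex \<Rightarrow> complex \<Rightarrow> (nat \<Rightarrow> complex) \<Rightarrow> nat \<Rightarrow> real" where
  "weighted_sq \<zeta>1 \<zeta>2 a n = (cmod (a n))\<^sup>2 + (cmod (deriv_psum \<zeta>1 a n))\<^sup>2 / (real n * (real n + 1))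
     + (cmod (deriv_psum \<zeta>2 a n))\<^sup>2 / (real n * (real n + 1))"

lemma weighted_sq_nonneg [simp]: "0 \<le> weighted_sq \<zeta>1 \<zeta>2 a n"
  by (simp add: weighted_sq_def)

lemma summable_weighted_sq_iff:
  assumes "cmod \<zeta>1 = 1" "cmod \<zeta>2 = 1"
  shows "summable (weighted_sq \<zeta>1 \<zeta>2 a) \<longleftrightarrow> local_dirichlet \<zeta>1 a \<and> local_dirichlet \<zeta>2 a"
proof
  assume *: "summable (weighted_sq \<zeta>1 \<zeta>2 a)"
  show "local_dirichlet \<zeta>1 a \<and> local_dirichlet \<zeta>2 a"
    unfolding local_dirichlet_def
    by (intro conjI summable_comparison_test'[OF *, of 0]) (simp_all add: weighted_sq_def)
next
  assume "local_dirichlet \<zeta>1 a \<and> local_dirichlet \<zeta>2 a"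
  then show "summable (weighted_sq \<zeta>1 \<zeta>2 a)"
    unfolding weighted_sq_def using local_dirichlet_square_summable[OF assms(1)]
    by (intro summable_add) (auto simp: local_dirichlet_def)
qed

text \<open>The sums of \<open>weighted_sq\<close> are the squared norms. As for square summable
  sequences, the limit is taken coordinatewise, and the Cauchy bound passes first to finite partial
  sums and then to the whole series.\<close>

lemma weighted_sq_complete:
  fixes x :: "nat \<Rightarrow> nat \<Rightarrow> complex"
  assumes sm: "\<And>m n. summable (weighted_sq \<zeta>1 \<zeta>2 (\<lambda>k. x m k - x n k))"
    and cauchy: "\<And>e. e > 0 \<Longrightarrow> \<exists>N. \<forall>m\<ge>N. \<forall>n\<ge>N. (\<Sum>k. weighted_sq \<zeta>1 \<zeta>2 (\<lambda>k. x m k - x n k) k) < e"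
  shows "\<exists>a. (\<exists>m. summable (weighted_sq \<zeta>1 \<zeta>2 (\<lambda>k. x m k - a k))) \<and>
    (\<lambda>m. \<Sum>k. weighted_sq \<zeta>1 \<zeta>2 (\<lambda>k. x m k - a k) k) \<longlonglongrightarrow> 0"
proof -
  let ?w = "weighted_sq \<zeta>1 \<zeta>2"
  have "Cauchy (\<lambda>m. x m k)" for k
  proof (rule metric_CauchyI)
    fix e :: real assume "e > 0"
    then obtain N where N: "\<And>m n. m \<ge> N \<Longrightarrow> n \<ge> N \<Longrightarrow> (\<Sum>k. ?w (\<lambda>k. x m k - x n k) k) < e\<^sup>2"
      using cauchy[of "e\<^sup>2"] by auto
    have "dist (x m k) (x n k) < e" if "m \<ge> N" "n \<ge> N" for m n
    proof -
      have "(cmod (x m k - x n k))\<^sup>2 \<le> ?w (\<lambda>k. x m k - x n k) k"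
        by (simp add: weighted_sq_def)
      also have "\<dots> \<le> (\<Sum>k. ?w (\<lambda>k. x m k - x n k) k)"
        using sum_le_suminf[OF sm, of "{k}"] by simp
      finally have "(cmod (x m k - x n k))\<^sup>2 < e\<^sup>2" using N[OF that] by simp
      then show ?thesis
        using \<open>e > 0\<close> power2_less_imp_less[of "cmod (x m k - x n k)" e] by (simp add: dist_norm)
    qed
    then show "\<exists>M. \<forall>m\<ge>M. \<forall>n\<ge>M. dist (x m k) (x n k) < e" by blast
  qed
  then have "\<exists>l. (\<lambda>m. x m k) \<longlonglongrightarrow> l" for k
    by (simp add: Cauchy_convergent_iff convergent_def)
  then obtain a where a: "\<And>k. (\<lambda>m. x m k) \<longlonglongrightarrow> a k" by metis
  \<comment> \<open>The summand with index \<open>k\<close> involves only the coordinates up to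
    \<open>k\<close>, so coordinatewise convergence suffices.\<close>
  have lim: "(\<lambda>n. ?w (\<lambda>k. x m k - x n k) k) \<longlonglongrightarrow> ?w (\<lambda>k. x m k - a k) k" for m k
  proof -
    have "(\<lambda>n. deriv_psum \<zeta> (\<lambda>k. x m k - x n k) k) \<longlonglongrightarrow> deriv_psum \<zeta> (\<lambda>k. x m k - a k) k" for \<zeta>
      unfolding deriv_psum_def by (intro tendsto_intros a)
    note lim' = this
    show ?thesis
      unfolding weighted_sq_def divide_inverse by (intro tendsto_intros a lim')
  qed
  have tail: "\<exists>N. \<forall>m\<ge>N. summable (?w (\<lambda>k. x m k - a k)) \<and> (\<Sum>k. ?w (\<lambda>k. x m k - a k) k) \<le> e" if "e > 0" for e
  proof -
    obtain N where N: "\<And>m n. m \<ge> N \<Longrightarrow> n \<ge> N \<Longrightarrow> (\<Sum>k. ?w (\<lambda>k. x m k - x n k) k) < e"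
      using cauchy[OF \<open>e > 0\<close>] by auto
    have "summable (?w (\<lambda>k. x m k - a k)) \<and> (\<Sum>k. ?w (\<lambda>k. x m k - a k) k) \<le> e" if m: "m \<ge> N" for m
    proof -
      have part: "(\<Sum>k<K. ?w (\<lambda>k. x m k - a k) k) \<le> e" for K
      proof (rule LIMSEQ_le_const2)
        show "(\<lambda>n. \<Sum>k<K. ?w (\<lambda>k. x m k - x n k) k) \<longlonglongrightarrow> (\<Sum>k<K. ?w (\<lambda>k. x m k - a k) k)"
          by (intro tendsto_sum lim)
        have "(\<Sum>k<K. ?w (\<lambda>k. x m k - x n k) k) \<le> e" if "n \<ge> N" for n
          using sum_le_suminf[OF sm, of "{..<K}" m n] N[OF m that] by simp
        then show "\<exists>N. \<forall>n\<ge>N. (\<Sum>k<K. ?w (\<lambda>k. x m k - x n k) k) \<le> e" by blast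
      qed
      have s: "summable (?w (\<lambda>k. x m k - a k))"
        by (rule summableI_nonneg_bounded[OF _ part]) simp
      then show ?thesis using suminf_le_const[OF s part] by blast
    qed
    then show ?thesis by blast
  qed
  have "(\<lambda>m. \<Sum>k. ?w (\<lambda>k. x m k - a k) k) \<longlonglongrightarrow> 0"
  proof (rule LIMSEQ_I)
    fix e :: real assume "e > 0"
    then obtain N where N: "\<And>m. m \<ge> N \<Longrightarrow> summable (?w (\<lambda>k. x m k - a k)) \<and> (\<Sum>k. ?w (\<lambda>k. x m k - a k) k) \<le> e / 2"
      using tail[of "e / 2"] by auto
    have "norm ((\<Sum>k. ?w (\<lambda>k. x m k - a k) k) - 0) < e" if "m \<ge> N" for m
      using N[OF that] suminf_nonneg[of "?w (\<lambda>k. x m k - a k)"] \<open>e > 0\<close> by simp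
    then show "\<exists>no. \<forall>m\<ge>no. norm ((\<Sum>k. ?w (\<lambda>k. x m k - a k) k) - 0) < e" by blast
  qed
  moreover have "\<exists>m. summable (?w (\<lambda>k. x m k - a k))" using tail[of 1] by auto
  ultimately show ?thesis by blast
qed

section \<open>Taylor coefficients and the Dirichlet integral\<close>

lemma taylor_coeff_sums:
  assumes "f holomorphic_on ball 0 1" "cmod z < 1"
  shows "(\<lambda>n. taylor_coeff f n * z ^ n) sums f z"
  using holomorphic_power_series[of f 0 1 z] assms by (simp add: taylor_coeff_def)

lemma taylor_coeff_unique:
  assumes "\<And>z. cmod z < 1 \<Longrightarrow> (\<lambda>n. a n * z ^ n) sums f z"
  shows "f holomorphic_on ball 0 1" "taylor_coeff f n = a n"
proof -
  show "f holomorphic_on ball 0 1"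
    by (rule power_series_holomorphic[where a = a]) (use assms in simp)
  have "eventually (\<lambda>u. (\<lambda>n. fps_nth (Abs_fps a) n * u ^ n) sums f u) (nhds 0)"
    by (rule eventually_nhds_in_open[of "ball 0 1", THEN eventually_mono]) (use assms in simp_all)
  from fps_nth_fps_expansion[OF has_fps_expansionI[OF this]]
  show "taylor_coeff f n = a n" by (simp add: taylor_coeff_def)
qed

lemma taylor_coeff_deriv: "taylor_coeff (deriv f) n = of_nat (Suc n) * taylor_coeff f (Suc n)"
proof -
  have "(deriv ^^ n) (deriv f) = (deriv ^^ Suc n) f" by (simp only: funpow_Suc_right o_apply)
  then show ?thesis by (simp add: taylor_coeff_def del: of_nat_Suc)
qed

lemma taylor_coeff_add:
  assumes "f holomorphic_on ball 0 1" "g holomorphic_on ball 0 1"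
  shows "taylor_coeff (\<lambda>z. f z + g z) n = taylor_coeff f n + taylor_coeff g n"
  using taylor_coeff_sums assms
  by (intro taylor_coeff_unique(2)) (auto simp: distrib_right intro!: sums_add)

lemma taylor_coeff_cmult:
  assumes "f holomorphic_on ball 0 1"
  shows "taylor_coeff (\<lambda>z. c * f z) n = c * taylor_coeff f n"
  using taylor_coeff_sums assms
  by (intro taylor_coeff_unique(2)) (auto simp: mult.assoc intro!: sums_mult)

lemma taylor_coeff_Mz:
  assumes "f holomorphic_on ball 0 1"
  shows "taylor_coeff (Mz f) = shift (taylor_coeff f)"
proof
  fix n
  have "(\<lambda>n. shift (taylor_coeff f) n * z ^ n) sums Mz f z" if "cmod z < 1" for z
  proof -
    have "(\<lambda>n. z * (taylor_coeff f n * z ^ n)) sums (z * f z)"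
      using taylor_coeff_sums[OF assms that] by (rule sums_mult)
    then have "(\<lambda>n. shift (taylor_coeff f) (Suc n) * z ^ Suc n) sums (z * f z)"
      by (simp add: ac_simps)
    from sums_Suc[OF this] show ?thesis by (simp add: Mz_def)
  qed
  then show "taylor_coeff (Mz f) n = shift (taylor_coeff f) n" by (rule taylor_coeff_unique(2))
qed

text \<open>Cauchy product of the series of \<open>deriv f\<close> with the geometric series in
  \<open>cnj \<zeta> * z\<close>.\<close>

lemma cauchy_kernel_quotient_sums:
  assumes f: "f holomorphic_on ball 0 1" and \<zeta>: "cmod \<zeta> = 1" and z: "cmod z < 1"
  shows "(\<lambda>n. cnj \<zeta> ^ Suc n * deriv_psum \<zeta> (taylor_coeff f) (Suc n) * z ^ n) sums (deriv f z / (1 - cnj \<zeta> * z))"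
proof -
  define a where "a = taylor_coeff f"
  have "\<zeta> * cnj \<zeta> = 1" using \<zeta> complex_norm_square[of \<zeta>] by simp
  then have \<zeta>\<zeta>: "cnj \<zeta> ^ k * \<zeta> ^ k = 1" for k
    by (metis mult.commute power_mult_distrib power_one)
  have df: "deriv f holomorphic_on ball 0 1" by (rule holomorphic_deriv[OF f]) simp
  have 1: "(\<lambda>n. taylor_coeff (deriv f) n * w ^ n) sums deriv f w" if "cmod w < 1" for w
    by (rule taylor_coeff_sums[OF df that])
  have n1: "summable (\<lambda>n. norm (taylor_coeff (deriv f) n * z ^ n))"
  proof (rule powser_insidea)
    have "cmod (complex_of_real ((1 + cmod z) / 2)) < 1"
      by (simp only: norm_of_real) (use z in simp)
    from 1[OF this]
    show "summable (\<lambda>n. taylor_coeff (deriv f) n * complex_of_real ((1 + cmod z) / 2) ^ n)"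
      by (simp only: sums_iff)
    show "norm z < norm (complex_of_real ((1 + cmod z) / 2))"
      by (simp only: norm_of_real) (use z in simp)
  qed
  have nz: "norm (cnj \<zeta> * z) < 1" using \<zeta> z by (simp add: norm_mult)
  have n2: "summable (\<lambda>n. norm ((cnj \<zeta> * z) ^ n))"
    unfolding norm_power using nz by (intro summable_geometric) simp
  have "(\<lambda>k. \<Sum>i\<le>k. (taylor_coeff (deriv f) i * z ^ i) * (cnj \<zeta> * z) ^ (k - i)) sums
      ((\<Sum>k. taylor_coeff (deriv f) k * z ^ k) * (\<Sum>k. (cnj \<zeta> * z) ^ k))"
    by (rule Cauchy_product_sums[OF n1 n2])
  moreover have "(\<Sum>k. taylor_coeff (deriv f) k * z ^ k) = deriv f z"
    using 1[OF z] by (simp add: sums_iff)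
  moreover have "(\<Sum>k. (cnj \<zeta> * z) ^ k) = 1 / (1 - cnj \<zeta> * z)"
    by (rule suminf_geometric[OF nz])
  moreover have "(\<Sum>i\<le>k. (taylor_coeff (deriv f) i * z ^ i) * (cnj \<zeta> * z) ^ (k - i))
      = cnj \<zeta> ^ Suc k * deriv_psum \<zeta> a (Suc k) * z ^ k" for k
  proof -
    have "(taylor_coeff (deriv f) i * z ^ i) * (cnj \<zeta> * z) ^ (k - i)
        = cnj \<zeta> ^ Suc k * (of_nat (Suc i) * a (Suc i) * \<zeta> ^ Suc i) * z ^ k" if "i \<le> k" for i
    proof -
      \<comment> \<open>As \<open>\<zeta>\<close> is unimodular, the geometric factor splits into
        one depending on \<open>k\<close> only and one depending on \<open>i\<close> only; the inner
        sum then becomes \<open>deriv_psum\<close>.\<close>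
      have "cnj \<zeta> ^ Suc k * \<zeta> ^ Suc i = cnj \<zeta> ^ (k - i) * (cnj \<zeta> ^ Suc i * \<zeta> ^ Suc i)"
        using that by (simp only: mult.assoc[symmetric] power_add[symmetric]) simp
      then have "cnj \<zeta> ^ (k - i) = cnj \<zeta> ^ Suc k * \<zeta> ^ Suc i" by (simp only: \<zeta>\<zeta> mult_1_right)
      moreover have "z ^ i * z ^ (k - i) = z ^ k" using that by (simp add: power_add[symmetric])
      moreover have "(taylor_coeff (deriv f) i * z ^ i) * (cnj \<zeta> * z) ^ (k - i)
          = of_nat (Suc i) * a (Suc i) * cnj \<zeta> ^ (k - i) * (z ^ i * z ^ (k - i))"
        unfolding power_mult_distrib taylor_coeff_deriv a_def by (simp only: ac_simps)
      ultimately show ?thesis by (simp only: ac_simps)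
    qed
    moreover have "deriv_psum \<zeta> a (Suc k) = (\<Sum>i\<le>k. of_nat (Suc i) * a (Suc i) * \<zeta> ^ Suc i)"
      unfolding deriv_psum_def by (subst sum.atMost_Suc_shift) simp
    ultimately show ?thesis by (simp add: sum_distrib_left sum_distrib_right del: of_nat_Suc power_Suc)
  qed
  ultimately show ?thesis by (simp add: a_def)
qed

text \<open>On the circle \<open>cnj \<zeta>\<close> inverts \<open>\<zeta>\<close>, so
  \<open>1 - cnj \<zeta> * z\<close> and \<open>z - \<zeta>\<close> have equal moduli. The integrand
  thus becomes the weighted Bergman density of \<open>f' / (1 - cnj \<zeta> * z)\<close>, to which
  Parseval's identity applies.\<close>

lemma nn_integral_local_dirichlet:
  assumes f: "f holomorphic_on ball 0 1" and \<zeta>: "cmod \<zeta> = 1"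
  shows "(\<integral>\<^sup>+z. ennreal ((cmod (deriv f z))\<^sup>2 * ((1 - (cmod z)\<^sup>2) / (cmod (z - \<zeta>))\<^sup>2)) * indicator (ball 0 1) z \<partial>disc_area)
    = (\<Sum>n. ennreal ((cmod (deriv_psum \<zeta> (taylor_coeff f) n))\<^sup>2 / (real n * (real n + 1))))"
proof -
  have "cmod (1 - cnj \<zeta> * z) = cmod (z - \<zeta>)" for z
  proof -
    have "\<zeta> * cnj \<zeta> = 1" using \<zeta> complex_norm_square[of \<zeta>] by simp
    then have "1 - cnj \<zeta> * z = cnj \<zeta> * (\<zeta> - z)" by (simp add: algebra_simps)
    then show ?thesis using \<zeta> by (simp add: norm_mult norm_minus_commute)
  qed
  then have "(\<integral>\<^sup>+z. ennreal ((cmod (deriv f z))\<^sup>2 * ((1 - (cmod z)\<^sup>2) / (cmod (z - \<zeta>))\<^sup>2)) * indicator (ball 0 1) z \<partial>disc_area)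
    = (\<integral>\<^sup>+z. ennreal ((cmod (deriv f z / (1 - cnj \<zeta> * z)))\<^sup>2 * (1 - (cmod z)\<^sup>2)) * indicator (ball 0 1) z \<partial>disc_area)"
    by (simp add: norm_divide power_divide)
  also have "\<dots> = (\<Sum>n. ennreal ((cmod (cnj \<zeta> ^ Suc n * deriv_psum \<zeta> (taylor_coeff f) (Suc n)))\<^sup>2 / ((n + 1) * (n + 2))))"
    by (rule disc_parseval) (rule cauchy_kernel_quotient_sums[OF f \<zeta>])
  also have "\<dots> = (\<Sum>n. ennreal ((cmod (deriv_psum \<zeta> (taylor_coeff f) (Suc n)))\<^sup>2 / (real (Suc n) * (real (Suc n) + 1))))"
    using \<zeta> by (simp add: norm_mult norm_power algebra_simps)
  also have "\<dots> = (\<Sum>n. ennreal ((cmod (deriv_psum \<zeta> (taylor_coeff f) n))\<^sup>2 / (real n * (real n + 1))))"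
    (is "_ = (\<Sum>n. ?t n)")
  proof -
    \<comment> \<open>The term at 0 vanishes, so the index may start at 0 instead of 1.\<close>
    have "(\<lambda>n. ?t (Suc n)) sums (\<Sum>n. ?t (Suc n))" by (rule summable_sums) (rule summableI)
    from sums_Suc[OF this] show ?thesis by (simp add: sums_iff)
  qed
  finally show ?thesis .
qed

text \<open>As a push-forward of the counting measure on two points, the sum of the Dirac measures
  turns the Poisson integral into a finite sum.\<close>

lemma add_dirac_eq_distr:
  assumes "cmod \<zeta>1 = 1" "cmod \<zeta>2 = 1"
  shows "add_measure (dirac \<zeta>1) (dirac \<zeta>2)
    = distr (count_space UNIV) circle_borel (\<lambda>b. if b then \<zeta>1 else \<zeta>2)"
proof (rule measure_eqI)
  have sp: "space circle_borel = sphere 0 1" by (simp add: circle_borel_def space_restrict_space)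
  show "sets (add_measure (dirac \<zeta>1) (dirac \<zeta>2)) = sets (distr (count_space UNIV) circle_borel (\<lambda>b. if b then \<zeta>1 else \<zeta>2))"
    by (simp add: add_measure_def dirac_def sets.sets_measure_of_eq)
  fix A assume "A \<in> sets (add_measure (dirac \<zeta>1) (dirac \<zeta>2))"
  then have A: "A \<in> sets circle_borel"
    by (simp add: add_measure_def dirac_def sets.sets_measure_of_eq)
  have "emeasure (add_measure (dirac \<zeta>1) (dirac \<zeta>2)) A = indicator A \<zeta>1 + indicator A \<zeta>2"
    using A by (simp add: emeasure_add_measure dirac_def)
  also have "\<dots> = emeasure (count_space UNIV) ((\<lambda>b. if b then \<zeta>1 else \<zeta>2) -` A)"
  proof -
    have "(\<lambda>b. if b then \<zeta>1 else \<zeta>2) -` A = (if \<zeta>1 \<in> A then {True} else {}) \<union> (if \<zeta>2 \<in> A then {False} else {})"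
      by (auto split: if_splits)
    then show ?thesis by (simp add: emeasure_count_space split: split_indicator)
  qed
  also have "\<dots> = emeasure (distr (count_space UNIV) circle_borel (\<lambda>b. if b then \<zeta>1 else \<zeta>2)) A"
    using A assms by (subst emeasure_distr) (auto simp: sp)
  finally show "emeasure (add_measure (dirac \<zeta>1) (dirac \<zeta>2)) A
      = emeasure (distr (count_space UNIV) circle_borel (\<lambda>b. if b then \<zeta>1 else \<zeta>2)) A" .
qed

lemma poisson_add_dirac:
  assumes "cmod \<zeta>1 = 1" "cmod \<zeta>2 = 1"
  shows "poisson (add_measure (dirac \<zeta>1) (dirac \<zeta>2)) z
    = (1 - (cmod z)\<^sup>2) / (cmod (z - \<zeta>1))\<^sup>2 + (1 - (cmod z)\<^sup>2) / (cmod (z - \<zeta>2))\<^sup>2"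
proof -
  have sp: "space circle_borel = sphere 0 1" by (simp add: circle_borel_def space_restrict_space)
  have m: "(\<lambda>\<zeta>. (1 - (cmod z)\<^sup>2) / (cmod (z - \<zeta>))\<^sup>2) \<in> borel_measurable circle_borel"
    unfolding circle_borel_def by (rule measurable_restrict_space1) measurable
  have "poisson (add_measure (dirac \<zeta>1) (dirac \<zeta>2)) z
    = (\<integral>b. (1 - (cmod z)\<^sup>2) / (cmod (z - (if b then \<zeta>1 else \<zeta>2)))\<^sup>2 \<partial>count_space UNIV)"
    unfolding poisson_def add_dirac_eq_distr[OF assms]
    by (rule integral_distr[OF _ m]) (use assms in \<open>simp add: sp\<close>)
  then show ?thesis
    by (simp add: lebesgue_integral_count_space_finite UNIV_bool)
qed

section \<open>Dirichlet-type spaces of two point masses\<close>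

locale two_point_dirichlet =
  fixes \<zeta>1 \<zeta>2 :: complex and \<mu> :: "complex measure"
  assumes \<zeta>1: "cmod \<zeta>1 = 1" and \<zeta>2: "cmod \<zeta>2 = 1"
    and \<mu>: "\<mu> = add_measure (dirac \<zeta>1) (dirac \<zeta>2)"
begin

abbreviation D where "D \<equiv> Dspace \<mu>"
abbreviation tc where "tc \<equiv> taylor_coeff"

definition energy_density :: "(complex \<Rightarrow> complex) \<Rightarrow> complex \<Rightarrow> real" where
  "energy_density f z = indicator (ball 0 1) z *\<^sub>R ((cmod (deriv f z))\<^sup>2 * poisson \<mu> z)"

definition energy_term :: "(nat \<Rightarrow> complex) \<Rightarrow> nat \<Rightarrow> real" where
  "energy_term a n = (cmod (deriv_psum \<zeta>1 a n))\<^sup>2 / (real n * (real n + 1))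
    + (cmod (deriv_psum \<zeta>2 a n))\<^sup>2 / (real n * (real n + 1))"

lemma energy_term_nonneg [simp]: "0 \<le> energy_term a n"
  by (simp add: energy_term_def)

lemma poisson_eq:
  "poisson \<mu> z = (1 - (cmod z)\<^sup>2) / (cmod (z - \<zeta>1))\<^sup>2 + (1 - (cmod z)\<^sup>2) / (cmod (z - \<zeta>2))\<^sup>2"
  unfolding \<mu> by (rule poisson_add_dirac[OF \<zeta>1 \<zeta>2])

lemma poisson_nonneg: "cmod z < 1 \<Longrightarrow> 0 \<le> poisson \<mu> z"
  by (simp add: poisson_eq power_le_one)

lemma poisson_measurable [measurable]: "poisson \<mu> \<in> borel_measurable borel"
  unfolding poisson_eq[abs_def] by measurable

lemma energy_density_nonneg: "0 \<le> energy_density f z"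
  using poisson_nonneg by (simp add: energy_density_def split: split_indicator)

lemma energy_density_measurable:
  assumes "f holomorphic_on ball 0 1"
  shows "energy_density f \<in> borel_measurable borel"
proof -
  have "continuous_on (ball 0 1) (deriv f)"
    using holomorphic_deriv[OF assms open_ball] by (rule holomorphic_on_imp_continuous_on)
  then have [measurable]: "(\<lambda>z. indicator (ball 0 1) z *\<^sub>R deriv f z) \<in> borel_measurable borel"
    by (intro borel_measurable_continuous_on_indicator) simp_all
  have eq: "energy_density f = (\<lambda>z. (cmod (indicator (ball 0 1) z *\<^sub>R deriv f z))\<^sup>2 * poisson \<mu> z)"
    by (auto simp: energy_density_def fun_eq_iff split: split_indicator)
  show ?thesis unfolding eq by measurable
qed

lemma nn_integral_energy_density:
  assumes f: "f holomorphic_on ball 0 1"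
  shows "(\<integral>\<^sup>+z. ennreal (energy_density f z) \<partial>disc_area) = (\<Sum>n. ennreal (energy_term (tc f) n))"
proof -
  have cont: "continuous_on (ball 0 1) (deriv f)"
    using holomorphic_deriv[OF f open_ball] by (rule holomorphic_on_imp_continuous_on)
  then have dm [measurable]: "(\<lambda>z. indicator (ball 0 1) z *\<^sub>R deriv f z) \<in> borel_measurable borel"
    by (intro borel_measurable_continuous_on_indicator) simp_all
  let ?g = "\<lambda>\<zeta> z. ennreal ((cmod (deriv f z))\<^sup>2 * ((1 - (cmod z)\<^sup>2) / (cmod (z - \<zeta>))\<^sup>2)) * indicator (ball 0 1) z"
  have meas: "?g \<zeta> \<in> borel_measurable disc_area" for \<zeta>
  proof -
    have eq: "?g \<zeta> = (\<lambda>z. ennreal ((cmod (indicator (ball 0 1) z *\<^sub>R deriv f z))\<^sup>2 * ((1 - (cmod z)\<^sup>2) / (cmod (z - \<zeta>))\<^sup>2)))"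
      by (auto simp: fun_eq_iff split: split_indicator)
    show ?thesis unfolding eq by measurable
  qed
  have "(\<integral>\<^sup>+z. ennreal (energy_density f z) \<partial>disc_area) = (\<integral>\<^sup>+z. ?g \<zeta>1 z + ?g \<zeta>2 z \<partial>disc_area)"
    by (intro nn_integral_cong)
       (auto simp: energy_density_def poisson_eq distrib_left power_le_one
         ennreal_plus[symmetric] simp del: ennreal_plus split: split_indicator)
  also have "\<dots> = (\<integral>\<^sup>+z. ?g \<zeta>1 z \<partial>disc_area) + (\<integral>\<^sup>+z. ?g \<zeta>2 z \<partial>disc_area)"
    by (rule nn_integral_add[OF meas meas])
  also have "\<dots> = (\<Sum>n. ennreal ((cmod (deriv_psum \<zeta>1 (tc f) n))\<^sup>2 / (real n * (real n + 1))))
      + (\<Sum>n. ennreal ((cmod (deriv_psum \<zeta>2 (tc f) n))\<^sup>2 / (real n * (real n + 1))))"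
    by (simp only: nn_integral_local_dirichlet[OF f \<zeta>1] nn_integral_local_dirichlet[OF f \<zeta>2])
  also have "\<dots> = (\<Sum>n. ennreal ((cmod (deriv_psum \<zeta>1 (tc f) n))\<^sup>2 / (real n * (real n + 1)))
      + ennreal ((cmod (deriv_psum \<zeta>2 (tc f) n))\<^sup>2 / (real n * (real n + 1))))"
    by (rule suminf_add) (rule summableI)+
  finally show ?thesis by (simp add: energy_term_def)
qed

text \<open>Parseval's identity holds for extended nonnegative values, so finiteness of the
  Dirichlet integral is the same as summability of both coefficient series.\<close>

lemma Dspace_iff:
  "f \<in> D \<longleftrightarrow> f holomorphic_on ball 0 1 \<and> (\<forall>z. z \<notin> ball 0 1 \<longrightarrow> f z = 0)
    \<and> local_dirichlet \<zeta>1 (tc f) \<and> local_dirichlet \<zeta>2 (tc f)"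
proof -
  have "set_nn_integral disc_area (ball 0 1) (\<lambda>z. ennreal ((cmod (deriv f z))\<^sup>2 * poisson \<mu> z)) < \<infinity>
      \<longleftrightarrow> local_dirichlet \<zeta>1 (tc f) \<and> local_dirichlet \<zeta>2 (tc f)" if f: "f holomorphic_on ball 0 1"
  proof -
    have "set_nn_integral disc_area (ball 0 1) (\<lambda>z. ennreal ((cmod (deriv f z))\<^sup>2 * poisson \<mu> z))
        = (\<integral>\<^sup>+z. ennreal (energy_density f z) \<partial>disc_area)"
      by (intro nn_integral_cong) (auto simp: energy_density_def split: split_indicator)
    also have "\<dots> = (\<Sum>n. ennreal (energy_term (tc f) n))" by (rule nn_integral_energy_density[OF f])
    also have "\<dots> < \<infinity> \<longleftrightarrow> summable (energy_term (tc f))"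
    proof
      assume "(\<Sum>n. ennreal (energy_term (tc f) n)) < \<infinity>"
      then show "summable (energy_term (tc f))"
        by (intro summable_suminf_not_top) auto
    next
      assume "summable (energy_term (tc f))"
      then have "(\<Sum>n. ennreal (energy_term (tc f) n)) = ennreal (\<Sum>n. energy_term (tc f) n)"
        by (intro suminf_ennreal2) auto
      then show "(\<Sum>n. ennreal (energy_term (tc f) n)) < \<infinity>" by simp
    qed
    also have "\<dots> \<longleftrightarrow> local_dirichlet \<zeta>1 (tc f) \<and> local_dirichlet \<zeta>2 (tc f)"
    proof
      assume *: "summable (energy_term (tc f))"
      show "local_dirichlet \<zeta>1 (tc f) \<and> local_dirichlet \<zeta>2 (tc f)"
        unfolding local_dirichlet_def
        by (intro conjI summable_comparison_test'[OF *, of 0]) (simp_all add: energy_term_def)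
    next
      assume "local_dirichlet \<zeta>1 (tc f) \<and> local_dirichlet \<zeta>2 (tc f)"
      then show "summable (energy_term (tc f))"
        unfolding energy_term_def by (intro summable_add) (auto simp: local_dirichlet_def)
    qed
    finally show ?thesis .
  qed
  then show ?thesis by (auto simp: Dspace_def)
qed

lemma D_hol: "f \<in> D \<Longrightarrow> f holomorphic_on ball 0 1"
  and D_zero: "f \<in> D \<Longrightarrow> \<not> cmod z < 1 \<Longrightarrow> f z = 0"
  and D_local: "f \<in> D \<Longrightarrow> local_dirichlet \<zeta>1 (tc f)" "f \<in> D \<Longrightarrow> local_dirichlet \<zeta>2 (tc f)"
  and D_square_summable: "f \<in> D \<Longrightarrow> summable (\<lambda>n. (cmod (tc f n))\<^sup>2)"
  using local_dirichlet_square_summable[OF \<zeta>1] by (auto simp: Dspace_iff)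

text \<open>Such coefficients are square summable, hence bounded, so the power series converges on
  the whole disc.\<close>

lemma D_exists:
  assumes "local_dirichlet \<zeta>1 a" "local_dirichlet \<zeta>2 a"
  shows "\<exists>f\<in>D. tc f = a"
proof -
  have "summable (\<lambda>n. (cmod (a n))\<^sup>2)" by (rule local_dirichlet_square_summable[OF \<zeta>1 assms(1)])
  then have "(\<lambda>n. sqrt ((cmod (a n))\<^sup>2)) \<longlonglongrightarrow> sqrt 0"
    by (intro tendsto_intros summable_LIMSEQ_zero)
  then have "(\<lambda>n. cmod (a n)) \<longlonglongrightarrow> 0" by simp
  then have "Bseq a" by (simp add: convergent_imp_Bseq convergentI tendsto_norm_zero_iff)
  then obtain C where C: "\<And>n. cmod (a n) \<le> C" by (auto simp: Bseq_def)
  define f where "f z = (if cmod z < 1 then \<Sum>n. a n * z ^ n else 0)" for z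
  have "(\<lambda>n. a n * z ^ n) sums f z" if "cmod z < 1" for z
  proof -
    have "summable (\<lambda>n. a n * z ^ n)"
    proof (rule summable_comparison_test'[of "\<lambda>n. C * cmod z ^ n" 0])
      show "summable (\<lambda>n. C * cmod z ^ n)" using that by (intro summable_mult summable_geometric) simp
      show "norm (a n * z ^ n) \<le> C * cmod z ^ n" for n
        using C by (simp add: norm_mult norm_power mult_right_mono)
    qed
    then show ?thesis using that by (simp add: f_def summable_sums)
  qed
  note * = taylor_coeff_unique[OF this]
  have "tc f = a" using *(2) by (rule ext)
  moreover have "\<forall>z. z \<notin> ball 0 1 \<longrightarrow> f z = 0" by (simp add: f_def)
  with *(1) assms \<open>tc f = a\<close> have "f \<in> D" by (simp only: Dspace_iff)
  ultimately show ?thesis by blast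
qed

lemma D_eqI:
  assumes "f \<in> D" "g \<in> D" "tc f = tc g"
  shows "f = g"
proof
  fix z
  show "f z = g z"
  proof (cases "cmod z < 1")
    case True
    from taylor_coeff_sums[OF D_hol[OF assms(1)] this] taylor_coeff_sums[OF D_hol[OF assms(2)] this]
    show ?thesis using assms(3) sums_unique2 by metis
  qed (simp add: D_zero[OF assms(1)] D_zero[OF assms(2)])
qed

lemma tc_add: "f \<in> D \<Longrightarrow> g \<in> D \<Longrightarrow> tc (f + g) = (\<lambda>n. tc f n + tc g n)"
  by (simp add: plus_fun_def taylor_coeff_add D_hol fun_eq_iff)

lemma tc_scale: "f \<in> D \<Longrightarrow> tc (fun_scale c f) = (\<lambda>n. c * tc f n)"
  by (simp add: fun_scale_def taylor_coeff_cmult D_hol fun_eq_iff)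

lemma tc_Mz: "f \<in> D \<Longrightarrow> tc (Mz f) = shift (tc f)"
  by (simp add: taylor_coeff_Mz D_hol)

lemma D_add: "f \<in> D \<Longrightarrow> g \<in> D \<Longrightarrow> f + g \<in> D"
  unfolding Dspace_iff[of "f + g"]
  by (simp add: tc_add local_dirichlet_add D_local D_zero)
    (simp add: plus_fun_def holomorphic_on_add D_hol)

lemma D_scale: "f \<in> D \<Longrightarrow> fun_scale c f \<in> D"
  unfolding Dspace_iff[of "fun_scale c f"]
  by (simp add: tc_scale local_dirichlet_scale D_local)
    (simp add: fun_scale_def D_zero holomorphic_on_mult D_hol)

lemma D_Mz: "f \<in> D \<Longrightarrow> Mz f \<in> D"
  unfolding Dspace_iff[of "Mz f"]
  by (simp add: tc_Mz local_dirichlet_shift D_local \<zeta>1 \<zeta>2)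
    (simp add: Mz_def D_zero holomorphic_on_mult D_hol)

section \<open>The inner product in terms of Taylor coefficients\<close>

lemma has_bochner_integral_energy:
  assumes "f \<in> D"
  shows "has_bochner_integral disc_area (\<lambda>z. complex_of_real (energy_density f z))
    ((\<Sum>n. local_term \<zeta>1 (tc f) (tc f) n) + (\<Sum>n. local_term \<zeta>2 (tc f) (tc f) n))"
proof -
  have s1: "summable (\<lambda>n. (cmod (deriv_psum \<zeta>1 (tc f) n))\<^sup>2 / (real n * (real n + 1)))"
    and s2: "summable (\<lambda>n. (cmod (deriv_psum \<zeta>2 (tc f) n))\<^sup>2 / (real n * (real n + 1)))"
    using D_local[OF assms] by (simp_all add: local_dirichlet_def)
  have s: "summable (energy_term (tc f))"
    unfolding energy_term_def by (intro summable_add s1 s2)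
  have nn: "0 \<le> energy_term (tc f) n" for n by simp
  have "has_bochner_integral disc_area (energy_density f) (\<Sum>n. energy_term (tc f) n)"
  proof (rule has_bochner_integral_nn_integral)
    show "energy_density f \<in> borel_measurable disc_area"
      using energy_density_measurable[OF D_hol[OF assms]] by simp
    show "(\<integral>\<^sup>+z. ennreal (energy_density f z) \<partial>disc_area) = ennreal (\<Sum>n. energy_term (tc f) n)"
      unfolding nn_integral_energy_density[OF D_hol[OF assms]] by (rule suminf_ennreal2[OF nn s])
  qed (simp_all add: energy_density_nonneg suminf_nonneg[OF s nn])
  then have "has_bochner_integral disc_area (\<lambda>z. complex_of_real (energy_density f z))
      (complex_of_real (\<Sum>n. energy_term (tc f) n))"
    by (rule has_bochner_integral_of_real)
  moreover have "complex_of_real (\<Sum>n. energy_term (tc f) n)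
      = (\<Sum>n. local_term \<zeta>1 (tc f) (tc f) n) + (\<Sum>n. local_term \<zeta>2 (tc f) (tc f) n)"
    unfolding local_term_self energy_term_def suminf_add[OF s1 s2, symmetric] of_real_add
      suminf_of_real[OF s1] suminf_of_real[OF s2] ..
  ultimately show ?thesis by simp
qed

lemma polarization:
  fixes x y :: complex
  shows "x * cnj y = ((x + y) * cnj (x + y) - (x - y) * cnj (x - y)
    + \<i> * ((x + \<i> * y) * cnj (x + \<i> * y)) - \<i> * ((x - \<i> * y) * cnj (x - \<i> * y))) / 4"
  by (simp add: algebra_simps)

text \<open>The Hardy part is a series by definition. For the area integral, integrability and value
  are known on the diagonal only; polarization over \<open>f + c g\<close> with \<open>c\<close>
  among 1, -1, \<open>\<i>\<close> and \<open>-\<i>\<close> transfers both to pairs.\<close>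

theorem Dinner_eq:
  assumes f: "f \<in> D" and g: "g \<in> D"
  shows "Dinner \<mu> f g = (\<Sum>n. tc f n * cnj (tc g n)) + (\<Sum>n. local_term \<zeta>1 (tc f) (tc g) n)
    + (\<Sum>n. local_term \<zeta>2 (tc f) (tc g) n)"
proof -
  define h where "h c = f + fun_scale c g" for c
  have h: "h c \<in> D" for c using f g by (simp add: h_def D_add D_scale)
  have tc_h: "tc (h c) = (\<lambda>n. tc f n + c * tc g n)" for c
    using f g by (simp add: h_def tc_add tc_scale D_scale)
  define L where "L c = (\<Sum>n. local_term \<zeta>1 (tc (h c)) (tc (h c)) n) + (\<Sum>n. local_term \<zeta>2 (tc (h c)) (tc (h c)) n)" for c
  define E where "E c z = complex_of_real (energy_density (h c) z)" for c z
  have E: "has_bochner_integral disc_area (E c) (L c)" for c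
    using has_bochner_integral_energy[OF h[of c]] by (simp add: E_def[abs_def] L_def)
  have deriv_h: "deriv (h c) z = deriv f z + c * deriv g z" if "cmod z < 1" for c z
  proof -
    have "f field_differentiable at z" "g field_differentiable at z"
      using f g that by (auto intro!: holomorphic_on_imp_differentiable_at[OF D_hol])
    then show ?thesis
      by (simp add: h_def plus_fun_def fun_scale_def deriv_add deriv_cmult field_differentiable_mult
          field_differentiable_const)
  qed
  have eq: "indicator (ball 0 1) z *\<^sub>R (deriv f z * cnj (deriv g z) * complex_of_real (poisson \<mu> z))
      = (E 1 z - E (-1) z + \<i> * E \<i> z - \<i> * E (-\<i>) z) / 4" for z
  proof (cases "cmod z < 1")
    case True
    have "E c z = (deriv f z + c * deriv g z) * cnj (deriv f z + c * deriv g z) * of_real (poisson \<mu> z)" for c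
      using True by (simp only: E_def energy_density_def indicator_simps mem_ball dist_0_norm
          deriv_h[OF True] of_real_mult complex_norm_square scaleR_one)
    then show ?thesis
      using True by (subst polarization) (simp add: algebra_simps)
  qed (simp add: E_def energy_density_def)
  have "has_bochner_integral disc_area (\<lambda>z. (E 1 z - E (-1) z + \<i> * E \<i> z - \<i> * E (-\<i>) z) / 4)
      ((L 1 - L (-1) + \<i> * L \<i> - \<i> * L (-\<i>)) / 4)"
    by (intro has_bochner_integral_divide_zero has_bochner_integral_diff has_bochner_integral_add
        has_bochner_integral_mult_right E)
  then have "set_lebesgue_integral disc_area (ball 0 1)
       (\<lambda>z. deriv f z * cnj (deriv g z) * complex_of_real (poisson \<mu> z)) = (L 1 - L (-1) + \<i> * L \<i> - \<i> * L (-\<i>)) / 4"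
    unfolding set_lebesgue_integral_def eq by (rule has_bochner_integral_integral_eq)
  also have "\<dots> = (\<Sum>n. local_term \<zeta>1 (tc f) (tc g) n) + (\<Sum>n. local_term \<zeta>2 (tc f) (tc g) n)"
  proof -
    have pol: "(\<Sum>n. local_term \<zeta> (tc f) (tc g) n) = ((\<Sum>n. local_term \<zeta> (tc (h 1)) (tc (h 1)) n)
        - (\<Sum>n. local_term \<zeta> (tc (h (-1))) (tc (h (-1))) n) + \<i> * (\<Sum>n. local_term \<zeta> (tc (h \<i>)) (tc (h \<i>)) n)
        - \<i> * (\<Sum>n. local_term \<zeta> (tc (h (-\<i>))) (tc (h (-\<i>))) n)) / 4"
      if \<zeta>: "\<zeta> \<in> {\<zeta>1, \<zeta>2}" for \<zeta>
    proof -
      have loc: "local_dirichlet \<zeta> (tc (h c))" for c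
        using \<zeta> D_local[OF h] by auto
      have dp: "deriv_psum \<zeta> (tc (h c)) n = deriv_psum \<zeta> (tc f) n + c * deriv_psum \<zeta> (tc g) n" for c n
        unfolding tc_h by (simp add: deriv_psum_add deriv_psum_scale)
      have lt_eq: "local_term \<zeta> (tc f) (tc g) n = (local_term \<zeta> (tc (h 1)) (tc (h 1)) n
          - local_term \<zeta> (tc (h (-1))) (tc (h (-1))) n + \<i> * local_term \<zeta> (tc (h \<i>)) (tc (h \<i>)) n
          - \<i> * local_term \<zeta> (tc (h (-\<i>))) (tc (h (-\<i>))) n) / 4" for n
      proof -
        let ?x = "deriv_psum \<zeta> (tc f) n" and ?y = "deriv_psum \<zeta> (tc g) n"
        have "?x * cnj ?y / w = (A / w - B / w + \<i> * (C / w) - \<i> * (E / w)) / 4"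
          if "?x * cnj ?y = (A - B + \<i> * C - \<i> * E) / 4" for w A B C E
          by (simp add: that add_divide_distrib diff_divide_distrib mult.commute)
        then show ?thesis
          unfolding local_term_def dp by this (subst polarization, simp)
      qed
      have "local_term \<zeta> (tc (h c)) (tc (h c)) sums (\<Sum>n. local_term \<zeta> (tc (h c)) (tc (h c)) n)" for c
        by (intro summable_sums summable_local_term loc)
      then show ?thesis
        unfolding lt_eq by (intro sums_unique[symmetric] sums_divide sums_diff sums_add sums_mult)
    qed
    show ?thesis
      unfolding pol[OF insertI1] pol[OF insertI2[OF singletonI]] L_def
      by (simp add: add_divide_distrib diff_divide_distrib algebra_simps)
  qed
  finally show ?thesis by (simp add: Dinner_def hardy_inner_def add.assoc)
qed

lemma tc_diff:
  assumes "f \<in> D" "g \<in> D"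
  shows "tc (f - g) = (\<lambda>n. tc f n - tc g n)"
proof -
  have eq: "f - g = f + fun_scale (-1) g" by (simp add: fun_eq_iff fun_scale_def)
  show ?thesis unfolding eq using assms by (simp add: tc_add tc_scale D_scale)
qed

lemma Dinner_sums:
  assumes "f \<in> D" "g \<in> D"
  shows "(\<lambda>n. tc f n * cnj (tc g n) + local_term \<zeta>1 (tc f) (tc g) n + local_term \<zeta>2 (tc f) (tc g) n)
    sums Dinner \<mu> f g"
  unfolding Dinner_eq[OF assms] using assms
  by (intro sums_add summable_sums summable_mult_cnj D_square_summable summable_local_term D_local)

lemma D_weighted_sq: "f \<in> D \<Longrightarrow> summable (weighted_sq \<zeta>1 \<zeta>2 (tc f))"
  by (simp add: summable_weighted_sq_iff[OF \<zeta>1 \<zeta>2] D_local)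

lemma Dinner_self:
  assumes "f \<in> D"
  shows "Dinner \<mu> f f = of_real (\<Sum>n. weighted_sq \<zeta>1 \<zeta>2 (tc f) n)"
proof -
  have "(\<lambda>n. complex_of_real (weighted_sq \<zeta>1 \<zeta>2 (tc f) n)) sums Dinner \<mu> f f"
    using Dinner_sums[OF assms assms]
    unfolding weighted_sq_def of_real_add local_term_self complex_norm_square[of "tc f _"] .
  moreover have "(\<lambda>n. complex_of_real (weighted_sq \<zeta>1 \<zeta>2 (tc f) n)) sums
      of_real (\<Sum>n. weighted_sq \<zeta>1 \<zeta>2 (tc f) n)"
    by (intro sums_of_real summable_sums D_weighted_sq assms)
  ultimately show ?thesis by (rule sums_unique2)
qed

lemma Dspace_complex_hilbert_space: "complex_hilbert_space fun_scale D (Dinner \<mu>)"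
proof (intro complex_hilbert_space.intro vector_space_fun_scale complex_hilbert_space_axioms.intro)
  interpret V: vector_space fun_scale by (rule vector_space_fun_scale)
  \<comment> \<open>Any element yields the zero function on scaling by 0; the zero coefficient
    sequence supplies one.\<close>
  obtain f0 where "f0 \<in> D" using D_exists[of "\<lambda>_. 0"] by (auto simp: local_dirichlet_def deriv_psum_def)
  then have zero: "0 \<in> D" using D_scale[of f0 0] by simp
  show sub: "V.subspace D" by (rule V.subspaceI) (simp_all add: zero D_add D_scale)
  show "Dinner \<mu> (f + g) h = Dinner \<mu> f h + Dinner \<mu> g h" if "f \<in> D" "g \<in> D" "h \<in> D" for f g h
  proof (rule sums_unique2[OF Dinner_sums])
    show "(\<lambda>n. tc (f + g) n * cnj (tc h n) + local_term \<zeta>1 (tc (f + g)) (tc h) n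
        + local_term \<zeta>2 (tc (f + g)) (tc h) n) sums (Dinner \<mu> f h + Dinner \<mu> g h)"
    proof -
      have "tc (f + g) n * cnj (tc h n) + local_term \<zeta>1 (tc (f + g)) (tc h) n + local_term \<zeta>2 (tc (f + g)) (tc h) n
        = (tc f n * cnj (tc h n) + local_term \<zeta>1 (tc f) (tc h) n + local_term \<zeta>2 (tc f) (tc h) n)
        + (tc g n * cnj (tc h n) + local_term \<zeta>1 (tc g) (tc h) n + local_term \<zeta>2 (tc g) (tc h) n)" for n
        using that by (simp add: tc_add local_term_def deriv_psum_add add_divide_distrib algebra_simps)
      then show ?thesis
        using sums_add[OF Dinner_sums[OF that(1,3)] Dinner_sums[OF that(2,3)]] by simp
    qed
  qed (use that D_add in auto)
  show "Dinner \<mu> (fun_scale c f) g = c * Dinner \<mu> f g" if "f \<in> D" "g \<in> D" for c f g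
  proof (rule sums_unique2[OF Dinner_sums])
    show "(\<lambda>n. tc (fun_scale c f) n * cnj (tc g n) + local_term \<zeta>1 (tc (fun_scale c f)) (tc g) n
        + local_term \<zeta>2 (tc (fun_scale c f)) (tc g) n) sums (c * Dinner \<mu> f g)"
      using sums_mult[OF Dinner_sums[OF that], of c] that
      by (simp add: tc_scale local_term_def deriv_psum_scale distrib_left mult.assoc)
  qed (use that D_scale in auto)
  show "Dinner \<mu> g f = cnj (Dinner \<mu> f g)" if "f \<in> D" "g \<in> D" for f g
  proof (rule sums_unique2[OF Dinner_sums])
    show "(\<lambda>n. tc g n * cnj (tc f n) + local_term \<zeta>1 (tc g) (tc f) n
        + local_term \<zeta>2 (tc g) (tc f) n) sums cnj (Dinner \<mu> f g)"
      using iffD2[OF sums_cnj Dinner_sums[OF that]]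
      by (simp add: local_term_def mult.commute)
  qed (use that in auto)
  show "0 < Re (Dinner \<mu> f f)" if "f \<in> D" "f \<noteq> 0" for f
  proof -
    have "tc f \<noteq> tc 0" using D_eqI[OF that(1) zero] that(2) by blast
    moreover have "tc 0 = (\<lambda>n. 0)" using tc_scale[OF \<open>f0 \<in> D\<close>, of 0] by simp
    ultimately obtain n where "tc f n \<noteq> 0" by (auto simp: fun_eq_iff)
    then have "0 < weighted_sq \<zeta>1 \<zeta>2 (tc f) n"
      unfolding weighted_sq_def by (intro add_pos_nonneg) auto
    then have "0 < (\<Sum>n. weighted_sq \<zeta>1 \<zeta>2 (tc f) n)"
      by (intro suminf_pos2[OF D_weighted_sq[OF that(1)]]) auto
    then show ?thesis by (simp add: Dinner_self that)
  qed
  fix X :: "nat \<Rightarrow> complex \<Rightarrow> complex"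
  assume X: "X n \<in> D" for n
  assume cauchy: "\<exists>N. \<forall>m\<ge>N. \<forall>n\<ge>N. ip_norm (Dinner \<mu>) (X m - X n) < e" if "e > 0" for e
  have diff: "f - g \<in> D" if "f \<in> D" "g \<in> D" for f g using V.subspace_diff[OF sub that] .
  have norm: "ip_norm (Dinner \<mu>) (f - g) = sqrt (\<Sum>k. weighted_sq \<zeta>1 \<zeta>2 (\<lambda>k. tc f k - tc g k) k)"
    if "f \<in> D" "g \<in> D" for f g
    using that by (simp add: ip_norm_def Dinner_self diff tc_diff)
  have "\<exists>a. (\<exists>m. summable (weighted_sq \<zeta>1 \<zeta>2 (\<lambda>k. tc (X m) k - a k))) \<and>
    (\<lambda>m. \<Sum>k. weighted_sq \<zeta>1 \<zeta>2 (\<lambda>k. tc (X m) k - a k) k) \<longlonglongrightarrow> 0"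
  proof (rule weighted_sq_complete)
    show "summable (weighted_sq \<zeta>1 \<zeta>2 (\<lambda>k. tc (X m) k - tc (X n) k))" for m n
      using D_weighted_sq[OF diff[OF X[of m] X[of n]]] X by (simp add: tc_diff)
    fix e :: real assume "e > 0"
    then obtain N where "\<And>m n. m \<ge> N \<Longrightarrow> n \<ge> N \<Longrightarrow> ip_norm (Dinner \<mu>) (X m - X n) < sqrt e"
      using cauchy[of "sqrt e"] by auto
    then show "\<exists>N. \<forall>m\<ge>N. \<forall>n\<ge>N. (\<Sum>k. weighted_sq \<zeta>1 \<zeta>2 (\<lambda>k. tc (X m) k - tc (X n) k) k) < e"
      by (auto simp: norm X)
  qed
  then obtain a m where sm: "summable (weighted_sq \<zeta>1 \<zeta>2 (\<lambda>k. tc (X m) k - a k))"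
    and lim: "(\<lambda>m. \<Sum>k. weighted_sq \<zeta>1 \<zeta>2 (\<lambda>k. tc (X m) k - a k) k) \<longlonglongrightarrow> 0" by blast
  \<comment> \<open>The limit sequence is the coefficient sequence of \<open>X m\<close> minus a
    difference of finite norm, so it belongs to a function of the space.\<close>
  have "local_dirichlet \<zeta> a" if "local_dirichlet \<zeta> (\<lambda>k. tc (X m) k - a k)" "local_dirichlet \<zeta> (tc (X m))" for \<zeta>
    using local_dirichlet_add[OF that(2) local_dirichlet_scale[OF that(1), of "-1"]] by simp
  then obtain f where f: "f \<in> D" "tc f = a"
    using D_exists[of a] sm D_local[OF X[of m]] by (auto simp: summable_weighted_sq_iff[OF \<zeta>1 \<zeta>2])
  have "(\<lambda>n. ip_norm (Dinner \<mu>) (X n - f)) \<longlonglongrightarrow> sqrt 0"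
    unfolding norm[OF X f(1)] f(2) by (intro tendsto_intros lim)
  then show "\<exists>f\<in>D. (\<lambda>n. ip_norm (Dinner \<mu>) (X n - f)) \<longlonglongrightarrow> 0"
    using f(1) by auto
qed

text \<open>The quadratic estimate \<open>quad\<close> bounds the boundary value by 2 on vectors of
  norm 1; homogeneity extends this to all vectors with the constant 2.\<close>

lemma boundary_value_bounded:
  assumes "\<zeta> \<in> {\<zeta>1, \<zeta>2}"
  shows "\<exists>C. \<forall>f\<in>D. cmod (boundary_value \<zeta> (tc f)) \<le> C * ip_norm (Dinner \<mu>) f"
proof (intro exI ballI)
  interpret complex_hilbert_space fun_scale D "Dinner \<mu>" by (rule Dspace_complex_hilbert_space)
  have loc: "local_dirichlet \<zeta> (tc f)" if "f \<in> D" for f using assms that D_local by auto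
  have quad: "cmod (boundary_value \<zeta> (tc f)) \<le> 1 + Re (Dinner \<mu> f f)" if f: "f \<in> D" for f
  proof -
    let ?S = "\<Sum>n. (cmod (deriv_psum \<zeta> (tc f) n))\<^sup>2 / (real n * (real n + 1))"
    note sm = D_weighted_sq[OF f]
    have sz: "summable (\<lambda>n. (cmod (deriv_psum \<zeta> (tc f) n))\<^sup>2 / (real n * (real n + 1)))"
      using loc[OF f] by (simp add: local_dirichlet_def)
    have Re: "Re (Dinner \<mu> f f) = (\<Sum>n. weighted_sq \<zeta>1 \<zeta>2 (tc f) n)" by (simp add: Dinner_self f)
    have "?S \<le> Re (Dinner \<mu> f f)"
      unfolding Re by (rule suminf_le[OF _ sz sm]) (use assms in \<open>auto simp: weighted_sq_def\<close>)
    moreover have "(cmod (tc f 0))\<^sup>2 \<le> Re (Dinner \<mu> f f)"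
      unfolding Re using sum_le_suminf[OF sm, of "{0}"] by (simp add: weighted_sq_def)
    moreover have "cmod (tc f 0) \<le> ((cmod (tc f 0))\<^sup>2 + 1) / 2"
      using sum_squares_bound[of "cmod (tc f 0)" 1] by simp
    moreover have "b \<le> 1 + R" if "s \<le> R" "q \<le> R" "c \<le> (q + 1) / 2" "b \<le> c + (s + 1) / 2"
      for b c q s R :: real
      using that by argo
    ultimately show ?thesis
      using boundary_terms(2)[OF loc[OF f]] by blast
  qed
  fix f assume f: "f \<in> D"
  show "cmod (boundary_value \<zeta> (tc f)) \<le> 2 * ip_norm (Dinner \<mu>) f"
  proof (cases "f = 0")
    case True
    then have "tc f = (\<lambda>n. 0 * tc f n)" using tc_scale[OF f, of 0] by simp
    then have "boundary_value \<zeta> (tc f) = 0"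
      using boundary_value_scale[OF loc[OF f], of 0] by simp
    then show ?thesis using ip_norm_nonneg[OF f] by simp
  next
    case False
    define r where "r = ip_norm (Dinner \<mu>) f"
    have r: "r > 0" using ip_pos[OF f False] by (simp add: r_def ip_norm_def)
    let ?g = "fun_scale (of_real (1 / r)) f"
    have g: "?g \<in> D" using f by (rule D_scale)
    have "Dinner \<mu> ?g ?g = of_real (1 / r) * (of_real (1 / r) * Dinner \<mu> f f)"
      using f g by (simp add: ip_scale ip_scale_right)
    also have "Dinner \<mu> f f = of_real (r\<^sup>2)"
      using ip_self[OF f] by (simp add: r_def ip_norm_sq f)
    finally have "Re (Dinner \<mu> ?g ?g) = 1" using r by (simp add: power2_eq_square)
    then have "cmod (boundary_value \<zeta> (tc ?g)) \<le> 2" using quad[OF g] by simp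
    moreover have "cmod (boundary_value \<zeta> (tc ?g)) = cmod (boundary_value \<zeta> (tc f)) / r"
      using r by (simp only: tc_scale[OF f] boundary_value_scale[OF loc[OF f]] norm_mult norm_of_real) simp
    ultimately have "cmod (boundary_value \<zeta> (tc f)) / r \<le> 2" by (simp only:)
    then show ?thesis using r by (simp add: r_def[symmetric] pos_divide_le_eq)
  qed
qed

section \<open>The constant function and multiplication by the coordinate\<close>

definition one_disc :: "complex \<Rightarrow> complex" where
  "one_disc z = (if cmod z < 1 then 1 else 0)"

lemma tc_one_disc: "tc one_disc = (\<lambda>n. if n = 0 then 1 else 0)"
proof
  fix n
  have "(\<lambda>n. (if n = 0 then 1 else 0) * z ^ n) sums one_disc z" if "cmod z < 1" for z
    using sums_single[of 0 "\<lambda>n. z ^ n"] that by (simp add: one_disc_def if_distrib[of "\<lambda>x. x * _"] cong: if_cong)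
  then show "tc one_disc n = (if n = 0 then 1 else 0)" by (rule taylor_coeff_unique(2))
qed

lemma deriv_psum_one_disc [simp]: "deriv_psum \<zeta> (tc one_disc) n = 0"
  by (auto simp: deriv_psum_def tc_one_disc intro!: sum.neutral)

lemma one_disc_D: "one_disc \<in> D"
proof -
  obtain f where f: "f \<in> D" "tc f = tc one_disc"
    using D_exists[of "tc one_disc"] by (auto simp: local_dirichlet_def)
  have "f z = one_disc z" for z
  proof (cases "cmod z < 1")
    case True
    have "(\<lambda>n. tc one_disc n * z ^ n) sums f z"
      using taylor_coeff_sums[OF D_hol[OF f(1)] True] f(2) by simp
    moreover have "(\<lambda>n. tc one_disc n * z ^ n) sums one_disc z"
      using sums_single[of 0 "\<lambda>n. z ^ n"] True
      by (simp add: tc_one_disc one_disc_def if_distrib[of "\<lambda>x. x * _"] cong: if_cong)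
    ultimately show ?thesis by (rule sums_unique2)
  qed (simp add: D_zero[OF f(1)] one_disc_def)
  then have "f = one_disc" by (rule ext)
  then show ?thesis using f by simp
qed

text \<open>Constants have no Dirichlet energy, so only the Hardy part contributes. Hence the range
  of \<open>Mz\<close> is orthogonal to the constant function.\<close>

lemma Dinner_one_disc:
  assumes "f \<in> D"
  shows "Dinner \<mu> f one_disc = tc f 0"
proof -
  have lt: "local_term \<zeta> (tc f) (tc one_disc) = (\<lambda>n. 0)" for \<zeta>
    by (simp add: fun_eq_iff local_term_def)
  have "Dinner \<mu> f one_disc = (\<Sum>n. if n = 0 then tc f n else 0)"
    unfolding Dinner_eq[OF assms one_disc_D] lt
    by (simp add: tc_one_disc if_distrib[of cnj] if_distrib[of "\<lambda>x. _ * x"] cong: if_cong)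
  also have "\<dots> = tc f 0" using sums_single[of 0 "tc f"] by (simp add: sums_iff)
  finally show ?thesis .
qed

text \<open>The shift is isometric on the Hardy part, and each of the two local Dirichlet parts
  contributes one product of boundary values.\<close>

lemma Dinner_Mz:
  assumes f: "f \<in> D" and g: "g \<in> D"
  shows "Dinner \<mu> (Mz f) (Mz g) = Dinner \<mu> f g
    + boundary_value \<zeta>1 (tc f) * cnj (boundary_value \<zeta>1 (tc g))
    + boundary_value \<zeta>2 (tc f) * cnj (boundary_value \<zeta>2 (tc g))"
proof -
  have "(\<lambda>n. shift (tc f) (Suc n) * cnj (shift (tc g) (Suc n))) sums (\<Sum>n. tc f n * cnj (tc g n))"
    using f g by (simp add: summable_sums summable_mult_cnj D_square_summable)
  from sums_Suc[OF this]
  have "(\<lambda>n. shift (tc f) n * cnj (shift (tc g) n)) sums (\<Sum>n. tc f n * cnj (tc g n))" by simp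
  moreover note local_term_shift_sums[OF \<zeta>1 D_local(1)[OF f] D_local(1)[OF g]]
    local_term_shift_sums[OF \<zeta>2 D_local(2)[OF f] D_local(2)[OF g]]
  ultimately show ?thesis
    by (simp add: Dinner_eq D_Mz f g tc_Mz sums_iff)
qed

text \<open>The subtracted multiple of \<open>one_disc\<close> removes the value at 0, and the
  quotient by the coordinate has the backward shift of the coefficients, which keeps both local
  Dirichlet integrals finite.\<close>

lemma Mz_left_inverse:
  assumes f: "f \<in> D"
  shows "\<exists>g\<in>D. f - fun_scale (Dinner \<mu> f one_disc) one_disc = Mz g"
proof -
  interpret complex_hilbert_space fun_scale D "Dinner \<mu>" by (rule Dspace_complex_hilbert_space)
  obtain g where g: "g \<in> D" "tc g = (\<lambda>n. tc f (Suc n))"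
    using D_exists[of "\<lambda>n. tc f (Suc n)"] local_dirichlet_backward_shift D_local[OF f] \<zeta>1 \<zeta>2 by blast
  have "f - fun_scale (Dinner \<mu> f one_disc) one_disc = Mz g"
  proof (rule D_eqI)
    show "tc (f - fun_scale (Dinner \<mu> f one_disc) one_disc) = tc (Mz g)"
      using f g one_disc_D
      by (simp add: tc_diff D_scale tc_scale tc_Mz Dinner_one_disc)
         (auto simp: fun_eq_iff tc_one_disc shift_def split: nat.split)
  qed (use f g one_disc_D in \<open>simp_all add: D_scale D_Mz\<close>)
  then show ?thesis using g by blast
qed

theorem cauchy_dual_Mz_not_subnormal:
  assumes "\<zeta>1 * cnj \<zeta>2 \<noteq> \<zeta>2 * cnj \<zeta>1"
  shows "\<not> subnormal_in TYPE('k::ab_group_add) fun_scale D (Dinner \<mu>) (cauchy_dual D (Dinner \<mu>) Mz)"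
proof -
  interpret rank_two_defect fun_scale D "Dinner \<mu>" Mz "\<lambda>f. boundary_value \<zeta>1 (tc f)"
    "\<lambda>f. boundary_value \<zeta>2 (tc f)" \<zeta>1 \<zeta>2 one_disc
  proof (intro rank_two_defect.intro Dspace_complex_hilbert_space rank_two_defect_axioms.intro)
    show "boundary_value \<zeta>1 (tc one_disc) = 1" "boundary_value \<zeta>2 (tc one_disc) = 1"
      by (simp_all add: boundary_value_def) (simp_all add: tc_one_disc)
    show "Dinner \<mu> (Mz f) one_disc = 0" if "f \<in> D" for f
      using that by (simp add: Dinner_one_disc D_Mz tc_Mz)
  qed (use assms \<zeta>1 \<zeta>2 in \<open>simp_all add: D_Mz tc_add tc_scale tc_Mz boundary_value_add boundary_value_scale
      boundary_value_shift boundary_value_bounded D_local Dinner_Mz one_disc_D Mz_left_inverse\<close>)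
  show ?thesis by (rule cauchy_dual_not_subnormal)
qed

end

theorem theorem1p1:
  fixes \<zeta>1 \<zeta>2 :: complex and \<mu> :: "complex measure"
  assumes "\<zeta>1 \<in> sphere 0 1" and "\<zeta>2 \<in> sphere 0 1"
    and "vec_angle \<zeta>1 \<zeta>2 = pi / 2"
    and "\<mu> = add_measure (dirac \<zeta>1) (dirac \<zeta>2)"
  shows "\<not> subnormal_in TYPE('k::ab_group_add) fun_scale (Dspace \<mu>) (Dinner \<mu>)
           (cauchy_dual (Dspace \<mu>) (Dinner \<mu>) Mz)"
proof -
  have norm: "cmod \<zeta>1 = 1" "cmod \<zeta>2 = 1" using assms(1,2) by simp_all
  interpret two_point_dirichlet \<zeta>1 \<zeta>2 \<mu>
    by unfold_locales (use norm assms(4) in simp_all)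
  \<comment> \<open>Within these bounds \<open>cos\<close> inverts \<open>arccos\<close>, so the
    right angle yields a vanishing inner product.\<close>
  have "\<bar>inner \<zeta>1 \<zeta>2\<bar> \<le> 1" using Cauchy_Schwarz_ineq2[of \<zeta>1 \<zeta>2] norm by simp
  then have "inner \<zeta>1 \<zeta>2 = cos (arccos (inner \<zeta>1 \<zeta>2))" by (simp add: abs_le_iff)
  also have "arccos (inner \<zeta>1 \<zeta>2) = vec_angle \<zeta>1 \<zeta>2" using norm by (simp add: vec_angle_def)
  also have "cos \<dots> = 0" by (simp only: assms(3) cos_pi_half)
  finally have "Re (\<zeta>1 * cnj \<zeta>2) = 0" by (simp add: inner_complex_def)
  moreover have "\<zeta>1 * cnj \<zeta>2 \<noteq> 0" using norm by auto
  \<comment> \<open>A nonzero purely imaginary number differs from its conjugate.\<close>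
  ultimately have "\<zeta>1 * cnj \<zeta>2 \<noteq> cnj (\<zeta>1 * cnj \<zeta>2)" by (auto simp: complex_eq_iff)
  then show ?thesis by (intro cauchy_dual_Mz_not_subnormal) (simp add: mult.commute)
qed

end
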